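(* Let $p,q\in\mathbb C$ with $p\ne q$, and let $$S=\begin{bmatrix}1&0&0&p\\0&0&1&0\\0&1&0&0\\0&0&0&-1\end{bmatrix},\qquad R=\begin{bmatrix}1&0&0&q\\0&0&1&0\\0&1&0&0\\0&0&0&-1\end{bmatrix}.$$ For $n\geq 2$ let $\rho_n$ be the representation of the mixed doubles group $\mathsf{MD}_n$ on $(\mathbb C^2)^{\otimes n}$ given by $r_i\mapsto I_2^{\otimes(i-1)}\otimes R\otimes I_2^{\otimes(n-i-1)}$, $s_i\mapsto I_2^{\otimes(i-1)}\otimes S\otimes I_2^{\otimes(n-i-1)}$. Then the semisimple part of $\rho_n$ has the following structure: the composition factors of $\rho_n$ are, each with multiplicity exactly two, the representations $L_{(n-k,1^k)}$, $k=0,1,\dots,n-1$ (of dimensions $\binom{n-1}{k}$, a row of Pascal's triangle), where $L_{(n-k,1^k)}$ is the irreducible representation of the symmetric group $\Sigma_n$ labelled by the hook partition $(n-k,1^k)$, regarded as a representation of $\mathsf{MD}_n$ via the homomorphism $\mathsf{MD}_n\to\Sigma_n$ sending both $r_i$ and $s_i$ to the transposition $(i\ i{+}1)$.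
   Context: For $n\in\mathbb N$ the mixed doubles group $\mathsf{MD}_n$ is the group with generators $s_1,\dots,s_{n-1},r_1,\dots,r_{n-1}$ and relations $r_ir_{i+1}r_i=r_{i+1}r_ir_{i+1}$, $r_ir_{i+1}s_i=s_{i+1}r_ir_{i+1}$, $r_is_{i+1}s_i=s_{i+1}s_ir_{i+1}$, $s_is_{i+1}s_i=s_{i+1}s_is_{i+1}$, $s_i^2=1$, $r_i^2=1$, and $r_ir_j=r_jr_i$, $s_is_j=s_js_i$, $r_is_j=s_jr_i$ for $|i-j|>1$. The given pair $(R,S)$ does define a representation of $\mathsf{MD}_n$ by the stated formula for every $n$. *)

theory Defs
  imports "Jordan_Normal_Form.VS_Connect" "HOL-Algebra.Sym_Groups" "HOL-Algebra.AbelCoset"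
begin

hide_const (open) Multiset.mult Modules.module Modules.module_hom
hide_fact (open) Modules.module_hom_def

section \<open>Groups given by generators and relations\<close>

text \<open>The letter \<open>(x, True)\<close> stands for the generator \<open>x\<close> and \<open>(x, False)\<close> for its inverse.\<close>

type_synonym 'a gword = "('a \<times> bool) list"

definition gwords :: "'a set \<Rightarrow> 'a gword set" where
  "gwords X = lists (X \<times> UNIV)"

inductive_set pres_rel :: "'a set \<Rightarrow> ('a gword \<times> 'a gword) set \<Rightarrow> ('a gword \<times> 'a gword) set"
  for X Rels where
  refl: "w \<in> gwords X \<Longrightarrow> (w, w) \<in> pres_rel X Rels"
| sym: "(v, w) \<in> pres_rel X Rels \<Longrightarrow> (w, v) \<in> pres_rel X Rels"
| trans: "(u, v) \<in> pres_rel X Rels \<Longrightarrow> (v, w) \<in> pres_rel X Rels \<Longrightarrow> (u, w) \<in> pres_rel X Rels"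
| cancel: "u \<in> gwords X \<Longrightarrow> v \<in> gwords X \<Longrightarrow> x \<in> X \<Longrightarrow>
    (u @ (x, b) # (x, \<not> b) # v, u @ v) \<in> pres_rel X Rels"
| rel: "u \<in> gwords X \<Longrightarrow> v \<in> gwords X \<Longrightarrow> l \<in> gwords X \<Longrightarrow> r \<in> gwords X \<Longrightarrow> (l, r) \<in> Rels \<Longrightarrow>
    (u @ l @ v, u @ r @ v) \<in> pres_rel X Rels"

definition pres_class :: "'a set \<Rightarrow> ('a gword \<times> 'a gword) set \<Rightarrow> 'a gword \<Rightarrow> 'a gword set" where
  "pres_class X Rels w = pres_rel X Rels `` {w}"

definition presented_group :: "'a set \<Rightarrow> ('a gword \<times> 'a gword) set \<Rightarrow> 'a gword set monoid" where
  "presented_group X Rels =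
    \<lparr>carrier = gwords X // pres_rel X Rels,
     mult = (\<lambda>A B. \<Union>a\<in>A. \<Union>b\<in>B. pres_class X Rels (a @ b)),
     one = pres_class X Rels []\<rparr>"

fun eval_gword :: "('g, 'c) monoid_scheme \<Rightarrow> ('a \<Rightarrow> 'g) \<Rightarrow> 'a gword \<Rightarrow> 'g" where
  "eval_gword G f [] = \<one>\<^bsub>G\<^esub>"
| "eval_gword G f ((x, b) # w) = (if b then f x else inv\<^bsub>G\<^esub> (f x)) \<otimes>\<^bsub>G\<^esub> eval_gword G f w"

text \<open>The homomorphism out of a presented group induced by an assignment \<open>f\<close> of the generators.
  All words in a class have the same value when \<open>f\<close> respects the relations, see
  \<open>pres_lift_hom\<close> below.\<close>

definition pres_lift :: "('g, 'c) monoid_scheme \<Rightarrow> ('a \<Rightarrow> 'g) \<Rightarrow> 'a gword set \<Rightarrow> 'g" where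
  "pres_lift G f A = the_elem (eval_gword G f ` A)"

lemma pres_rel_gwords: "(u, v) \<in> pres_rel X Rels \<Longrightarrow> u \<in> gwords X \<and> v \<in> gwords X"
  by (induction rule: pres_rel.induct) (auto simp: gwords_def)

lemma gwords_append [simp]: "u @ v \<in> gwords X \<longleftrightarrow> u \<in> gwords X \<and> v \<in> gwords X"
  by (auto simp: gwords_def)

lemma gwords_Nil [simp]: "[] \<in> gwords X"
  by (auto simp: gwords_def)

lemma gwords_Cons [simp]: "a # v \<in> gwords X \<longleftrightarrow> fst a \<in> X \<and> v \<in> gwords X"
  by (cases a) (auto simp: gwords_def)

lemma equiv_pres_rel: "equiv (gwords X) (pres_rel X Rels)"
proof (rule equivI)
  show "pres_rel X Rels \<subseteq> gwords X \<times> gwords X"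
    using pres_rel_gwords by fastforce
  show "refl_on (gwords X) (pres_rel X Rels)"
    by (rule refl_onI) (use pres_rel_gwords in \<open>auto intro: pres_rel.refl\<close>)
  show "sym (pres_rel X Rels)" by (rule symI) (rule pres_rel.sym)
  show "trans (pres_rel X Rels)" by (rule transI) (rule pres_rel.trans)
qed

lemma pres_rel_append_left:
  "(u, v) \<in> pres_rel X Rels \<Longrightarrow> w \<in> gwords X \<Longrightarrow> (w @ u, w @ v) \<in> pres_rel X Rels"
proof (induction rule: pres_rel.induct)
  case (cancel u v x b)
  then show ?case using pres_rel.cancel[of "w @ u" X v x b] by simp
next
  case (rel u v l r)
  then show ?case using pres_rel.rel[of "w @ u" X v l r] by simp
next
  case (trans u v w')
  then show ?case by (meson pres_rel.trans)
qed (simp_all add: pres_rel.refl pres_rel.sym)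

lemma pres_rel_append_right:
  "(u, v) \<in> pres_rel X Rels \<Longrightarrow> w \<in> gwords X \<Longrightarrow> (u @ w, v @ w) \<in> pres_rel X Rels"
proof (induction rule: pres_rel.induct)
  case (cancel u v x b)
  then show ?case using pres_rel.cancel[of u X "v @ w" x b] by simp
next
  case (rel u v l r)
  then show ?case using pres_rel.rel[of u X "v @ w" l r] by simp
next
  case (trans u v w')
  then show ?case by (meson pres_rel.trans)
qed (simp_all add: pres_rel.refl pres_rel.sym)

lemma pres_rel_append:
  "(u, u') \<in> pres_rel X Rels \<Longrightarrow> (v, v') \<in> pres_rel X Rels \<Longrightarrow> (u @ v, u' @ v') \<in> pres_rel X Rels"
  by (meson pres_rel_append_left pres_rel_append_right pres_rel_gwords pres_rel.trans)

lemma pres_class_eq: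
  "u \<in> gwords X \<Longrightarrow> v \<in> gwords X \<Longrightarrow>
    pres_class X Rels u = pres_class X Rels v \<longleftrightarrow> (u, v) \<in> pres_rel X Rels"
  unfolding pres_class_def using eq_equiv_class_iff[OF equiv_pres_rel] by blast

lemma carrier_presented_group: "carrier (presented_group X Rels) = pres_class X Rels ` gwords X"
  by (auto simp: presented_group_def quotient_def pres_class_def)

lemma mult_presented_group:
  assumes "u \<in> gwords X" "v \<in> gwords X"
  shows "pres_class X Rels u \<otimes>\<^bsub>presented_group X Rels\<^esub> pres_class X Rels v = pres_class X Rels (u @ v)"
proof -
  have "pres_class X Rels (a @ b) = pres_class X Rels (u @ v)"
    if "(u, a) \<in> pres_rel X Rels" "(v, b) \<in> pres_rel X Rels" for a b
    using that assms pres_rel_gwords[OF that(1)] pres_rel_gwords[OF that(2)]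
      pres_rel.sym[OF pres_rel_append[OF that]]
    by (subst pres_class_eq) simp_all
  moreover have "(u, u) \<in> pres_rel X Rels" "(v, v) \<in> pres_rel X Rels"
    using assms by (auto intro: pres_rel.refl)
  ultimately have "(\<Union>a\<in>pres_class X Rels u. \<Union>b\<in>pres_class X Rels v. pres_class X Rels (a @ b)) =
      pres_class X Rels (u @ v)"
    unfolding pres_class_def[of X Rels u] pres_class_def[of X Rels v] by blast
  then show ?thesis
    by (simp add: presented_group_def)
qed

lemma one_presented_group: "\<one>\<^bsub>presented_group X Rels\<^esub> = pres_class X Rels []"
  by (simp add: presented_group_def)

lemma gword_inverse:
  assumes "w \<in> gwords X"
  shows "\<exists>v\<in>gwords X. (v @ w, []) \<in> pres_rel X Rels"
  using assms
proof (induction w)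
  case Nil
  then show ?case by (auto intro!: bexI[of _ "[]"] pres_rel.refl)
next
  case (Cons a w)
  obtain x b where a: "a = (x, b)" by fastforce
  from Cons obtain v where v: "v \<in> gwords X" "(v @ w, []) \<in> pres_rel X Rels" by auto
  have "(v @ (x, \<not> b) # (x, b) # w, v @ w) \<in> pres_rel X Rels"
    using pres_rel.cancel[of v X w x "\<not> b"] v Cons.prems a by simp
  then have "((v @ [(x, \<not> b)]) @ a # w, []) \<in> pres_rel X Rels"
    using pres_rel.trans[OF _ v(2)] a by simp
  moreover have "v @ [(x, \<not> b)] \<in> gwords X" using v Cons.prems a by simp
  ultimately show ?case by blast
qed

lemma group_presented_group: "group (presented_group X Rels)"
proof (rule groupI)
  fix x assume "x \<in> carrier (presented_group X Rels)"
  then obtain w where w: "w \<in> gwords X" "x = pres_class X Rels w"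
    by (auto simp: carrier_presented_group)
  then obtain v where v: "v \<in> gwords X" "(v @ w, []) \<in> pres_rel X Rels"
    using gword_inverse by blast
  then show "\<exists>y\<in>carrier (presented_group X Rels). y \<otimes>\<^bsub>presented_group X Rels\<^esub> x = \<one>\<^bsub>presented_group X Rels\<^esub>"
    using w by (intro bexI[of _ "pres_class X Rels v"])
      (auto simp: carrier_presented_group mult_presented_group one_presented_group pres_class_eq)
qed (auto simp: carrier_presented_group mult_presented_group one_presented_group)

context
  fixes G :: "('g, 'c) monoid_scheme" (structure) and X :: "'a set"
    and Rels :: "('a gword \<times> 'a gword) set" and f :: "'a \<Rightarrow> 'g"
  assumes G: "group G" and f: "f \<in> X \<rightarrow> carrier G"
    and resp: "\<And>l r. (l, r) \<in> Rels \<Longrightarrow> l \<in> gwords X \<Longrightarrow> r \<in> gwords X \<Longrightarrow> eval_gword G f l = eval_gword G f r"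
begin

interpretation group G by (rule G)

lemma gen_closed: "x \<in> X \<Longrightarrow> f x \<in> carrier G"
  using f by auto

lemma eval_gword_closed: "w \<in> gwords X \<Longrightarrow> eval_gword G f w \<in> carrier G"
  by (induction w) (auto simp: gen_closed)

lemma eval_gword_append:
  "u \<in> gwords X \<Longrightarrow> v \<in> gwords X \<Longrightarrow> eval_gword G f (u @ v) = eval_gword G f u \<otimes> eval_gword G f v"
proof (induction u)
  case (Cons a u)
  have "f (fst a) \<in> carrier G" using Cons f by auto
  with Cons show ?case by (cases a) (auto simp: eval_gword_closed m_assoc)
qed (auto simp: eval_gword_closed)

lemma eval_gword_pres_rel: "(u, v) \<in> pres_rel X Rels \<Longrightarrow> eval_gword G f u = eval_gword G f v"
proof (induction rule: pres_rel.induct)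
  case (cancel u v x b)
  then have x: "f x \<in> carrier G" and v: "eval_gword G f v \<in> carrier G"
    by (auto simp: gen_closed eval_gword_closed)
  have "f x \<otimes> (inv (f x) \<otimes> eval_gword G f v) = eval_gword G f v"
    "inv (f x) \<otimes> (f x \<otimes> eval_gword G f v) = eval_gword G f v"
    using x v by (simp_all add: m_assoc[symmetric])
  then show ?case
    using cancel by (cases b) (simp_all add: eval_gword_append)
next
  case (rel u v l r)
  then show ?case
    using resp[of l r] by (simp add: eval_gword_append)
qed simp_all

lemma pres_lift_class:
  assumes "w \<in> gwords X"
  shows "pres_lift G f (pres_class X Rels w) = eval_gword G f w"
proof -
  have "eval_gword G f v = eval_gword G f w" if "v \<in> pres_class X Rels w" for v
    using that eval_gword_pres_rel[of w v] by (simp add: pres_class_def)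
  moreover have "w \<in> pres_class X Rels w"
    using pres_rel.refl[OF assms] by (simp add: pres_class_def)
  ultimately have "eval_gword G f ` pres_class X Rels w = {eval_gword G f w}"
    by blast
  then show ?thesis by (simp add: pres_lift_def)
qed

lemma pres_lift_hom: "pres_lift G f \<in> hom (presented_group X Rels) G"
  by (rule homI)
    (auto simp: carrier_presented_group mult_presented_group pres_lift_class eval_gword_closed eval_gword_append)

lemma pres_lift_gen: "x \<in> X \<Longrightarrow> pres_lift G f (pres_class X Rels [(x, True)]) = f x"
  by (subst pres_lift_class) (auto simp: gen_closed)

end

section \<open>Complex representations of groups\<close>

record ('g, 'v) rep = "(complex, 'v) module" +
  act :: "'g \<Rightarrow> 'v \<Rightarrow> 'v"

definition mk_rep :: "(complex, 'v) module \<Rightarrow> ('g \<Rightarrow> 'v \<Rightarrow> 'v) \<Rightarrow> ('g, 'v) rep" where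
  "mk_rep M \<pi> = \<lparr>carrier = carrier M, mult = monoid.mult M, one = one M, zero = zero M,
     add = add M, smult = smult M, act = \<pi>\<rparr>"

definition representation :: "('g, 'c) monoid_scheme \<Rightarrow> ('g, 'v) rep \<Rightarrow> bool" where
  "representation G V \<longleftrightarrow>
     group G \<and> vectorspace class_ring V \<and>
     (\<forall>g\<in>carrier G. act V g \<in> module_hom class_ring V V) \<and>
     (\<forall>v\<in>carrier V. act V \<one>\<^bsub>G\<^esub> v = v) \<and>
     (\<forall>g\<in>carrier G. \<forall>h\<in>carrier G. \<forall>v\<in>carrier V. act V (g \<otimes>\<^bsub>G\<^esub> h) v = act V g (act V h v))"

definition invariant_subspace :: "('g, 'c) monoid_scheme \<Rightarrow> ('g, 'v) rep \<Rightarrow> 'v set \<Rightarrow> bool" where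
  "invariant_subspace G V W \<longleftrightarrow>
     VectorSpace.subspace class_ring W V \<and> (\<forall>g\<in>carrier G. act V g ` W \<subseteq> W)"

definition irreducible_rep :: "('g, 'c) monoid_scheme \<Rightarrow> ('g, 'v) rep \<Rightarrow> bool" where
  "irreducible_rep G V \<longleftrightarrow>
     representation G V \<and> carrier V \<noteq> {\<zero>\<^bsub>V\<^esub>} \<and>
     (\<forall>W. invariant_subspace G V W \<longrightarrow> W = {\<zero>\<^bsub>V\<^esub>} \<or> W = carrier V)"

definition rep_iso :: "('g, 'c) monoid_scheme \<Rightarrow> ('g, 'v) rep \<Rightarrow> ('g, 'w) rep \<Rightarrow> bool" where
  "rep_iso G V W \<longleftrightarrow>
     (\<exists>f\<in>module_hom class_ring V W. bij_betw f (carrier V) (carrier W) \<and>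
        (\<forall>g\<in>carrier G. \<forall>v\<in>carrier V. f (act V g v) = act W g (f v)))"

text \<open>The quotient \<open>V/W\<close>, whose elements are the cosets of \<open>W\<close>.  In the scalar multiplication,
  \<open>c\<cdot>X\<close> is a coset already if \<open>c \<noteq> 0\<close>; adding \<open>W\<close> takes care of \<open>c = 0\<close>.\<close>

definition quot_rep :: "('g, 'v) rep \<Rightarrow> 'v set \<Rightarrow> ('g, 'v set) rep" where
  "quot_rep V W =
     \<lparr>carrier = a_rcosets\<^bsub>V\<^esub> W, mult = undefined, one = undefined, zero = W, add = set_add V,
      smult = (\<lambda>c X. W <+>\<^bsub>V\<^esub> ((\<lambda>x. c \<odot>\<^bsub>V\<^esub> x) ` X)), act = (\<lambda>g X. act V g ` X)\<rparr>"

text \<open>A composition series \<open>0 = W\<^sub>0 \<subseteq> \<dots> \<subseteq> W\<^sub>m = V\<close> is given by the list \<open>[W\<^sub>0, \<dots>, W\<^sub>m]\<close>;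
  its factors are \<open>W\<^bsub>i+1\<^esub>/W\<^sub>i\<close> for \<open>i < m\<close>.\<close>

definition series_factor :: "('g, 'v) rep \<Rightarrow> 'v set list \<Rightarrow> nat \<Rightarrow> ('g, 'v set) rep" where
  "series_factor V Ws i = quot_rep (V\<lparr>carrier := Ws ! Suc i\<rparr>) (Ws ! i)"

definition composition_series :: "('g, 'c) monoid_scheme \<Rightarrow> ('g, 'v) rep \<Rightarrow> 'v set list \<Rightarrow> bool" where
  "composition_series G V Ws \<longleftrightarrow>
     Ws \<noteq> [] \<and> hd Ws = {\<zero>\<^bsub>V\<^esub>} \<and> last Ws = carrier V \<and>
     (\<forall>W\<in>set Ws. invariant_subspace G V W) \<and>
     (\<forall>i. Suc i < length Ws \<longrightarrow>
        Ws ! i \<subseteq> Ws ! Suc i \<and> irreducible_rep G (series_factor V Ws i))"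

definition multiplicity_in_series ::
  "('g, 'c) monoid_scheme \<Rightarrow> ('g, 'v) rep \<Rightarrow> 'v set list \<Rightarrow> ('g, 'w) rep \<Rightarrow> nat" where
  "multiplicity_in_series G V Ws L =
     card {i. Suc i < length Ws \<and> rep_iso G (series_factor V Ws i) L}"


section \<open>Specht modules\<close>

text \<open>A partition is a weakly decreasing list of positive parts; boxes are pairs (row, column),
  counted from 0.  The entries of a tableau are \<open>1, \<dots>, n\<close> where \<open>n\<close> is the size of the
  partition; its values outside the diagram are irrelevant.  A tabloid is the list of the
  entry sets of the rows.\<close>

definition young_diagram :: "nat list \<Rightarrow> (nat \<times> nat) set" where
  "young_diagram lam = {(i, j). i < length lam \<and> j < lam ! i}"

definition tableau :: "nat list \<Rightarrow> (nat \<times> nat \<Rightarrow> nat) \<Rightarrow> bool" where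
  "tableau lam t \<longleftrightarrow> bij_betw t (young_diagram lam) {1..sum_list lam}"

definition tabloid :: "nat list \<Rightarrow> (nat \<times> nat \<Rightarrow> nat) \<Rightarrow> nat set list" where
  "tabloid lam t = map (\<lambda>i. t ` ({i} \<times> {..<lam ! i})) [0..<length lam]"

definition tabloids :: "nat list \<Rightarrow> nat set list set" where
  "tabloids lam = tabloid lam ` {t. tableau lam t}"

definition column_stabilizer :: "nat list \<Rightarrow> (nat \<times> nat \<Rightarrow> nat) \<Rightarrow> (nat \<Rightarrow> nat) set" where
  "column_stabilizer lam t =
     {\<sigma>. \<sigma> permutes {1..sum_list lam} \<and>
        (\<forall>(i, j)\<in>young_diagram lam. \<exists>i'. (i', j) \<in> young_diagram lam \<and> \<sigma> (t (i, j)) = t (i', j))}"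

text \<open>The permutation module with basis the tabloids, realised as the space of functions on
  tabloids.  The polytabloid of \<open>t\<close> is the sum of \<open>sign \<sigma> \<cdot> {\<sigma> t}\<close> over the column stabilizer.\<close>

definition perm_module :: "nat list \<Rightarrow> (complex, nat set list \<Rightarrow> complex) module" where
  "perm_module lam = ring.func_space class_ring (tabloids lam)"

definition polytabloid :: "nat list \<Rightarrow> (nat \<times> nat \<Rightarrow> nat) \<Rightarrow> nat set list \<Rightarrow> complex" where
  "polytabloid lam t =
     (\<lambda>T\<in>tabloids lam. \<Sum>\<sigma> | \<sigma> \<in> column_stabilizer lam t \<and> tabloid lam (\<sigma> \<circ> t) = T. of_int (sign \<sigma>))"

definition tabloid_act ::
  "nat list \<Rightarrow> (nat \<Rightarrow> nat) \<Rightarrow> (nat set list \<Rightarrow> complex) \<Rightarrow> nat set list \<Rightarrow> complex" where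
  "tabloid_act lam \<sigma> f = (\<lambda>T\<in>tabloids lam. f (map ((`) (inv' \<sigma>)) T))"

text \<open>The irreducible representation of the symmetric group labelled by \<open>lam\<close>; in this
  convention one-row partitions give trivial and one-column partitions sign representations.\<close>

definition specht :: "nat list \<Rightarrow> (nat \<Rightarrow> nat, nat set list \<Rightarrow> complex) rep" where
  "specht lam = mk_rep
     ((perm_module lam)\<lparr>carrier :=
        LinearCombinations.module.span class_ring (perm_module lam) (polytabloid lam ` {t. tableau lam t})\<rparr>)
     (tabloid_act lam)"

definition hook :: "nat \<Rightarrow> nat \<Rightarrow> nat list" where
  "hook n k = (n - k) # replicate k 1"


section \<open>The mixed doubles group\<close>

datatype md_gen = Rgen nat | Sgen nat

definition MD_gens :: "nat \<Rightarrow> md_gen set" where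
  "MD_gens n = Rgen ` {1..<n} \<union> Sgen ` {1..<n}"

abbreviation r_letter :: "nat \<Rightarrow> md_gen \<times> bool" where "r_letter i \<equiv> (Rgen i, True)"
abbreviation s_letter :: "nat \<Rightarrow> md_gen \<times> bool" where "s_letter i \<equiv> (Sgen i, True)"

definition MD_rels :: "nat \<Rightarrow> (md_gen gword \<times> md_gen gword) set" where
  "MD_rels n =
     (\<Union>i\<in>{i. 1 \<le> i \<and> i + 1 < n}.
       {([r_letter i, r_letter (i+1), r_letter i], [r_letter (i+1), r_letter i, r_letter (i+1)]),
        ([r_letter i, r_letter (i+1), s_letter i], [s_letter (i+1), r_letter i, r_letter (i+1)]),
        ([r_letter i, s_letter (i+1), s_letter i], [s_letter (i+1), s_letter i, r_letter (i+1)]),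
        ([s_letter i, s_letter (i+1), s_letter i], [s_letter (i+1), s_letter i, s_letter (i+1)])}) \<union>
     (\<Union>i\<in>{1..<n}. {([s_letter i, s_letter i], []), ([r_letter i, r_letter i], [])}) \<union>
     (\<Union>(i, j)\<in>{(i, j). i \<in> {1..<n} \<and> j \<in> {1..<n} \<and> (i + 1 < j \<or> j + 1 < i)}.
       {([r_letter i, r_letter j], [r_letter j, r_letter i]),
        ([s_letter i, s_letter j], [s_letter j, s_letter i]),
        ([r_letter i, s_letter j], [s_letter j, r_letter i])})"

definition MD :: "nat \<Rightarrow> md_gen gword set monoid" where
  "MD n = presented_group (MD_gens n) (MD_rels n)"

definition MD_r :: "nat \<Rightarrow> nat \<Rightarrow> md_gen gword set" where
  "MD_r n i = pres_class (MD_gens n) (MD_rels n) [r_letter i]"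

definition MD_s :: "nat \<Rightarrow> nat \<Rightarrow> md_gen gword set" where
  "MD_s n i = pres_class (MD_gens n) (MD_rels n) [s_letter i]"

definition MD_perm :: "nat \<Rightarrow> md_gen gword set \<Rightarrow> nat \<Rightarrow> nat" where
  "MD_perm n = pres_lift (sym_group n)
     (case_md_gen (\<lambda>i. Transposition.transpose i (i + 1)) (\<lambda>i. Transposition.transpose i (i + 1)))"

definition hook_rep :: "nat \<Rightarrow> nat \<Rightarrow> (md_gen gword set, nat set list \<Rightarrow> complex) rep" where
  "hook_rep n k = mk_rep (module.truncate (specht (hook n k)))
     (\<lambda>g. act (specht (hook n k)) (MD_perm n g))"


section \<open>The representation attached to a pair of matrices\<close>

text \<open>Kronecker product, so that \<open>(\<complex>\<^sup>2)\<^bsup>\<otimes>n\<^esup>\<close> is the space of vectors of length \<open>2\<^sup>n\<close>,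
  with the basis of elementary tensors ordered lexicographically.\<close>

definition kron :: "'a :: semiring_1 mat \<Rightarrow> 'a mat \<Rightarrow> 'a mat" where
  "kron A B = mat (dim_row A * dim_row B) (dim_col A * dim_col B)
     (\<lambda>(i, j). A $$ (i div dim_row B, j div dim_col B) * B $$ (i mod dim_row B, j mod dim_col B))"

primrec kron_pow :: "'a :: semiring_1 mat \<Rightarrow> nat \<Rightarrow> 'a mat" where
  "kron_pow A 0 = 1\<^sub>m 1"
| "kron_pow A (Suc m) = kron A (kron_pow A m)"

definition local_op :: "nat \<Rightarrow> nat \<Rightarrow> complex mat \<Rightarrow> complex mat" where
  "local_op n i A = kron (kron (kron_pow (1\<^sub>m 2) (i - 1)) A) (kron_pow (1\<^sub>m 2) (n - i - 1))"

definition GL :: "nat \<Rightarrow> complex mat monoid" where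
  "GL d = units_of (ring_mat TYPE(complex) d ())"

definition MD_mat :: "nat \<Rightarrow> complex mat \<Rightarrow> complex mat \<Rightarrow> md_gen gword set \<Rightarrow> complex mat" where
  "MD_mat n R S = pres_lift (GL (2 ^ n)) (case_md_gen (\<lambda>i. local_op n i R) (\<lambda>i. local_op n i S))"

definition MD_rep :: "nat \<Rightarrow> complex mat \<Rightarrow> complex mat \<Rightarrow> (md_gen gword set, complex vec) rep" where
  "MD_rep n R S = mk_rep (module_vec TYPE(complex) (2 ^ n)) (\<lambda>g v. MD_mat n R S g *\<^sub>v v)"


section \<open>Well-definedness\<close>

subsection \<open>The homomorphism to the symmetric group\<close>

lemma MD_gens_simps [simp]:
  "Rgen i \<in> MD_gens n \<longleftrightarrow> 1 \<le> i \<and> i < n" "Sgen i \<in> MD_gens n \<longleftrightarrow> 1 \<le> i \<and> i < n"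
  by (auto simp: MD_gens_def)

lemma group_MD: "group (MD n)"
  by (simp add: MD_def group_presented_group)

lemma transpose_braid:
  "Transposition.transpose i (Suc i) \<circ> (Transposition.transpose (Suc i) (Suc (Suc i)) \<circ> Transposition.transpose i (Suc i)) =
   Transposition.transpose (Suc i) (Suc (Suc i)) \<circ> (Transposition.transpose i (Suc i) \<circ> Transposition.transpose (Suc i) (Suc (Suc i)))"
  by (auto simp: fun_eq_iff Transposition.transpose_def)

lemma transpose_far:
  "Suc i < j \<or> Suc j < i \<Longrightarrow> Transposition.transpose i (Suc i) \<circ> Transposition.transpose j (Suc j) =
   Transposition.transpose j (Suc j) \<circ> Transposition.transpose i (Suc i)"
  by (auto simp: fun_eq_iff Transposition.transpose_def)

context
  fixes n :: nat
begin

private definition F where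
  "F = case_md_gen (\<lambda>i. Transposition.transpose i (i + 1)) (\<lambda>i. Transposition.transpose i (i + 1))"

private lemma F_closed: "F \<in> MD_gens n \<rightarrow> carrier (sym_group n)"
  by (auto simp: MD_gens_def F_def sym_group_def intro!: permutes_swap_id)

private lemma F_resp: "(l, r) \<in> MD_rels n \<Longrightarrow> eval_gword (sym_group n) F l = eval_gword (sym_group n) F r"
  unfolding MD_rels_def
  by (auto simp: F_def sym_group_mult sym_group_one transpose_braid transpose_far)

lemma MD_perm_hom: "MD_perm n \<in> hom (MD n) (sym_group n)"
  unfolding MD_perm_def MD_def F_def[symmetric]
  by (rule pres_lift_hom[OF sym_group_is_group F_closed F_resp])

lemma MD_perm_r: "1 \<le> i \<Longrightarrow> i < n \<Longrightarrow> MD_perm n (MD_r n i) = Transposition.transpose i (i + 1)"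
  unfolding MD_perm_def MD_r_def F_def[symmetric]
  by (subst pres_lift_gen[OF sym_group_is_group F_closed F_resp]) (auto simp: F_def)

lemma MD_perm_s: "1 \<le> i \<Longrightarrow> i < n \<Longrightarrow> MD_perm n (MD_s n i) = Transposition.transpose i (i + 1)"
  unfolding MD_perm_def MD_s_def F_def[symmetric]
  by (subst pres_lift_gen[OF sym_group_is_group F_closed F_resp]) (auto simp: F_def)

end


subsection \<open>Kronecker products\<close>

lemma kron_carrier [simp, intro]:
  "A \<in> carrier_mat a b \<Longrightarrow> B \<in> carrier_mat c d \<Longrightarrow> kron A B \<in> carrier_mat (a * c) (b * d)"
  by (auto simp: kron_def)

lemma dim_kron [simp]:
  "dim_row (kron A B) = dim_row A * dim_row B" "dim_col (kron A B) = dim_col A * dim_col B"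
  by (auto simp: kron_def)

lemma index_kron:
  "i < dim_row A * dim_row B \<Longrightarrow> j < dim_col A * dim_col B \<Longrightarrow>
    kron A B $$ (i, j) = A $$ (i div dim_row B, j div dim_col B) * B $$ (i mod dim_row B, j mod dim_col B)"
  by (simp add: kron_def)

lemma mod_less_of_mult: "(i::nat) < a * b \<Longrightarrow> i mod b < b"
  by (cases "b = 0") auto

lemma sum_div_mod:
  fixes h :: "nat \<Rightarrow> nat \<Rightarrow> 'a :: comm_monoid_add"
  shows "(\<Sum>k<b * e. h (k div e) (k mod e)) = (\<Sum>i<b. \<Sum>j<e. h i j)"
proof -
  have "(\<Sum>i<b. \<Sum>j<e. h i j) = (\<Sum>(i, j)\<in>{..<b} \<times> {..<e}. h i j)"
    by (simp add: sum.cartesian_product)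
  also have "\<dots> = (\<Sum>k<b * e. h (k div e) (k mod e))"
  proof (rule sum.reindex_bij_witness[where j = "\<lambda>(i, j). i * e + j" and i = "\<lambda>k. (k div e, k mod e)"])
    fix x assume "x \<in> {..<b} \<times> {..<e}"
    then obtain i j where x: "x = (i, j)" "i < b" "j < e" by auto
    have "i * e + j < (i + 1) * e" using x by simp
    also have "\<dots> \<le> b * e" using x by (intro mult_right_mono) auto
    finally show "(case x of (i, j) \<Rightarrow> i * e + j) \<in> {..<b * e}" using x by simp
  qed (auto simp: less_mult_imp_div_less intro: mod_less_of_mult)
  finally show ?thesis ..
qed

lemma kron_mult:
  fixes A B C D :: "'a :: comm_semiring_1 mat"
  assumes "A \<in> carrier_mat a b" "C \<in> carrier_mat b c" "B \<in> carrier_mat d e" "D \<in> carrier_mat e f"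
  shows "kron A B * kron C D = kron (A * C) (B * D)"
proof (rule eq_matI)
  fix i j assume "i < dim_row (kron (A * C) (B * D))" "j < dim_col (kron (A * C) (B * D))"
  then have ij: "i < a * d" "j < c * f" using assms by auto
  note dims = carrier_matD[OF assms(1)] carrier_matD[OF assms(2)] carrier_matD[OF assms(3)] carrier_matD[OF assms(4)]
  have div: "i div d < a" "j div f < c" "i mod d < d" "j mod f < f"
    using ij by (auto simp: less_mult_imp_div_less intro: mod_less_of_mult)
  have "(kron A B * kron C D) $$ (i, j) = (\<Sum>k<b * e. kron A B $$ (i, k) * kron C D $$ (k, j))"
    using ij by (simp add: dims scalar_prod_def atLeast0LessThan)
  also have "\<dots> = (\<Sum>k<b * e. (A $$ (i div d, k div e) * C $$ (k div e, j div f)) *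
      (B $$ (i mod d, k mod e) * D $$ (k mod e, j mod f)))"
  proof (intro sum.cong HOL.refl)
    fix k assume "k \<in> {..<b * e}"
    then have "kron A B $$ (i, k) = A $$ (i div d, k div e) * B $$ (i mod d, k mod e)"
      "kron C D $$ (k, j) = C $$ (k div e, j div f) * D $$ (k mod e, j mod f)"
      using ij by (simp_all add: index_kron dims)
    then show "kron A B $$ (i, k) * kron C D $$ (k, j) = (A $$ (i div d, k div e) * C $$ (k div e, j div f)) *
      (B $$ (i mod d, k mod e) * D $$ (k mod e, j mod f))"
      by (simp add: mult_ac)
  qed
  also have "\<dots> = (\<Sum>k<b. \<Sum>l<e. (A $$ (i div d, k) * C $$ (k, j div f)) *
      (B $$ (i mod d, l) * D $$ (l, j mod f)))"
    by (rule sum_div_mod)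
  also have "\<dots> = (\<Sum>k<b. A $$ (i div d, k) * C $$ (k, j div f)) *
      (\<Sum>l<e. B $$ (i mod d, l) * D $$ (l, j mod f))"
    by (simp add: sum_product)
  also have "\<dots> = kron (A * C) (B * D) $$ (i, j)"
    using ij div by (simp add: dims index_kron scalar_prod_def atLeast0LessThan)
  finally show "(kron A B * kron C D) $$ (i, j) = kron (A * C) (B * D) $$ (i, j)" .
qed (use assms in auto)

lemma kron_assoc: "kron (kron A B) C = kron A (kron B C)"
proof (rule eq_matI)
  fix i j assume ij: "i < dim_row (kron A (kron B C))" "j < dim_col (kron A (kron B C))"
  have i: "i < dim_row A * dim_row B * dim_row C" and j: "j < dim_col A * dim_col B * dim_col C"
    using ij by (auto simp: mult.assoc)
  have "i div dim_row C < dim_row A * dim_row B" "j div dim_col C < dim_col A * dim_col B"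
    using i j by (auto simp: less_mult_imp_div_less)
  moreover have "i mod (dim_row B * dim_row C) < dim_row B * dim_row C"
    "j mod (dim_col B * dim_col C) < dim_col B * dim_col C"
    using ij by (auto intro: mod_less_of_mult)
  moreover have d: "x div (b * c) = x div c div b" "x mod (b * c) div c = x div c mod b"
    "x mod (b * c) mod c = x mod c" for x b c :: nat
    by (cases "c = 0"; simp add: div_mult2_eq mult.commute[of b c] mod_mult2_eq)+
  ultimately show "kron (kron A B) C $$ (i, j) = kron A (kron B C) $$ (i, j)"
    using i j ij by (simp add: index_kron d mult.assoc)
qed (auto simp: mult.assoc)

lemma kron_one: "kron (1\<^sub>m a) (1\<^sub>m b) = 1\<^sub>m (a * b)"
proof (rule eq_matI)
  fix i j assume "i < dim_row (1\<^sub>m (a * b) :: 'a mat)" "j < dim_col (1\<^sub>m (a * b) :: 'a mat)"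
  then have ij: "i < a * b" "j < a * b" by auto
  have "i div b < a" "j div b < a" "i mod b < b" "j mod b < b"
    using ij by (auto simp: less_mult_imp_div_less intro: mod_less_of_mult)
  moreover have "i = j \<longleftrightarrow> i div b = j div b \<and> i mod b = j mod b"
    by (metis div_mult_mod_eq)
  ultimately show "kron (1\<^sub>m a) (1\<^sub>m b) $$ (i, j) = (1\<^sub>m (a * b) :: 'a mat) $$ (i, j)"
    using ij by (auto simp: index_kron)
qed auto

lemma kron_pow_one: "kron_pow (1\<^sub>m d) m = 1\<^sub>m (d ^ m)"
  by (induction m) (simp_all add: kron_one)


subsection \<open>The representation of the mixed doubles group\<close>

lemma group_GL: "group (GL d)"
proof -
  interpret ring "ring_mat TYPE(complex) d ()" by (rule ring_mat)
  show ?thesis unfolding GL_def by (rule units_group)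
qed

lemma GL_simps: "mult (GL d) = (*)" "one (GL d) = 1\<^sub>m d"
  by (simp_all add: GL_def units_of_def ring_mat_def)

lemma carrier_GL: "g \<in> carrier (GL d) \<Longrightarrow> g \<in> carrier_mat d d"
  by (auto simp: GL_def units_of_def Units_def ring_mat_def)

context
  fixes n :: nat
begin

private definition emb :: "nat \<Rightarrow> complex mat \<Rightarrow> nat \<Rightarrow> complex mat" where
  "emb a A b = kron (kron (1\<^sub>m a) A) (1\<^sub>m b)"

private lemma emb_mult:
  assumes "A \<in> carrier_mat d d" "B \<in> carrier_mat d d"
  shows "emb a A b * emb a B b = emb a (A * B) b"
proof -
  have "kron (1\<^sub>m a) A \<in> carrier_mat (a * d) (a * d)" "kron (1\<^sub>m a) B \<in> carrier_mat (a * d) (a * d)"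
    using assms by auto
  then have "emb a A b * emb a B b = kron (kron (1\<^sub>m a) A * kron (1\<^sub>m a) B) (1\<^sub>m b * 1\<^sub>m b)"
    unfolding emb_def by (intro kron_mult) auto
  also have "kron (1\<^sub>m a) A * kron (1\<^sub>m a) B = kron (1\<^sub>m a * 1\<^sub>m a) (A * B)"
    by (rule kron_mult) (use assms in auto)
  finally show ?thesis by (simp add: emb_def)
qed

private lemma emb_one: "emb a (1\<^sub>m d) b = 1\<^sub>m (a * d * b)"
  by (simp add: emb_def kron_one)

private lemma emb_right: "emb a A (b * c) = emb a (kron A (1\<^sub>m b)) c"
  by (simp add: emb_def kron_assoc kron_one[symmetric])

private lemma emb_left: "emb (a * b) A c = emb a (kron (1\<^sub>m b) A) c"
  by (simp add: emb_def kron_assoc kron_one[symmetric])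

private lemma local_op_emb: "local_op n i A = emb (2 ^ (i - 1)) A (2 ^ (n - i - 1))"
  by (simp add: local_op_def emb_def kron_pow_one)

private lemma local_op_carrier:
  assumes "1 \<le> i" "i < n" "A \<in> carrier_mat 4 4"
  shows "local_op n i A \<in> carrier_mat (2 ^ n) (2 ^ n)"
proof -
  have "n = (i - 1) + 2 + (n - i - 1)" using assms by simp
  then have "(2::nat) ^ n = 2 ^ (i - 1) * 4 * 2 ^ (n - i - 1)"
    by (metis power_add power2_eq_square[of 2] mult_2 numeral_Bit0)
  then show ?thesis
    using assms by (auto simp: local_op_emb emb_def)
qed

private lemma local_op_square:
  assumes "1 \<le> i" "i < n" "A \<in> carrier_mat 4 4" "A * A = 1\<^sub>m 4"
  shows "local_op n i A * local_op n i A = 1\<^sub>m (2 ^ n)"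
proof -
  have "local_op n i A * local_op n i A = 1\<^sub>m (2 ^ (i - 1) * 4 * 2 ^ (n - i - 1))"
    using emb_mult[OF assms(3,3)] assms(4) by (simp add: local_op_emb emb_one)
  then show ?thesis
    using local_op_carrier[OF assms(1-3)] by (metis carrier_matD(1) index_mult_mat(2) index_one_mat(2))
qed

private lemma local_op_pair:
  assumes "1 \<le> i" "Suc i < n"
  shows "local_op n i A = emb (2 ^ (i - 1)) (kron A (1\<^sub>m 2)) (2 ^ (n - i - 2))"
    and "local_op n (Suc i) A = emb (2 ^ (i - 1)) (kron (1\<^sub>m 2) A) (2 ^ (n - i - 2))"
proof -
  have e: "n - i - 1 = Suc (n - i - 2)" "i = Suc (i - 1)" using assms by auto
  show "local_op n i A = emb (2 ^ (i - 1)) (kron A (1\<^sub>m 2)) (2 ^ (n - i - 2))"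
    unfolding local_op_emb e(1) power_Suc emb_right ..
  have "(2::nat) ^ i = 2 ^ (i - 1) * 2" by (subst e(2)) simp
  then show "local_op n (Suc i) A = emb (2 ^ (i - 1)) (kron (1\<^sub>m 2) A) (2 ^ (n - i - 2))"
    by (simp add: local_op_emb emb_left)
qed

private lemma local_op_braid:
  assumes "1 \<le> i" "Suc i < n" and "A \<in> carrier_mat 4 4" "B \<in> carrier_mat 4 4" "C \<in> carrier_mat 4 4"
    and br: "kron A (1\<^sub>m 2) * (kron (1\<^sub>m 2) B * kron C (1\<^sub>m 2)) =
             kron (1\<^sub>m 2) C * (kron B (1\<^sub>m 2) * kron (1\<^sub>m 2) A)"
  shows "local_op n i A * (local_op n (Suc i) B * local_op n i C) =
         local_op n (Suc i) C * (local_op n i B * local_op n (Suc i) A)"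
proof -
  have c: "kron X (1\<^sub>m 2) \<in> carrier_mat 8 8" "kron (1\<^sub>m 2) X \<in> carrier_mat 8 8"
    if "X \<in> carrier_mat 4 4" for X :: "complex mat"
    using that kron_carrier[OF that one_carrier_mat[of 2]] kron_carrier[OF one_carrier_mat[of 2] that]
    by auto
  have "kron (1\<^sub>m 2) B * kron C (1\<^sub>m 2) \<in> carrier_mat 8 8"
    "kron B (1\<^sub>m 2) * kron (1\<^sub>m 2) A \<in> carrier_mat 8 8"
    using c assms(3-5) by (auto intro: mult_carrier_mat)
  then show ?thesis
    unfolding local_op_pair[OF assms(1,2)]
    by (simp add: emb_mult[where d = 8] c assms(3-5) br)
qed

private lemma local_op_far:
  assumes "1 \<le> i" "Suc i < j" "j < n" and A: "A \<in> carrier_mat 4 4" and B: "B \<in> carrier_mat 4 4"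
  shows "local_op n i A * local_op n j B = local_op n j B * local_op n i A"
proof -
  define m where "m = (2::nat) ^ (j - i - 2)"
  have e1: "n - i - 1 = (j - i - 2) + 2 + (n - j - 1)" and e2: "j - 1 = (i - 1) + 2 + (j - i - 2)"
    using assms by auto
  have i: "local_op n i A = emb (2 ^ (i - 1)) (kron A (1\<^sub>m (m * 4))) (2 ^ (n - j - 1))"
    unfolding local_op_emb e1 power_add emb_right by (simp add: m_def)
  have j: "local_op n j B = emb (2 ^ (i - 1)) (kron (1\<^sub>m (4 * m)) B) (2 ^ (n - j - 1))"
    unfolding local_op_emb e2 power_add mult.assoc emb_left by (simp add: m_def)
  have c: "kron A (1\<^sub>m (m * 4)) \<in> carrier_mat (4 * (m * 4)) (4 * (m * 4))"
    "kron (1\<^sub>m (4 * m)) B \<in> carrier_mat (4 * (m * 4)) (4 * (m * 4))"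
    using A B kron_carrier[OF one_carrier_mat[of "4 * m"] B] by (auto simp: mult_ac)
  have a: "kron A (1\<^sub>m (m * 4)) = kron A (kron (1\<^sub>m m) (1\<^sub>m 4))"
    and b: "kron (1\<^sub>m (4 * m)) B = kron (1\<^sub>m 4) (kron (1\<^sub>m m) B)"
    by (simp_all add: kron_one kron_assoc[symmetric])
  have "kron A (kron (1\<^sub>m m) (1\<^sub>m 4)) * kron (1\<^sub>m 4) (kron (1\<^sub>m m) B) = kron A (kron (1\<^sub>m m) B)"
    using A B by (subst kron_mult[of _ 4 4 _ 4 _ "m * 4" "m * 4" _ "m * 4"])
      (auto simp: kron_mult[of _ m m _ m _ 4 4 _ 4])
  moreover have "kron (1\<^sub>m 4) (kron (1\<^sub>m m) B) * kron A (kron (1\<^sub>m m) (1\<^sub>m 4)) = kron A (kron (1\<^sub>m m) B)"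
    using A B by (subst kron_mult[of _ 4 4 _ 4 _ "m * 4" "m * 4" _ "m * 4"])
      (auto simp: kron_mult[of _ m m _ m _ 4 4 _ 4])
  ultimately show ?thesis
    unfolding i j emb_mult[OF c] emb_mult[OF c(2,1)] unfolding a b by simp
qed

context
  fixes p q :: complex and R S :: "complex mat"
  assumes S: "S = mat_of_rows_list 4 [[1, 0, 0, p], [0, 0, 1, 0], [0, 1, 0, 0], [0, 0, 0, -1]]"
    and R: "R = mat_of_rows_list 4 [[1, 0, 0, q], [0, 0, 1, 0], [0, 1, 0, 0], [0, 0, 0, -1]]"
begin

private definition mx :: "complex \<Rightarrow> complex mat" where
  "mx x = mat_of_rows_list 4 [[1, 0, 0, x], [0, 0, 1, 0], [0, 1, 0, 0], [0, 0, 0, -1]]"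

private lemma RS: "R = mx q" "S = mx p"
  by (simp_all add: R S mx_def)

private lemma mx_carrier: "mx x \<in> carrier_mat 4 4"
  by (simp add: mx_def mat_of_rows_list_def numeral_eq_Suc)

private lemma less_8: "(i::nat) < 8 \<longleftrightarrow> i = 0 \<or> i = 1 \<or> i = 2 \<or> i = 3 \<or> i = 4 \<or> i = 5 \<or> i = 6 \<or> i = 7"
  by linarith

private lemma mx_square: "mx x * mx x = 1\<^sub>m 4"
  by (rule eq_matI) (auto simp: mx_def mat_of_rows_list_def scalar_prod_def numeral_eq_Suc less_Suc_eq)

private definition m1 :: "complex \<Rightarrow> complex mat" where
  "m1 x = mat_of_rows_list 8
     [[1, 0, 0, 0, 0, 0, x, 0], [0, 1, 0, 0, 0, 0, 0, x], [0, 0, 0, 0, 1, 0, 0, 0], [0, 0, 0, 0, 0, 1, 0, 0],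
      [0, 0, 1, 0, 0, 0, 0, 0], [0, 0, 0, 1, 0, 0, 0, 0], [0, 0, 0, 0, 0, 0, -1, 0], [0, 0, 0, 0, 0, 0, 0, -1]]"

private definition m2 :: "complex \<Rightarrow> complex mat" where
  "m2 x = mat_of_rows_list 8
     [[1, 0, 0, x, 0, 0, 0, 0], [0, 0, 1, 0, 0, 0, 0, 0], [0, 1, 0, 0, 0, 0, 0, 0], [0, 0, 0, -1, 0, 0, 0, 0],
      [0, 0, 0, 0, 1, 0, 0, x], [0, 0, 0, 0, 0, 0, 1, 0], [0, 0, 0, 0, 0, 1, 0, 0], [0, 0, 0, 0, 0, 0, 0, -1]]"

private lemma kron_mx: "kron (mx x) (1\<^sub>m 2) = m1 x" "kron (1\<^sub>m 2) (mx x) = m2 x"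
proof -
  have d: "dim_row (mx x) = 4" "dim_col (mx x) = 4" "dim_row (m1 x) = 8" "dim_col (m1 x) = 8"
    "dim_row (m2 x) = 8" "dim_col (m2 x) = 8"
    by (simp_all add: mx_def m1_def m2_def mat_of_rows_list_def)
  have mx: "i < 4 \<Longrightarrow> j < 4 \<Longrightarrow>
      mx x $$ (i, j) = [[1, 0, 0, x], [0, 0, 1, 0], [0, 1, 0, 0], [0, 0, 0, -1]] ! i ! j" for i j
    by (simp add: mx_def mat_of_rows_list_def)
  have m1: "i < 8 \<Longrightarrow> j < 8 \<Longrightarrow> m1 x $$ (i, j) =
     [[1, 0, 0, 0, 0, 0, x, 0], [0, 1, 0, 0, 0, 0, 0, x], [0, 0, 0, 0, 1, 0, 0, 0], [0, 0, 0, 0, 0, 1, 0, 0],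
      [0, 0, 1, 0, 0, 0, 0, 0], [0, 0, 0, 1, 0, 0, 0, 0], [0, 0, 0, 0, 0, 0, -1, 0], [0, 0, 0, 0, 0, 0, 0, -1]] ! i ! j" for i j
    by (simp add: m1_def mat_of_rows_list_def)
  have m2: "i < 8 \<Longrightarrow> j < 8 \<Longrightarrow> m2 x $$ (i, j) =
     [[1, 0, 0, x, 0, 0, 0, 0], [0, 0, 1, 0, 0, 0, 0, 0], [0, 1, 0, 0, 0, 0, 0, 0], [0, 0, 0, -1, 0, 0, 0, 0],
      [0, 0, 0, 0, 1, 0, 0, x], [0, 0, 0, 0, 0, 0, 1, 0], [0, 0, 0, 0, 0, 1, 0, 0], [0, 0, 0, 0, 0, 0, 0, -1]] ! i ! j" for i j
    by (simp add: m2_def mat_of_rows_list_def)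
  show "kron (mx x) (1\<^sub>m 2) = m1 x"
  proof (rule eq_matI)
    fix i j assume "i < dim_row (m1 x)" "j < dim_col (m1 x)"
    then show "kron (mx x) (1\<^sub>m 2) $$ (i, j) = m1 x $$ (i, j)"
      unfolding d less_8 by (elim disjE) (simp_all add: index_kron d mx m1)
  qed (simp_all add: d)
  show "kron (1\<^sub>m 2) (mx x) = m2 x"
  proof (rule eq_matI)
    fix i j assume "i < dim_row (m2 x)" "j < dim_col (m2 x)"
    then show "kron (1\<^sub>m 2) (mx x) $$ (i, j) = m2 x $$ (i, j)"
      unfolding d less_8 by (elim disjE) (simp_all add: index_kron d mx m2)
  qed (simp_all add: d)
qed

private lemma mx_braid:
  "kron (mx x) (1\<^sub>m 2) * (kron (1\<^sub>m 2) (mx y) * kron (mx z) (1\<^sub>m 2)) =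
   kron (1\<^sub>m 2) (mx z) * (kron (mx y) (1\<^sub>m 2) * kron (1\<^sub>m 2) (mx x))"
proof -
  have "m2 y * m1 z = mat_of_rows_list 8
     [[1, 0, 0, 0, 0, y, z, 0], [0, 0, 0, 0, 1, 0, 0, 0], [0, 1, 0, 0, 0, 0, 0, z], [0, 0, 0, 0, 0, -1, 0, 0],
      [0, 0, 1, 0, 0, 0, 0, -y], [0, 0, 0, 0, 0, 0, -1, 0], [0, 0, 0, 1, 0, 0, 0, 0], [0, 0, 0, 0, 0, 0, 0, 1]]"
    by (rule eq_matI) (auto simp: m1_def m2_def mat_of_rows_list_def scalar_prod_def numeral_eq_Suc less_Suc_eq)
  moreover have "m1 y * m2 x = mat_of_rows_list 8
     [[1, 0, 0, x, 0, y, 0, 0], [0, 0, 1, 0, 0, 0, 0, -y], [0, 0, 0, 0, 1, 0, 0, x], [0, 0, 0, 0, 0, 0, 1, 0],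
      [0, 1, 0, 0, 0, 0, 0, 0], [0, 0, 0, -1, 0, 0, 0, 0], [0, 0, 0, 0, 0, -1, 0, 0], [0, 0, 0, 0, 0, 0, 0, 1]]"
    by (rule eq_matI) (auto simp: m1_def m2_def mat_of_rows_list_def scalar_prod_def numeral_eq_Suc less_Suc_eq)
  ultimately show ?thesis
    unfolding kron_mx
    by (intro eq_matI) (auto simp: m1_def m2_def mat_of_rows_list_def scalar_prod_def numeral_eq_Suc less_Suc_eq)
qed

private definition f where
  "f = case_md_gen (\<lambda>i. local_op n i R) (\<lambda>i. local_op n i S)"

private lemma f_closed: "f \<in> MD_gens n \<rightarrow> carrier (GL (2 ^ n))"
proof -
  have "local_op n i (mx x) \<in> carrier (GL (2 ^ n))" if "1 \<le> i" "i < n" for i x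
    using local_op_carrier[OF that mx_carrier[of x]] local_op_square[OF that mx_carrier mx_square, of x]
    by (auto simp: GL_def units_of_def Units_def ring_mat_def)
  then show ?thesis unfolding f_def unfolding RS by (auto simp: MD_gens_def)
qed

private lemma f_resp:
  assumes "(l, r) \<in> MD_rels n"
  shows "eval_gword (GL (2 ^ n)) f l = eval_gword (GL (2 ^ n)) f r"
proof -
  interpret group "GL (2 ^ n)" by (rule group_GL)
  have [simp]: "local_op n i (mx x) \<otimes>\<^bsub>GL (2 ^ n)\<^esub> \<one>\<^bsub>GL (2 ^ n)\<^esub> = local_op n i (mx x)"
    if "1 \<le> i" "i < n" for i x
    using local_op_carrier[OF that mx_carrier[of x]] by (simp add: GL_simps)
  have [simp]: "local_op n i (mx x) * 1\<^sub>m (2 ^ n) = local_op n i (mx x)"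
    if "1 \<le> i" "i < n" for i x
    using local_op_carrier[OF that mx_carrier[of x]] by simp
  have braid: "local_op n i (mx x) * (local_op n (Suc i) (mx y) * local_op n i (mx z)) =
         local_op n (Suc i) (mx z) * (local_op n i (mx y) * local_op n (Suc i) (mx x))"
    if "Suc 0 \<le> i" "Suc i < n" for i x y z
    using that by (intro local_op_braid mx_carrier mx_braid) auto
  have far: "local_op n i (mx x) * local_op n j (mx y) = local_op n j (mx y) * local_op n i (mx x)"
    if "Suc i < j" "Suc 0 \<le> i" "j < n" for i j x y
    using that local_op_far[of i j "mx x" "mx y"] mx_carrier by auto
  show ?thesis
    using assms unfolding MD_rels_def f_def unfolding RS
    by (auto simp: GL_simps local_op_square mx_carrier mx_square intro: braid far far[symmetric])
qed

lemma MD_mat_hom: "MD_mat n R S \<in> hom (MD n) (GL (2 ^ n))"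
  unfolding MD_mat_def MD_def f_def[symmetric]
  by (rule pres_lift_hom[OF group_GL f_closed f_resp])

lemma MD_mat_r: "1 \<le> i \<Longrightarrow> i < n \<Longrightarrow> MD_mat n R S (MD_r n i) = local_op n i R"
  unfolding MD_mat_def MD_r_def f_def[symmetric]
  by (subst pres_lift_gen[OF group_GL f_closed f_resp]) (auto simp: f_def)

lemma MD_mat_s: "1 \<le> i \<Longrightarrow> i < n \<Longrightarrow> MD_mat n R S (MD_s n i) = local_op n i S"
  unfolding MD_mat_def MD_s_def f_def[symmetric]
  by (subst pres_lift_gen[OF group_GL f_closed f_resp]) (auto simp: f_def)

end
end

lemma mk_rep_simps [simp]:
  "carrier (mk_rep M \<pi>) = carrier M" "zero (mk_rep M \<pi>) = zero M" "add (mk_rep M \<pi>) = add M"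
  "smult (mk_rep M \<pi>) = smult M" "act (mk_rep M \<pi>) = \<pi>" "module.truncate (mk_rep M \<pi>) = M"
  by (simp_all add: mk_rep_def module.truncate_def)

lemma vectorspace_cong:
  fixes V :: "(complex, 'v, 'c) module_scheme" and W :: "(complex, 'v, 'd) module_scheme"
  assumes V: "vectorspace class_ring V"
    and eq: "carrier W = carrier V" "zero W = zero V" "add W = add V" "smult W = smult V"
  shows "vectorspace class_ring W"
proof -
  interpret V: vectorspace class_ring V by (rule V)
  have neg: "\<exists>y\<in>carrier V. y \<oplus>\<^bsub>V\<^esub> x = \<zero>\<^bsub>V\<^esub>" if "x \<in> carrier V" for x
    using that V.a_inv_closed V.l_neg by blast
  have "abelian_group W"
    by (rule abelian_groupI) (simp_all add: eq V.a_ac neg)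
  moreover have "a * b \<odot>\<^bsub>V\<^esub> x = a \<odot>\<^bsub>V\<^esub> (b \<odot>\<^bsub>V\<^esub> x)" "1 \<odot>\<^bsub>V\<^esub> x = x" if "x \<in> carrier V" for a b x
    using V.smult_assoc1[of a b x] V.smult_one[of x] that by simp_all
  ultimately have "module class_ring W"
    by (intro moduleI) (auto simp: eq V.smult_l_distr V.smult_r_distr
        intro: class_cring.cring_axioms simp flip: V.smult_l_distr)
  then show ?thesis
    using V by (simp add: vectorspace_def)
qed

lemma vectorspace_mk_rep: "vectorspace class_ring M \<Longrightarrow> vectorspace class_ring (mk_rep M \<pi>)"
  by (erule vectorspace_cong) simp_all

lemma vectorspace_truncate:
  fixes V :: "(complex, 'v, 'c) module_scheme"
  shows "vectorspace class_ring V \<Longrightarrow> vectorspace class_ring (module.truncate V)"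
  by (erule vectorspace_cong) (simp_all add: module.truncate_def)

lemma representation_MD_rep:
  assumes "S = mat_of_rows_list 4 [[1, 0, 0, p], [0, 0, 1, 0], [0, 1, 0, 0], [0, 0, 0, -1]]"
    and "R = mat_of_rows_list 4 [[1, 0, 0, q], [0, 0, 1, 0], [0, 1, 0, 0], [0, 0, 0, -1]]"
  shows "representation (MD n) (MD_rep n R S)"
proof -
  note hom = MD_mat_hom[OF assms, of n]
  have mat: "MD_mat n R S g \<in> carrier_mat (2 ^ n) (2 ^ n)" if "g \<in> carrier (MD n)" for g
    using hom_in_carrier[OF hom that] by (rule carrier_GL)
  have mult: "MD_mat n R S (g \<otimes>\<^bsub>MD n\<^esub> h) = MD_mat n R S g * MD_mat n R S h"
    if "g \<in> carrier (MD n)" "h \<in> carrier (MD n)" for g h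
    using hom_mult[OF hom that] by (simp add: GL_simps)
  have one: "MD_mat n R S \<one>\<^bsub>MD n\<^esub> = 1\<^sub>m (2 ^ n)"
    using hom_one[OF hom group_MD group_GL] by (simp add: GL_simps)
  have "vectorspace class_ring (MD_rep n R S)"
    unfolding MD_rep_def by (rule vectorspace_mk_rep) (rule vec_vs)
  moreover have "act (MD_rep n R S) g \<in> module_hom class_ring (MD_rep n R S) (MD_rep n R S)"
    if "g \<in> carrier (MD n)" for g
    using mat[OF that]
    by (auto simp: module_hom_def MD_rep_def module_vec_simps mult_add_distrib_mat_vec[of _ "2 ^ n" "2 ^ n"]
        mult_mat_vec[of _ "2 ^ n" "2 ^ n"])
  moreover have "MD_mat n R S g * MD_mat n R S h *\<^sub>v v = MD_mat n R S g *\<^sub>v (MD_mat n R S h *\<^sub>v v)"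
    if "g \<in> carrier (MD n)" "h \<in> carrier (MD n)" "v \<in> carrier_vec (2 ^ n)" for g h v
    using assoc_mult_mat_vec[OF mat mat] that by blast
  ultimately show ?thesis
    by (simp add: representation_def group_MD MD_rep_def module_vec_simps one mult)
qed


subsection \<open>Specht modules are representations\<close>

lemma tableau_comp:
  "tableau lam t \<Longrightarrow> \<sigma> permutes {1..sum_list lam} \<Longrightarrow> tableau lam (\<sigma> \<circ> t)"
  unfolding tableau_def using bij_betw_trans permutes_imp_bij by blast

lemma tabloid_comp: "tabloid lam (\<sigma> \<circ> t) = map ((`) \<sigma>) (tabloid lam t)"
  by (auto simp: tabloid_def image_comp)

lemma tabloids_image:
  "T \<in> tabloids lam \<Longrightarrow> \<sigma> permutes {1..sum_list lam} \<Longrightarrow> map ((`) \<sigma>) T \<in> tabloids lam"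
  unfolding tabloids_def using tableau_comp tabloid_comp by (metis (mono_tags) imageE image_eqI mem_Collect_eq)

lemma map_image_inv:
  assumes "\<sigma> permutes A"
  shows "map ((`) (inv' \<sigma>)) (map ((`) \<sigma>) T) = T" "map ((`) \<sigma>) (map ((`) (inv' \<sigma>)) T) = T"
  using permutes_inv_o[OF assms] by (simp_all add: map_idI image_comp)

lemma tabloid_act_polytabloid:
  assumes \<sigma>: "\<sigma> permutes {1..sum_list lam}" and t: "tableau lam t"
  shows "tabloid_act lam \<sigma> (polytabloid lam t) = polytabloid lam (\<sigma> \<circ> t)"
proof
  fix T
  note i = permutes_inv[OF \<sigma>]
  note inv = permutes_inverses[OF \<sigma>]
  have sgn: "sign (\<sigma> \<circ> \<rho> \<circ> inv' \<sigma>) = sign \<rho>" if "\<rho> permutes {1..sum_list lam}" for \<rho>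
  proof -
    have p: "permutation \<sigma>" "permutation \<rho>" "permutation (inv' \<sigma>)"
      using \<sigma> that i by (auto simp: permutation_permutes)
    then have "sign (\<sigma> \<circ> \<rho> \<circ> inv' \<sigma>) = sign \<sigma> * sign \<rho> * sign \<sigma>"
      by (simp add: sign_compose permutation_compose sign_inverse)
    also have "\<dots> = sign \<rho> * (sign \<sigma> * sign \<sigma>)" by (simp only: mult_ac)
    finally show ?thesis by (simp add: sign_idempotent)
  qed
  show "tabloid_act lam \<sigma> (polytabloid lam t) T = polytabloid lam (\<sigma> \<circ> t) T"
  proof (cases "T \<in> tabloids lam")
    case True
    have "(\<Sum>\<rho> | \<rho> \<in> column_stabilizer lam t \<and> tabloid lam (\<rho> \<circ> t) = map ((`) (inv' \<sigma>)) T. of_int (sign \<rho>)) =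
       (\<Sum>\<rho> | \<rho> \<in> column_stabilizer lam (\<sigma> \<circ> t) \<and> tabloid lam (\<rho> \<circ> (\<sigma> \<circ> t)) = T. of_int (sign \<rho>) :: complex)"
    proof (rule sum.reindex_bij_witness[where j = "\<lambda>\<rho>. \<sigma> \<circ> \<rho> \<circ> inv' \<sigma>" and i = "\<lambda>\<rho>. inv' \<sigma> \<circ> \<rho> \<circ> \<sigma>"])
      fix \<rho>
      assume \<rho>: "\<rho> \<in> {\<rho>. \<rho> \<in> column_stabilizer lam t \<and> tabloid lam (\<rho> \<circ> t) = map ((`) (inv' \<sigma>)) T}"
      then have p: "\<rho> permutes {1..sum_list lam}" by (simp add: column_stabilizer_def)
      show "inv' \<sigma> \<circ> (\<sigma> \<circ> \<rho> \<circ> inv' \<sigma>) \<circ> \<sigma> = \<rho>" by (simp add: fun_eq_iff inv)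
      show "of_int (sign (\<sigma> \<circ> \<rho> \<circ> inv' \<sigma>)) = (of_int (sign \<rho>) :: complex)" by (simp only: sgn[OF p])
      have "\<sigma> \<circ> \<rho> \<circ> inv' \<sigma> \<in> column_stabilizer lam (\<sigma> \<circ> t)"
        using \<rho> p \<sigma> i unfolding column_stabilizer_def
        by (auto simp: inv intro!: permutes_compose) fastforce
      moreover have "tabloid lam (\<sigma> \<circ> \<rho> \<circ> inv' \<sigma> \<circ> (\<sigma> \<circ> t)) = map ((`) \<sigma>) (tabloid lam (\<rho> \<circ> t))"
        by (simp add: tabloid_comp[symmetric] comp_def inv)
      ultimately show "\<sigma> \<circ> \<rho> \<circ> inv' \<sigma> \<in>
          {\<rho>. \<rho> \<in> column_stabilizer lam (\<sigma> \<circ> t) \<and> tabloid lam (\<rho> \<circ> (\<sigma> \<circ> t)) = T}"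
        using \<rho> map_image_inv(2)[OF \<sigma>, of T] by simp
    next
      fix \<rho>
      assume \<rho>: "\<rho> \<in> {\<rho>. \<rho> \<in> column_stabilizer lam (\<sigma> \<circ> t) \<and> tabloid lam (\<rho> \<circ> (\<sigma> \<circ> t)) = T}"
      then have p: "\<rho> permutes {1..sum_list lam}" by (simp add: column_stabilizer_def)
      show "\<sigma> \<circ> (inv' \<sigma> \<circ> \<rho> \<circ> \<sigma>) \<circ> inv' \<sigma> = \<rho>" by (simp add: fun_eq_iff inv)
      have "inv' \<sigma> \<circ> \<rho> \<circ> \<sigma> \<in> column_stabilizer lam t"
        using \<rho> p \<sigma> i unfolding column_stabilizer_def
        by (auto intro!: permutes_compose) (fastforce simp: inv)
      moreover have "tabloid lam (inv' \<sigma> \<circ> \<rho> \<circ> \<sigma> \<circ> t) = map ((`) (inv' \<sigma>)) T"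
        using \<rho> tabloid_comp[of lam "inv' \<sigma>" "\<rho> \<circ> (\<sigma> \<circ> t)"] by (simp add: comp_assoc)
      ultimately show "inv' \<sigma> \<circ> \<rho> \<circ> \<sigma> \<in>
          {\<rho>. \<rho> \<in> column_stabilizer lam t \<and> tabloid lam (\<rho> \<circ> t) = map ((`) (inv' \<sigma>)) T}"
        by simp
    qed
    then show ?thesis
      using True tabloids_image[OF True i] by (simp add: tabloid_act_def polytabloid_def)
  qed (simp add: tabloid_act_def polytabloid_def)
qed

lemma vectorspace_perm_module: "vectorspace class_ring (perm_module lam)"
proof -
  interpret vectorspace class_ring "module_vec TYPE(complex) 0" by (rule vec_vs)
  show ?thesis unfolding perm_module_def by (rule func_space_is_vs)
qed

lemma perm_module_simps:
  "carrier (perm_module lam) = extensional (tabloids lam)"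
  "add (perm_module lam) f g = (\<lambda>T\<in>tabloids lam. f T + g T)"
  "smult (perm_module lam) c f = (\<lambda>T\<in>tabloids lam. c * f T)"
  "zero (perm_module lam) = (\<lambda>T\<in>tabloids lam. 0)"
proof -
  show "carrier (perm_module lam) = extensional (tabloids lam)"
    "add (perm_module lam) f g = (\<lambda>T\<in>tabloids lam. f T + g T)"
    "smult (perm_module lam) c f = (\<lambda>T\<in>tabloids lam. c * f T)"
    "zero (perm_module lam) = (\<lambda>T\<in>tabloids lam. 0)"
    by (simp_all add: perm_module_def ring.func_space_def[OF class_ring.ring_axioms] PiE_def)
qed

lemma tabloid_act_hom:
  assumes "\<sigma> permutes {1..sum_list lam}"
  shows "tabloid_act lam \<sigma> \<in> module_hom class_ring (perm_module lam) (perm_module lam)"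
  using tabloids_image[OF _ permutes_inv[OF assms]]
  by (auto simp: module_hom_def perm_module_simps tabloid_act_def)

lemma module_hom_restrict:
  assumes "f \<in> module_hom K M M" "carrier V \<subseteq> carrier M" "f ` carrier V \<subseteq> carrier V"
    "add V = add M" "smult V = smult M"
  shows "f \<in> module_hom K V V"
  using assms by (simp add: module_hom_def subset_iff image_subset_iff)

lemma representation_specht: "representation (sym_group (sum_list lam)) (specht lam)"
proof -
  define M where "M = perm_module lam"
  define P where "P = polytabloid lam ` {t. tableau lam t}"
  interpret vectorspace class_ring M unfolding M_def by (rule vectorspace_perm_module)
  have P: "P \<subseteq> carrier M"
    by (auto simp: P_def M_def perm_module_simps polytabloid_def)
  note sub = span_is_submodule[OF P]
  have sc: "span P \<subseteq> carrier M" using P by (rule span_is_subset2)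
  have inv: "tabloid_act lam \<sigma> ` span P \<subseteq> span P" if "\<sigma> permutes {1..sum_list lam}" for \<sigma>
  proof -
    have hom: "tabloid_act lam \<sigma> \<in> module_hom class_ring M M"
      unfolding M_def by (rule tabloid_act_hom[OF that])
    then interpret h: mod_hom class_ring M M "tabloid_act lam \<sigma>"
      by unfold_locales
    have "submodule class_ring {v \<in> carrier M. tabloid_act lam \<sigma> v \<in> span P} M"
      using sub by (auto simp: submodule_def module_axioms)
    moreover have "P \<subseteq> {v \<in> carrier M. tabloid_act lam \<sigma> v \<in> span P}"
      using P in_own_span[OF P] tabloid_act_polytabloid[OF that] tableau_comp[OF _ that]
      by (auto simp: P_def)
    ultimately show ?thesis using span_is_subset by blast
  qed
  have "vectorspace class_ring (M\<lparr>carrier := span P\<rparr>)"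
    by (rule subspace_is_vs) (simp add: subspace_def sub vectorspace_axioms)
  then have vs: "vectorspace class_ring (specht lam)"
    unfolding specht_def M_def P_def by (rule vectorspace_mk_rep)
  have c: "carrier (specht lam) = span P" and a: "act (specht lam) = tabloid_act lam"
    and ops: "add (specht lam) = add M" "smult (specht lam) = smult M"
    by (simp_all add: specht_def M_def P_def)
  have ext: "v \<in> extensional (tabloids lam)" if "v \<in> span P" for v
    using that sc by (auto simp: M_def perm_module_simps)
  have "act (specht lam) \<sigma> \<in> module_hom class_ring (specht lam) (specht lam)"
    if "\<sigma> permutes {1..sum_list lam}" for \<sigma>
    unfolding a by (rule module_hom_restrict[OF tabloid_act_hom[OF that], folded M_def])
      (use inv[OF that] sc in \<open>simp_all only: c ops\<close>)
  moreover have "tabloid_act lam id v = v" if "v \<in> span P" for v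
    using ext[OF that] by (auto simp: tabloid_act_def fun_eq_iff extensional_def)
  moreover have "tabloid_act lam (\<sigma> \<circ> \<tau>) v = tabloid_act lam \<sigma> (tabloid_act lam \<tau> v)"
    if "\<sigma> permutes {1..sum_list lam}" "\<tau> permutes {1..sum_list lam}" for \<sigma> \<tau> v
  proof
    fix T
    have "inv' (\<sigma> \<circ> \<tau>) = inv' \<tau> \<circ> inv' \<sigma>"
      using that by (intro o_inv_distrib permutes_bij)
    then have "map ((`) (inv' (\<sigma> \<circ> \<tau>))) T = map ((`) (inv' \<tau>)) (map ((`) (inv' \<sigma>)) T)"
      by (simp add: image_comp)
    then show "tabloid_act lam (\<sigma> \<circ> \<tau>) v T = tabloid_act lam \<sigma> (tabloid_act lam \<tau> v) T"
      using tabloids_image[OF _ permutes_inv[OF that(1)], of T]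
      unfolding tabloid_act_def restrict_def by (simp only: split: if_split) blast
  qed
  ultimately show ?thesis
    using vs by (auto simp: representation_def sym_group_is_group sym_group_carrier sym_group_mult sym_group_one c a)
qed

lemma representation_hook_rep:
  assumes "k < n"
  shows "representation (MD n) (hook_rep n k)"
proof -
  have n: "sum_list (hook n k) = n"
    using assms by (simp add: hook_def sum_list_replicate)
  define V where "V = specht (hook n k)"
  note hom = MD_perm_hom[of n]
  have V: "representation (sym_group n) V"
    using representation_specht[of "hook n k"] by (simp add: n V_def)
  have tr: "carrier (module.truncate V) = carrier V" "add (module.truncate V) = add V"
    "smult (module.truncate V) = smult V" "zero (module.truncate V) = zero V"
    "monoid.mult (module.truncate V) = monoid.mult V" "one (module.truncate V) = one V"
    by (simp_all add: module.truncate_def)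
  have "vectorspace class_ring (hook_rep n k)"
    using V unfolding hook_rep_def V_def[symmetric]
    by (intro vectorspace_mk_rep) (simp add: representation_def vectorspace_truncate)
  moreover have "module_hom class_ring (hook_rep n k) (hook_rep n k) = module_hom class_ring V V"
    by (simp add: module_hom_def hook_rep_def V_def[symmetric] tr)
  moreover have "carrier (hook_rep n k) = carrier V" "act (hook_rep n k) g = act V (MD_perm n g)" for g
    by (simp_all add: hook_rep_def V_def[symmetric] tr)
  ultimately show ?thesis
    using V hom_in_carrier[OF hom] hom_mult[OF hom] hom_one[OF hom group_MD sym_group_is_group]
    by (simp add: representation_def group_MD)
qed

end

theory Submission
  imports Defs "HOL-Library.Nat_Bijection"
begin

text \<open>Order the basis of \<open>(\<complex>\<^sup>2)\<^bsup>\<otimes>n\<^esup>\<close> by the set \<open>A\<close> of positions of the second basis vector.  The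
  entries \<open>p\<close> and \<open>q\<close> only lower the cardinality of \<open>A\<close>, so on the graded pieces of the filtration
  by cardinality \<open>r\<^sub>i\<close> and \<open>s\<^sub>i\<close> act alike, namely as the adjacent transposition on the exterior power
  \<open>\<Lambda>\<^sup>j \<complex>\<^sup>n\<close>.  Contraction with the coordinate sum and the wedge product with \<open>e\<^sub>1 + \<dots> + e\<^sub>n\<close> are
  equivariant and their anticommutator is multiplication by \<open>n\<close>, so \<open>\<Lambda>\<^sup>j \<complex>\<^sup>n\<close> is the direct sum of
  the images of \<open>\<Lambda>\<^bsup>j+1\<^esup>\<close> and \<open>\<Lambda>\<^bsup>j-1\<^esup>\<close>.  The image of contraction in \<open>\<Lambda>\<^sup>k\<close> is the Specht module of
  the hook \<open>(n - k, 1\<^sup>k)\<close>, and it occurs once in degree \<open>k\<close> and once in degree \<open>k + 1\<close>.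
  Irreducibility is James's argument: antisymmetrizing any vector over the column stabilizer
  gives a multiple of the polytabloid.\<close>

section \<open>Intertwiners and quotients\<close>

text \<open>The claim concerns every composition series, and exhibiting the filtration settles only
  one of them; \<open>Jordan_Hoelder\<close> carries its factors over to all others. Since
  \<open>p\<close> and \<open>q\<close> leak into lower degrees, only leading components transform
  as in the exterior algebra. Hence each factor is identified by a linear map that reads the top
  component alone.

  Between the image of \<open>wd\<close> and the image of \<open>bd\<close>, the two operators are
  mutually inverse up to the factor \<open>n\<close>, which is invertible in the complex numbers. So
  preimages and kernels of these maps are explicit, and no dimension count enters the identification
  of the factors.

  The link to Specht modules is a uniqueness statement: a function on hook tabloids that is
  antisymmetric under the permutations of \<open>1, ..., k + 1\<close> is determined by its value at
  one tabloid. It shows that the contraction of \<open>e_1 ... e_(k+1)\<close> is a polytabloid, and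
  that antisymmetrized vectors are multiples of it. The other half of James's argument is
  positivity: a vector of the module all of whose translates antisymmetrize to zero is orthogonal to
  the whole module, itself included.\<close>

definition intertwiner ::
  "('g, 'c) monoid_scheme \<Rightarrow> ('g, 'v) rep \<Rightarrow> ('g, 'w) rep \<Rightarrow> ('v \<Rightarrow> 'w) \<Rightarrow> bool" where
  "intertwiner G V W f \<longleftrightarrow> f \<in> module_hom class_ring V W \<and>
     (\<forall>g\<in>carrier G. \<forall>v\<in>carrier V. f (act V g v) = act W g (f v))"

lemma intertwiner_iff:
  "intertwiner G V W f \<longleftrightarrow>
     (\<forall>x\<in>carrier V. f x \<in> carrier W) \<and>
     (\<forall>x\<in>carrier V. \<forall>y\<in>carrier V. f (x \<oplus>\<^bsub>V\<^esub> y) = f x \<oplus>\<^bsub>W\<^esub> f y) \<and>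
     (\<forall>c. \<forall>x\<in>carrier V. f (c \<odot>\<^bsub>V\<^esub> x) = c \<odot>\<^bsub>W\<^esub> f x) \<and>
     (\<forall>g\<in>carrier G. \<forall>v\<in>carrier V. f (act V g v) = act W g (f v))"
  by (auto simp: intertwiner_def module_hom_def Pi_def)

lemma representation_closed:
  fixes V (structure)
  assumes "representation G V"
  shows "\<zero> \<in> carrier V"
    and "x \<in> carrier V \<Longrightarrow> y \<in> carrier V \<Longrightarrow> x \<oplus> y \<in> carrier V"
    and "x \<in> carrier V \<Longrightarrow> c \<odot> x \<in> carrier V"
    and "g \<in> carrier G \<Longrightarrow> x \<in> carrier V \<Longrightarrow> act V g x \<in> carrier V"
proof -
  interpret V: vectorspace class_ring V using assms by (simp add: representation_def)
  show "\<zero> \<in> carrier V" "x \<in> carrier V \<Longrightarrow> y \<in> carrier V \<Longrightarrow> x \<oplus> y \<in> carrier V"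
    "x \<in> carrier V \<Longrightarrow> c \<odot> x \<in> carrier V"
    by auto
  show "g \<in> carrier G \<Longrightarrow> x \<in> carrier V \<Longrightarrow> act V g x \<in> carrier V"
    using assms by (auto simp: representation_def module_hom_def)
qed

lemma representation_act:
  fixes V (structure)
  assumes "representation G V" "g \<in> carrier G"
  shows "x \<in> carrier V \<Longrightarrow> y \<in> carrier V \<Longrightarrow> act V g (x \<oplus> y) = act V g x \<oplus> act V g y"
    and "x \<in> carrier V \<Longrightarrow> act V g (c \<odot> x) = c \<odot> act V g x"
    and "x \<in> carrier V \<Longrightarrow> h \<in> carrier G \<Longrightarrow> act V (g \<otimes>\<^bsub>G\<^esub> h) x = act V g (act V h x)"
    and "x \<in> carrier V \<Longrightarrow> act V \<one>\<^bsub>G\<^esub> x = x"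
  using assms by (auto simp: representation_def module_hom_def)

text \<open>The additive inverse refers to the carrier, scalar multiplication does not. Writing
  negatives as multiples by -1 makes differences in a space and in its restriction to a subspace
  agree, and shows that subspaces are closed under them.\<close>

lemma a_inv_eq_smult:
  fixes V :: "(complex, 'v, 'd) module_scheme" (structure)
  assumes "vectorspace class_ring V" "x \<in> carrier V"
  shows "\<ominus> x = (- 1) \<odot> x"
proof -
  interpret V: vectorspace class_ring V by fact
  have "(- 1) \<odot> x \<oplus> 1 \<odot> x = (- 1 + 1) \<odot> x"
    using V.smult_l_distr[of "- 1" 1 x] assms(2) by simp
  also have "\<dots> = \<zero>" using V.lmult_0[of x] assms(2) by simp
  finally have "(- 1) \<odot> x \<oplus> x = \<zero>"
    using V.smult_one[of x] assms(2) by simp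
  then show ?thesis using V.minus_equality[of "(- 1) \<odot> x" x] assms(2) by simp
qed

lemma representation_module: "representation G V \<Longrightarrow> module class_ring V"
  by (simp add: representation_def vectorspace_def)

section \<open>Invariant subspaces and equivariant images\<close>

lemma invariant_subspace_iff:
  fixes V (structure)
  assumes "representation G V"
  shows "invariant_subspace G V W \<longleftrightarrow> W \<subseteq> carrier V \<and> \<zero> \<in> W \<and>
     (\<forall>x\<in>W. \<forall>y\<in>W. x \<oplus> y \<in> W) \<and> (\<forall>c. \<forall>x\<in>W. c \<odot> x \<in> W) \<and>
     (\<forall>g\<in>carrier G. \<forall>x\<in>W. act V g x \<in> W)"
  using assms representation_module[OF assms]
  by (auto simp: invariant_subspace_def VectorSpace.subspace_def submodule_def representation_def image_subset_iff)

lemma subspace_diff: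
  fixes V (structure)
  assumes V: "representation G V" and W: "invariant_subspace G V W" and "x \<in> W" "y \<in> W"
  shows "x \<ominus> y \<in> W"
proof -
  interpret V: vectorspace class_ring V using V by (simp add: representation_def)
  have c: "x \<in> carrier V" "y \<in> carrier V" using assms by (auto simp: invariant_subspace_iff[OF V])
  have "\<ominus> y = (- 1) \<odot> y" by (rule a_inv_eq_smult[OF V.vectorspace_axioms c(2)])
  then have "\<ominus> y \<in> W" using W assms by (simp add: invariant_subspace_iff[OF V])
  then show ?thesis using W assms by (simp add: a_minus_def invariant_subspace_iff[OF V])
qed

text \<open>Each axiom is pulled back to \<open>V\<close> by choosing preimages. This is how the
  quotient becomes a representation: its operations are set operations on cosets, so checking them
  directly would be awkward. The image of zero is prescribed because \<open>W\<close> is not yet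
  known to be a group.\<close>

lemma representation_surj_image:
  fixes V (structure)
  assumes V: "representation G V" and f: "intertwiner G V W f"
    and surj: "f ` carrier V = carrier W" and zero: "f \<zero> = \<zero>\<^bsub>W\<^esub>"
  shows "representation G W"
proof -
  interpret V: vectorspace class_ring V using V by (simp add: representation_def)
  note f = f[unfolded intertwiner_iff]
  have add: "f x \<oplus>\<^bsub>W\<^esub> f y = f (x \<oplus> y)" if "x \<in> carrier V" "y \<in> carrier V" for x y
    using f that by simp
  have smult: "c \<odot>\<^bsub>W\<^esub> f x = f (c \<odot> x)" if "x \<in> carrier V" for x c
    using f that by simp
  have act: "act W g (f x) = f (act V g x)" if "x \<in> carrier V" "g \<in> carrier G" for x g
    using f that by simp
  have ex: "\<exists>v\<in>carrier V. x = f v" if "x \<in> carrier W" for x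
    using surj that by blast
  have cl: "f x \<in> carrier W" if "x \<in> carrier V" for x using f that by blast
  have ag: "abelian_group W"
  proof (rule abelian_groupI)
    fix x y z assume "x \<in> carrier W" "y \<in> carrier W" "z \<in> carrier W"
    then obtain a b c where [simp]: "x = f a" "y = f b" "z = f c"
      "a \<in> carrier V" "b \<in> carrier V" "c \<in> carrier V" using ex by metis
    show "x \<oplus>\<^bsub>W\<^esub> y \<oplus>\<^bsub>W\<^esub> z = x \<oplus>\<^bsub>W\<^esub> (y \<oplus>\<^bsub>W\<^esub> z)" by (simp add: add V.a_assoc)
  next
    fix x y assume "x \<in> carrier W" "y \<in> carrier W"
    then obtain a b where [simp]: "x = f a" "y = f b" "a \<in> carrier V" "b \<in> carrier V" using ex by metis
    show "x \<oplus>\<^bsub>W\<^esub> y \<in> carrier W" by (simp add: add cl)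
    show "x \<oplus>\<^bsub>W\<^esub> y = y \<oplus>\<^bsub>W\<^esub> x" by (simp add: add V.a_comm)
  next
    fix x assume "x \<in> carrier W"
    then obtain a where a[simp]: "x = f a" "a \<in> carrier V" using ex by metis
    show "\<zero>\<^bsub>W\<^esub> \<oplus>\<^bsub>W\<^esub> x = x" unfolding zero[symmetric] by (simp add: add)
    show "\<exists>y\<in>carrier W. y \<oplus>\<^bsub>W\<^esub> x = \<zero>\<^bsub>W\<^esub>" unfolding zero[symmetric]
      by (rule bexI[of _ "f (\<ominus> a)"]) (simp_all add: add V.l_neg cl)
  qed (simp add: cl flip: zero)
  have "module class_ring W"
  proof (rule moduleI[OF class_cring.cring_axioms ag])
    fix a b x assume "x \<in> carrier W"
    then obtain v where [simp]: "x = f v" "v \<in> carrier V" using ex by metis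
    show "a \<odot>\<^bsub>W\<^esub> x \<in> carrier W" by (simp add: smult cl)
    show "(a \<oplus>\<^bsub>class_ring\<^esub> b) \<odot>\<^bsub>W\<^esub> x = a \<odot>\<^bsub>W\<^esub> x \<oplus>\<^bsub>W\<^esub> b \<odot>\<^bsub>W\<^esub> x"
      using V.smult_l_distr[of a b v] by (simp add: smult add)
    show "(a \<otimes>\<^bsub>class_ring\<^esub> b) \<odot>\<^bsub>W\<^esub> x = a \<odot>\<^bsub>W\<^esub> (b \<odot>\<^bsub>W\<^esub> x)"
      using V.smult_assoc1[of a b v] by (simp add: smult)
    show "\<one>\<^bsub>class_ring\<^esub> \<odot>\<^bsub>W\<^esub> x = x" using V.smult_one[of v] by (simp add: smult)
  next
    fix a x y assume "x \<in> carrier W" "y \<in> carrier W"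
    then obtain u v where [simp]: "x = f u" "y = f v" "u \<in> carrier V" "v \<in> carrier V" using ex by metis
    show "a \<odot>\<^bsub>W\<^esub> (x \<oplus>\<^bsub>W\<^esub> y) = a \<odot>\<^bsub>W\<^esub> x \<oplus>\<^bsub>W\<^esub> a \<odot>\<^bsub>W\<^esub> y"
      by (simp add: smult add V.smult_r_distr)
  qed
  then have "vectorspace class_ring W"
    by (simp add: vectorspace_def class_field)
  moreover have "act W g \<in> module_hom class_ring W W" if g: "g \<in> carrier G" for g
  proof -
    have "act W g x \<in> carrier W" if "x \<in> carrier W" for x
      using ex[OF that] g by (auto simp: act cl representation_closed(4)[OF V])
    moreover have "act W g (x \<oplus>\<^bsub>W\<^esub> y) = act W g x \<oplus>\<^bsub>W\<^esub> act W g y"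
      if "x \<in> carrier W" "y \<in> carrier W" for x y
      using ex[OF that(1)] ex[OF that(2)] g
      by (auto simp: act add representation_act[OF V] representation_closed[OF V])
    moreover have "act W g (c \<odot>\<^bsub>W\<^esub> x) = c \<odot>\<^bsub>W\<^esub> act W g x" if "x \<in> carrier W" for x c
      using ex[OF that(1)] g
      by (auto simp: act smult representation_act[OF V] representation_closed[OF V])
    ultimately show ?thesis by (auto simp: module_hom_def)
  qed
  moreover have G: "group G" using V by (simp add: representation_def)
  moreover have "act W \<one>\<^bsub>G\<^esub> x = x" if "x \<in> carrier W" for x
    using ex[OF that] G V by (auto simp: act group.is_monoid monoid.one_closed representation_def)
  moreover have "act W (g \<otimes>\<^bsub>G\<^esub> h) x = act W g (act W h x)"
    if "x \<in> carrier W" "g \<in> carrier G" "h \<in> carrier G" for x g h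
    using ex[OF that(1)] that G
    by (auto simp: act group.is_monoid monoid.m_closed representation_act[OF V] representation_closed[OF V])
  ultimately show ?thesis by (simp add: representation_def)
qed

text \<open>Two surjections from \<open>D\<close> with the same fibres induce an isomorphism of
  their targets, by choosing preimages. Inverses, the first isomorphism theorem and the butterfly
  lemma are all instances. Fibres are compared through equality of values, which makes sense before
  anything is known about \<open>A\<close> and \<open>B\<close>.\<close>

lemma rep_iso_common_cover:
  assumes D: "representation G D" and a: "intertwiner G D A a" and b: "intertwiner G D B b"
    and surj: "a ` carrier D = carrier A" "b ` carrier D = carrier B"
    and ker: "\<And>x y. x \<in> carrier D \<Longrightarrow> y \<in> carrier D \<Longrightarrow> a x = a y \<longleftrightarrow> b x = b y"
  shows "rep_iso G A B"
proof -
  define f where "f = (\<lambda>y. b (inv_into (carrier D) a y))"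
  have fa: "f (a x) = b x" if "x \<in> carrier D" for x
    using ker[of "inv_into (carrier D) a (a x)" x] that
    by (simp add: f_def inv_into_into f_inv_into_f)
  have ex: "\<exists>x\<in>carrier D. y = a x" if "y \<in> carrier A" for y using that surj(1) by blast
  note a = a[unfolded intertwiner_iff] and b = b[unfolded intertwiner_iff]
  note cl = representation_closed[OF D]
  have "f (x \<oplus>\<^bsub>A\<^esub> y) = f x \<oplus>\<^bsub>B\<^esub> f y" if "x \<in> carrier A" "y \<in> carrier A" for x y
  proof -
    from that obtain u v where uv: "x = a u" "y = a v" "u \<in> carrier D" "v \<in> carrier D" using ex by metis
    then have "x \<oplus>\<^bsub>A\<^esub> y = a (u \<oplus>\<^bsub>D\<^esub> v)" using a by simp
    then show ?thesis using uv b by (simp add: fa cl)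
  qed
  moreover have "f (c \<odot>\<^bsub>A\<^esub> x) = c \<odot>\<^bsub>B\<^esub> f x" if "x \<in> carrier A" for c x
  proof -
    from that obtain u where uv: "x = a u" "u \<in> carrier D" using ex by metis
    then have "c \<odot>\<^bsub>A\<^esub> x = a (c \<odot>\<^bsub>D\<^esub> u)" using a by simp
    then show ?thesis using uv b by (simp add: fa cl)
  qed
  moreover have "f (act A g x) = act B g (f x)" if "x \<in> carrier A" "g \<in> carrier G" for g x
  proof -
    from that obtain u where uv: "x = a u" "u \<in> carrier D" using ex by metis
    then have "act A g x = a (act D g u)" using a that by simp
    then show ?thesis using uv b that by (simp add: fa cl)
  qed
  moreover have bij: "bij_betw f (carrier A) (carrier B)"
  proof -
    have "f ` carrier A = carrier B"
      unfolding surj[symmetric] image_image by (simp add: fa)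
    moreover have "inj_on f (carrier A)"
      by (rule inj_onI) (metis ex fa ker)
    ultimately show ?thesis by (simp add: bij_betw_def)
  qed
  moreover have "f x \<in> carrier B" if "x \<in> carrier A" for x
    using bij that by (auto simp: bij_betw_def)
  ultimately have "f \<in> module_hom class_ring A B"
    by (auto simp: module_hom_def)
  with bij \<open>\<And>g x. x \<in> carrier A \<Longrightarrow> g \<in> carrier G \<Longrightarrow> f (act A g x) = act B g (f x)\<close> show ?thesis
    unfolding rep_iso_def by blast
qed

lemma rep_iso_iff:
  "rep_iso G V W \<longleftrightarrow> (\<exists>f. intertwiner G V W f \<and> bij_betw f (carrier V) (carrier W))"
  by (auto simp: rep_iso_def intertwiner_def)

lemma intertwiner_id: "intertwiner G V V (\<lambda>x. x)"
  by (simp add: intertwiner_iff)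

lemma intertwiner_comp:
  "intertwiner G U V f \<Longrightarrow> intertwiner G V W h \<Longrightarrow> intertwiner G U W (\<lambda>x. h (f x))"
  by (simp add: intertwiner_iff)

lemma rep_iso_sym:
  assumes "representation G V" "rep_iso G V W"
  shows "rep_iso G W V"
proof -
  from assms(2) obtain f where f: "intertwiner G V W f" "bij_betw f (carrier V) (carrier W)"
    by (auto simp: rep_iso_iff)
  show ?thesis
    by (rule rep_iso_common_cover[OF assms(1) f(1) intertwiner_id])
      (use f(2) in \<open>auto simp: bij_betw_def inj_on_eq_iff\<close>)
qed

lemma rep_iso_trans:
  assumes "rep_iso G U V" "rep_iso G V W"
  shows "rep_iso G U W"
proof -
  from assms obtain f h where f: "intertwiner G U V f" "bij_betw f (carrier U) (carrier V)"
    and h: "intertwiner G V W h" "bij_betw h (carrier V) (carrier W)"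
    by (auto simp: rep_iso_iff)
  have "bij_betw (\<lambda>x. h (f x)) (carrier U) (carrier W)"
    using bij_betw_trans[OF f(2) h(2)] by (simp add: comp_def)
  then show ?thesis
    using intertwiner_comp[OF f(1) h(1)] by (auto simp: rep_iso_iff)
qed

lemma intertwiner_zero:
  fixes V (structure)
  assumes "representation G V" "representation G W" "intertwiner G V W f"
  shows "f \<zero> = \<zero>\<^bsub>W\<^esub>"
proof -
  interpret V: vectorspace class_ring V using assms by (simp add: representation_def)
  interpret W: vectorspace class_ring W using assms by (simp add: representation_def)
  have "f (0 \<odot> \<zero>) = 0 \<odot>\<^bsub>W\<^esub> f \<zero>" "f \<zero> \<in> carrier W"
    using assms(3) V.zero_closed unfolding intertwiner_iff by blast+
  then show ?thesis using V.lmult_0[of "\<zero>"] W.lmult_0[of "f \<zero>"] by simp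
qed

lemma invariant_subspace_image:
  assumes V: "representation G V" and W: "representation G W" and f: "intertwiner G V W f"
    and U: "invariant_subspace G V U"
  shows "invariant_subspace G W (f ` U)"
proof -
  note U = U[unfolded invariant_subspace_iff[OF V]]
  have sub: "x \<in> carrier V" if "x \<in> U" for x using U that by blast
  note f' = f[unfolded intertwiner_iff]
  have "\<zero>\<^bsub>W\<^esub> \<in> f ` U" using intertwiner_zero[OF V W f] U by (metis imageI)
  moreover have "f x \<oplus>\<^bsub>W\<^esub> f y \<in> f ` U" if "x \<in> U" "y \<in> U" for x y
    using f' U that sub by (metis imageI)
  moreover have "c \<odot>\<^bsub>W\<^esub> f x \<in> f ` U" if "x \<in> U" for x c
    using f' U that sub by (metis imageI)
  moreover have "act W g (f x) \<in> f ` U" if "x \<in> U" "g \<in> carrier G" for x g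
    using f' U that sub by (metis imageI)
  ultimately show ?thesis
    unfolding invariant_subspace_iff[OF W] using f' sub by blast
qed

lemma irreducible_rep_iso:
  fixes V (structure)
  assumes irr: "irreducible_rep G V" and W: "representation G W" and iso: "rep_iso G V W"
  shows "irreducible_rep G W"
proof -
  have V: "representation G V" using irr by (simp add: irreducible_rep_def)
  from rep_iso_sym[OF V iso] obtain f where f: "intertwiner G W V f" "bij_betw f (carrier W) (carrier V)"
    by (auto simp: rep_iso_iff)
  note z = intertwiner_zero[OF W V f(1)]
  have im: "U = U'" if "f ` U = f ` U'" "U \<subseteq> carrier W" "U' \<subseteq> carrier W" for U U'
    using that f(2) by (metis bij_betw_def inj_on_image_eq_iff)
  have z': "f ` {\<zero>\<^bsub>W\<^esub>} = {\<zero>}" "{\<zero>\<^bsub>W\<^esub>} \<subseteq> carrier W"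
    using z representation_closed[OF W] by auto
  have "U = {\<zero>\<^bsub>W\<^esub>} \<or> U = carrier W" if U: "invariant_subspace G W U" for U
  proof -
    have "f ` U = {\<zero>} \<or> f ` U = carrier V"
      using invariant_subspace_image[OF W V f(1) U] irr by (simp add: irreducible_rep_def)
    moreover have "U \<subseteq> carrier W" using U by (simp add: invariant_subspace_iff[OF W])
    ultimately show ?thesis using im[of U] z' f(2) by (metis bij_betw_def order_refl)
  qed
  moreover have "carrier W \<noteq> {\<zero>\<^bsub>W\<^esub>}"
    using f(2) z' irr by (metis bij_betw_def irreducible_rep_def)
  ultimately show ?thesis using W by (simp add: irreducible_rep_def)
qed

section \<open>Subrepresentations and quotients\<close>

lemma subrepresentation:
  assumes V: "representation G V" and W: "invariant_subspace G V W"
  shows "representation G (V\<lparr>carrier := W\<rparr>)"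
proof -
  have "subspace class_ring W V" using W by (simp add: invariant_subspace_def)
  then have "vectorspace class_ring (V\<lparr>carrier := W\<rparr>)"
    using V vectorspace.subspace_is_vs by (auto simp: representation_def)
  then show ?thesis
    using V W by (auto simp: representation_def invariant_subspace_iff[OF V] module_hom_def subset_iff)
qed

lemma invariant_subspace_mono:
  assumes V: "representation G V" and W: "invariant_subspace G V W" and U: "invariant_subspace G V U"
    and "U \<subseteq> W"
  shows "invariant_subspace G (V\<lparr>carrier := W\<rparr>) U"
  using assms by (simp add: invariant_subspace_iff[OF V] invariant_subspace_iff[OF subrepresentation[OF V W]])

lemma quot_rep_sel:
  "carrier (quot_rep V W) = a_rcosets\<^bsub>V\<^esub> W" "zero (quot_rep V W) = W" "add (quot_rep V W) = set_add V"
  "smult (quot_rep V W) c X = W <+>\<^bsub>V\<^esub> ((\<lambda>x. c \<odot>\<^bsub>V\<^esub> x) ` X)" "act (quot_rep V W) g X = act V g ` X"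
  by (simp_all add: quot_rep_def)

lemma quotient_map:
  fixes V (structure)
  assumes V: "representation G V" and W: "invariant_subspace G V W"
  defines "\<pi> \<equiv> \<lambda>x. W +> x"
  shows "intertwiner G V (quot_rep V W) \<pi>"
    and "\<pi> ` carrier V = carrier (quot_rep V W)"
    and "\<pi> \<zero> = \<zero>\<^bsub>quot_rep V W\<^esub>"
    and "\<And>x y. x \<in> carrier V \<Longrightarrow> y \<in> carrier V \<Longrightarrow> \<pi> x = \<pi> y \<longleftrightarrow> x \<ominus> y \<in> W"
proof -
  interpret V: vectorspace class_ring V using V by (simp add: representation_def)
  interpret G: group G using V by (simp add: representation_def)
  note W' = W[unfolded invariant_subspace_iff[OF V]]
  have sub: "w \<in> carrier V" if "w \<in> W" for w using W' that by blast
  have mem: "z \<in> \<pi> x \<longleftrightarrow> (\<exists>w\<in>W. z = w \<oplus> x)" for x z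
    by (auto simp: \<pi>_def a_r_coset_def')
  interpret W: abelian_subgroup W V
  proof (rule abelian_subgroupI3)
    have "subgroup W (add_monoid V)"
    proof (rule V.add.subgroupI)
      show "W \<noteq> {}" using W' by blast
      show "\<ominus> x \<in> W" if "x \<in> W" for x
        using subspace_diff[OF V W _ that, of "\<zero>"] W' sub[OF that] by (simp add: a_minus_def)
    qed (use W' in auto)
    then show "additive_subgroup W V" by (rule additive_subgroup.intro)
  qed (rule V.abelian_group_axioms)
  note add = W.a_rcos_sum[folded \<pi>_def, symmetric]
  \<comment> \<open>An element \<open>w + c x\<close> lies in the right-hand side through the
    representative \<open>x\<close> itself; conversely \<open>w + c (w' + x)\<close> regroups as
    \<open>(w + c w') + c x\<close>.\<close>
  have smult: "\<pi> (c \<odot> x) = W <+>\<^bsub>V\<^esub> ((\<lambda>x. c \<odot> x) ` \<pi> x)" if x: "x \<in> carrier V" for x c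
  proof -
    have "z \<in> W <+>\<^bsub>V\<^esub> ((\<lambda>x. c \<odot> x) ` \<pi> x)" if "z \<in> \<pi> (c \<odot> x)" for z
    proof -
      from that obtain w where w: "w \<in> W" "z = w \<oplus> c \<odot> x" by (auto simp: mem)
      moreover have "x \<in> \<pi> x" using W' x by (auto simp: mem intro!: bexI[of _ "\<zero>"])
      ultimately show ?thesis unfolding set_add_def' by blast
    qed
    moreover have "z \<in> \<pi> (c \<odot> x)" if "z \<in> W <+>\<^bsub>V\<^esub> ((\<lambda>x. c \<odot> x) ` \<pi> x)" for z
    proof -
      from that obtain w w' where w: "w \<in> W" "w' \<in> W" "z = w \<oplus> c \<odot> (w' \<oplus> x)"
        by (auto simp: set_add_def' mem)
      then have "z = (w \<oplus> c \<odot> w') \<oplus> c \<odot> x" using x sub by (simp add: V.a_assoc V.smult_r_distr)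
      then show ?thesis using w W' mem by blast
    qed
    ultimately show ?thesis by blast
  qed
  have act: "\<pi> (act V g x) = act V g ` \<pi> x" if x: "x \<in> carrier V" and g: "g \<in> carrier G" for x g
  proof -
    have "z \<in> act V g ` \<pi> x" if "z \<in> \<pi> (act V g x)" for z
    proof -
      from that obtain w where w: "w \<in> W" "z = w \<oplus> act V g x" by (auto simp: mem)
      \<comment> \<open>The action on a coset is an image of sets, so \<open>w\<close> must be hit
        exactly; its preimage under \<open>g\<close> stays in \<open>W\<close> because
        \<open>W\<close> is invariant under the inverse of \<open>g\<close> as well.\<close>
      define w' where "w' = act V (inv\<^bsub>G\<^esub> g) w"
      have w': "w' \<in> W" using W' w g by (simp add: w'_def)
      have "act V g w' = act V (g \<otimes>\<^bsub>G\<^esub> inv\<^bsub>G\<^esub> g) w"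
        unfolding w'_def using representation_act(3)[OF V g sub[OF w(1)], of "inv\<^bsub>G\<^esub> g"] g by simp
      also have "\<dots> = w" using representation_act(4)[OF V g sub[OF w(1)]] g by simp
      finally have "z = act V g (w' \<oplus> x)"
        using w x sub[OF w'] by (simp add: representation_act[OF V g])
      then show ?thesis using w' mem by blast
    qed
    moreover have "z \<in> \<pi> (act V g x)" if "z \<in> act V g ` \<pi> x" for z
    proof -
      from that obtain w where w: "w \<in> W" "z = act V g (w \<oplus> x)" by (auto simp: mem)
      then have "z = act V g w \<oplus> act V g x" using x sub by (simp add: representation_act[OF V g])
      then show ?thesis using w W' g mem by blast
    qed
    ultimately show ?thesis by blast
  qed
  show im: "\<pi> ` carrier V = carrier (quot_rep V W)"
    by (auto simp: quot_rep_sel A_RCOSETS_def' \<pi>_def)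
  show "intertwiner G V (quot_rep V W) \<pi>"
    unfolding intertwiner_iff using im by (auto simp: quot_rep_sel add smult act)
  show "\<pi> \<zero> = \<zero>\<^bsub>quot_rep V W\<^esub>"
    using mem[of _ "\<zero>"] sub by (auto simp: quot_rep_sel)
  fix x y assume xy: "x \<in> carrier V" "y \<in> carrier V"
  show "\<pi> x = \<pi> y \<longleftrightarrow> x \<ominus> y \<in> W"
  proof
    assume eq: "\<pi> x = \<pi> y"
    have "x \<in> \<pi> x" using W' xy by (auto simp: mem intro!: bexI[of _ "\<zero>"])
    then obtain w where "w \<in> W" "x = w \<oplus> y" using eq mem by auto
    then show "x \<ominus> y \<in> W" using xy sub by (simp add: a_minus_def V.a_assoc V.r_neg)
  next
    assume d: "x \<ominus> y \<in> W"
    have "x = (x \<ominus> y) \<oplus> y" using xy by (simp add: a_minus_def V.a_assoc V.l_neg)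
    then have "\<pi> x = \<pi> (x \<ominus> y) <+>\<^bsub>V\<^esub> \<pi> y" using add[of "x \<ominus> y" y] xy by simp
    also have "\<pi> (x \<ominus> y) = \<pi> \<zero>"
      unfolding \<pi>_def using d W' by (simp only: W.a_rcos_const)
    also have "\<pi> \<zero> <+>\<^bsub>V\<^esub> \<pi> y = \<pi> y" using add[of "\<zero>" y] xy by simp
    finally show "\<pi> x = \<pi> y" .
  qed
qed

lemma representation_quot_rep:
  "representation G V \<Longrightarrow> invariant_subspace G V W \<Longrightarrow> representation G (quot_rep V W)"
  using representation_surj_image[OF _ quotient_map(1-3)] by blast

abbreviation subquot :: "('g, 'v) rep \<Rightarrow> 'v set \<Rightarrow> 'v set \<Rightarrow> ('g, 'v set) rep" where
  "subquot V W U \<equiv> quot_rep (V\<lparr>carrier := W\<rparr>) U"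

text \<open>The first isomorphism theorem: \<open>f\<close> and the coset map on \<open>W\<close>
  have the same fibres, since in both cases equality means that the difference lies in
  \<open>U\<close>.\<close>

lemma rep_iso_quot:
  assumes V: "representation G V" and W: "invariant_subspace G V W" and U: "invariant_subspace G V U"
    and "U \<subseteq> W" and L: "representation G L" and f: "intertwiner G (V\<lparr>carrier := W\<rparr>) L f"
    and surj: "f ` W = carrier L" and ker: "\<And>x. x \<in> W \<Longrightarrow> f x = \<zero>\<^bsub>L\<^esub> \<longleftrightarrow> x \<in> U"
  shows "rep_iso G (subquot V W U) L"
proof -
  define D where "D = V\<lparr>carrier := W\<rparr>"
  have D: "representation G D" unfolding D_def by (rule subrepresentation[OF V W])
  have UD: "invariant_subspace G D U" unfolding D_def by (rule invariant_subspace_mono) fact+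
  interpret L: vectorspace class_ring L using L by (simp add: representation_def)
  interpret D: vectorspace class_ring D using D by (simp add: representation_def)
  note f' = f[folded D_def, unfolded intertwiner_iff]
  have car: "carrier D = W" by (simp add: D_def)
  have diff: "f (x \<ominus>\<^bsub>D\<^esub> y) = f x \<ominus>\<^bsub>L\<^esub> f y" if "x \<in> carrier D" "y \<in> carrier D" for x y
    using f' that a_inv_eq_smult[OF D.vectorspace_axioms] a_inv_eq_smult[OF L.vectorspace_axioms]
    by (simp add: a_minus_def)
  show ?thesis unfolding D_def[symmetric]
  proof (rule rep_iso_common_cover[OF D])
    show "intertwiner G D (quot_rep D U) (\<lambda>x. U +>\<^bsub>D\<^esub> x)" "(\<lambda>x. U +>\<^bsub>D\<^esub> x) ` carrier D = carrier (quot_rep D U)"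
      using quotient_map[OF D UD] by simp_all
    show "intertwiner G D L f" "f ` carrier D = carrier L"
      using f surj by (simp_all add: D_def)
    fix x y assume xy: "x \<in> carrier D" "y \<in> carrier D"
    have "f x = f y \<longleftrightarrow> f x \<ominus>\<^bsub>L\<^esub> f y = \<zero>\<^bsub>L\<^esub>" using f' xy by simp
    also have "\<dots> \<longleftrightarrow> x \<ominus>\<^bsub>D\<^esub> y \<in> U" using ker[of "x \<ominus>\<^bsub>D\<^esub> y"] xy diff by (simp add: car[symmetric])
    also have "\<dots> \<longleftrightarrow> U +>\<^bsub>D\<^esub> x = U +>\<^bsub>D\<^esub> y" using quotient_map(4)[OF D UD] xy by simp
    finally show "U +>\<^bsub>D\<^esub> x = U +>\<^bsub>D\<^esub> y \<longleftrightarrow> f x = f y" ..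
  qed
qed

section \<open>The Jordan-Hoelder theorem\<close>

text \<open>The coset map of a subquotient, with its fibres described by subtraction in the ambient
  \<open>V\<close>. This lets subquotients over different subspaces of \<open>V\<close> be
  compared.\<close>

lemma quot_map_sub:
  fixes V (structure)
  assumes V: "representation G V" and W: "invariant_subspace G V W" and U: "invariant_subspace G V U"
    and UW: "U \<subseteq> W"
  obtains \<pi> where "intertwiner G (V\<lparr>carrier := W\<rparr>) (subquot V W U) \<pi>"
    and "\<pi> ` W = carrier (subquot V W U)"
    and "\<pi> \<zero> = \<zero>\<^bsub>subquot V W U\<^esub>"
    and "\<And>x y. x \<in> W \<Longrightarrow> y \<in> W \<Longrightarrow> \<pi> x = \<pi> y \<longleftrightarrow> x \<ominus> y \<in> U"
proof -
  define D where "D = V\<lparr>carrier := W\<rparr>"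
  have D: "representation G D" unfolding D_def by (rule subrepresentation[OF V W])
  have UD: "invariant_subspace G D U" unfolding D_def by (rule invariant_subspace_mono) fact+
  have vs: "vectorspace class_ring V" "vectorspace class_ring D"
    using V D by (simp_all add: representation_def)
  have "x \<ominus>\<^bsub>D\<^esub> y = x \<ominus> y" if "x \<in> W" "y \<in> W" for x y
  proof -
    have "y \<in> carrier V" "y \<in> carrier D" using that W by (auto simp: D_def invariant_subspace_iff[OF V])
    then show ?thesis
      using a_inv_eq_smult[OF vs(1)] a_inv_eq_smult[OF vs(2)] by (simp add: a_minus_def D_def)
  qed
  then have ker: "(U +>\<^bsub>D\<^esub> x = U +>\<^bsub>D\<^esub> y) = (x \<ominus> y \<in> U)" if "x \<in> W" "y \<in> W" for x y
    using quotient_map(4)[OF D UD] that by (simp add: D_def)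
  have im: "(\<lambda>x. U +>\<^bsub>D\<^esub> x) ` W = carrier (quot_rep D U)"
    using quotient_map(2)[OF D UD] by (simp add: D_def)
  have zero: "U +>\<^bsub>D\<^esub> \<zero> = \<zero>\<^bsub>quot_rep D U\<^esub>"
    using quotient_map(3)[OF D UD] by (simp add: D_def)
  show ?thesis
    by (rule that[folded D_def, OF quotient_map(1)[OF D UD] im zero ker])
qed

text \<open>The image of an intermediate \<open>X\<close> in the quotient is invariant, so it is
  zero or everything; since \<open>U\<close> is contained in \<open>X\<close>, the image determines
  \<open>X\<close>.\<close>

lemma irreducible_quot_maximal:
  fixes V (structure)
  assumes V: "representation G V" and W: "invariant_subspace G V W" and U: "invariant_subspace G V U"
    and UW: "U \<subseteq> W" and irr: "irreducible_rep G (subquot V W U)"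
  shows "U \<noteq> W"
    and "invariant_subspace G V X \<Longrightarrow> U \<subseteq> X \<Longrightarrow> X \<subseteq> W \<Longrightarrow> X = U \<or> X = W"
proof -
  define D where "D = V\<lparr>carrier := W\<rparr>"
  define Q where "Q = quot_rep D U"
  obtain \<pi> where \<pi>: "intertwiner G D Q \<pi>" "\<pi> ` W = carrier Q" "\<pi> \<zero> = \<zero>\<^bsub>Q\<^esub>"
    and ker: "\<And>x y. x \<in> W \<Longrightarrow> y \<in> W \<Longrightarrow> \<pi> x = \<pi> y \<longleftrightarrow> x \<ominus> y \<in> U"
    by (rule quot_map_sub[OF V W U UW, folded D_def, folded Q_def]) (rule that)
  have D: "representation G D" unfolding D_def by (rule subrepresentation[OF V W])
  have Q: "representation G Q" and irr: "carrier Q \<noteq> {\<zero>\<^bsub>Q\<^esub>}"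
    "\<And>Y. invariant_subspace G Q Y \<Longrightarrow> Y = {\<zero>\<^bsub>Q\<^esub>} \<or> Y = carrier Q"
    using irr by (auto simp: irreducible_rep_def Q_def D_def)
  interpret V: vectorspace class_ring V using V by (simp add: representation_def)
  note W' = W[unfolded invariant_subspace_iff[OF V]] and U' = U[unfolded invariant_subspace_iff[OF V]]
  have c: "x \<in> carrier V" if "x \<in> W" for x using that W' by blast
  have m0: "\<ominus> \<zero> = \<zero>" by (rule V.minus_equality) simp_all
  have ker0: "\<pi> x = \<zero>\<^bsub>Q\<^esub> \<longleftrightarrow> x \<in> U" if "x \<in> W" for x
    using ker[OF that, of "\<zero>"] \<pi>(3) W' c[OF that] by (simp add: a_minus_def m0)
  have z: "\<zero>\<^bsub>Q\<^esub> \<in> \<pi> ` Y" if "\<zero> \<in> Y" for Y using that \<pi>(3) by (metis imageI)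
  show "U \<noteq> W"
  proof
    assume "U = W"
    then have "\<pi> ` W \<subseteq> {\<zero>\<^bsub>Q\<^esub>}" using ker0 by auto
    moreover have "\<zero>\<^bsub>Q\<^esub> \<in> \<pi> ` W" using z W' by simp
    ultimately have "\<pi> ` W = {\<zero>\<^bsub>Q\<^esub>}" by (metis empty_iff subset_singletonD)
    then show False using \<pi>(2) irr(1) by simp
  qed
  assume X: "invariant_subspace G V X" "U \<subseteq> X" "X \<subseteq> W"
  have "invariant_subspace G D X" unfolding D_def by (rule invariant_subspace_mono[OF V W X(1,3)])
  then have "\<pi> ` X = {\<zero>\<^bsub>Q\<^esub>} \<or> \<pi> ` X = carrier Q"
    by (intro irr(2) invariant_subspace_image[OF D Q \<pi>(1)])
  then show "X = U \<or> X = W"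
  proof
    assume "\<pi> ` X = {\<zero>\<^bsub>Q\<^esub>}"
    then have "\<pi> x = \<zero>\<^bsub>Q\<^esub>" if "x \<in> X" for x using that by (metis imageI singletonD)
    then have "X \<subseteq> U" using ker0 subsetD[OF X(3)] by auto
    then show ?thesis using X(2) by simp
  next
    assume all: "\<pi> ` X = carrier Q"
    have "w \<in> X" if w: "w \<in> W" for w
    proof -
      have "\<pi> w \<in> \<pi> ` X" unfolding all \<pi>(2)[symmetric] using w by (rule imageI)
      then obtain x where x: "x \<in> X" "\<pi> w = \<pi> x" by (elim imageE)
      then have "w \<ominus> x \<in> U" using ker[OF w, of x] subsetD[OF X(3)] by simp
      then have "w \<ominus> x \<in> X" using X(2) by (rule rev_subsetD)
      then have "(w \<ominus> x) \<oplus> x \<in> X" using x X(1) by (simp add: invariant_subspace_iff[OF V])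
      moreover have "(w \<ominus> x) \<oplus> x = w"
        using c[OF w] c[of x] x X by (auto simp: a_minus_def V.a_assoc V.l_neg)
      ultimately show ?thesis by simp
    qed
    then show ?thesis using X(3) by (simp add: subset_antisym subsetI)
  qed
qed

section \<open>Intersections and sums of invariant subspaces, and matching of two series\<close>

lemma invariant_subspace_Int:
  "representation G V \<Longrightarrow> invariant_subspace G V U \<Longrightarrow> invariant_subspace G V W \<Longrightarrow>
    invariant_subspace G V (U \<inter> W)"
  by (auto simp: invariant_subspace_iff)

lemma set_add_iff: "z \<in> U <+>\<^bsub>V\<^esub> W \<longleftrightarrow> (\<exists>u\<in>U. \<exists>w\<in>W. z = u \<oplus>\<^bsub>V\<^esub> w)"
  by (auto simp: set_add_def')

lemma invariant_subspace_set_add: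
  fixes V (structure)
  assumes V: "representation G V" and U: "invariant_subspace G V U" and W: "invariant_subspace G V W"
  shows "invariant_subspace G V (U <+>\<^bsub>V\<^esub> W)" "U \<subseteq> U <+>\<^bsub>V\<^esub> W" "W \<subseteq> U <+>\<^bsub>V\<^esub> W"
proof -
  interpret V: vectorspace class_ring V using V by (simp add: representation_def)
  note U' = U[unfolded invariant_subspace_iff[OF V]] and W' = W[unfolded invariant_subspace_iff[OF V]]
  have c: "x \<in> carrier V" if "x \<in> U \<or> x \<in> W" for x using that U' W' by blast
  show s1: "U \<subseteq> U <+>\<^bsub>V\<^esub> W"
  proof
    fix x assume x: "x \<in> U"
    then have "x = x \<oplus> \<zero>" using c by simp
    then show "x \<in> U <+>\<^bsub>V\<^esub> W" using x W' unfolding set_add_iff by blast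
  qed
  show "W \<subseteq> U <+>\<^bsub>V\<^esub> W"
  proof
    fix x assume x: "x \<in> W"
    then have "x = \<zero> \<oplus> x" using c by simp
    then show "x \<in> U <+>\<^bsub>V\<^esub> W" using x U' unfolding set_add_iff by blast
  qed
  have "x \<oplus> y \<in> U <+>\<^bsub>V\<^esub> W" if xy: "x \<in> U <+>\<^bsub>V\<^esub> W" "y \<in> U <+>\<^bsub>V\<^esub> W" for x y
  proof -
    obtain a b a' b' where ab: "a \<in> U" "b \<in> W" "a' \<in> U" "b' \<in> W" "x = a \<oplus> b" "y = a' \<oplus> b'"
      using xy unfolding set_add_iff by blast
    then have "x \<oplus> y = (a \<oplus> a') \<oplus> (b \<oplus> b')" using c by (simp add: V.a_ac)
    then show ?thesis using ab U' W' unfolding set_add_iff by blast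
  qed
  moreover have "k \<odot> x \<in> U <+>\<^bsub>V\<^esub> W" if x: "x \<in> U <+>\<^bsub>V\<^esub> W" for k x
  proof -
    obtain a b where ab: "a \<in> U" "b \<in> W" "x = a \<oplus> b" using x unfolding set_add_iff by blast
    then have "k \<odot> x = k \<odot> a \<oplus> k \<odot> b" using c by (simp add: V.smult_r_distr)
    then show ?thesis using ab U' W' unfolding set_add_iff by blast
  qed
  moreover have "act V g x \<in> U <+>\<^bsub>V\<^esub> W" if x: "x \<in> U <+>\<^bsub>V\<^esub> W" and g: "g \<in> carrier G" for g x
  proof -
    obtain a b where ab: "a \<in> U" "b \<in> W" "x = a \<oplus> b" using x unfolding set_add_iff by blast
    then have "act V g x = act V g a \<oplus> act V g b" using c by (simp add: representation_act[OF V g])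
    then show ?thesis using ab g U' W' unfolding set_add_iff by blast
  qed
  moreover have "x \<in> carrier V" if "x \<in> U <+>\<^bsub>V\<^esub> W" for x
    using that c unfolding set_add_iff by auto
  moreover have "\<zero> \<in> U <+>\<^bsub>V\<^esub> W" using s1 U' by blast
  ultimately show "invariant_subspace G V (U <+>\<^bsub>V\<^esub> W)" unfolding invariant_subspace_iff[OF V] by blast
qed

lemma set_add_least:
  "representation G V \<Longrightarrow> invariant_subspace G V X \<Longrightarrow> U \<subseteq> X \<Longrightarrow> W \<subseteq> X \<Longrightarrow> U <+>\<^bsub>V\<^esub> W \<subseteq> X"
  by (auto simp: set_add_iff invariant_subspace_iff subset_iff)

text \<open>Zassenhaus's lemma in the case where no refinement is left. By \<open>A\<close> and
  \<open>B\<close> the intersection of \<open>A1\<close> and \<open>B1\<close> maps onto both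
  quotients, and by \<open>eq\<close> the two kernels in it coincide.\<close>

lemma butterfly:
  fixes V (structure)
  assumes V: "representation G V"
    and inv: "invariant_subspace G V A0" "invariant_subspace G V A1" "invariant_subspace G V B0"
      "invariant_subspace G V B1" "A0 \<subseteq> A1" "B0 \<subseteq> B1"
    and A: "A1 \<subseteq> A0 <+>\<^bsub>V\<^esub> (A1 \<inter> B1)" and B: "B1 \<subseteq> B0 <+>\<^bsub>V\<^esub> (A1 \<inter> B1)"
    and eq: "A0 \<inter> B1 = A1 \<inter> B0"
  shows "rep_iso G (subquot V A1 A0) (subquot V B1 B0)"
proof -
  interpret V: vectorspace class_ring V using V by (simp add: representation_def)
  define D where "D = A1 \<inter> B1"
  define QA where "QA = subquot V A1 A0"
  define QB where "QB = subquot V B1 B0"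
  have D: "invariant_subspace G V D" unfolding D_def by (rule invariant_subspace_Int[OF V inv(2,4)])
  have cover: thesis
    if C0: "invariant_subspace G V C0" and C1: "invariant_subspace G V C1" and C: "C0 \<subseteq> C1" "D \<subseteq> C1"
      "C1 \<subseteq> C0 <+>\<^bsub>V\<^esub> D"
    and wit: "\<And>\<pi>. intertwiner G (V\<lparr>carrier := D\<rparr>) (subquot V C1 C0) \<pi> \<Longrightarrow>
      \<pi> ` D = carrier (subquot V C1 C0) \<Longrightarrow>
      (\<And>x y. x \<in> D \<Longrightarrow> y \<in> D \<Longrightarrow> \<pi> x = \<pi> y \<longleftrightarrow> x \<ominus> y \<in> C0) \<Longrightarrow> thesis" for C0 C1 thesis
  proof -
    define Q where "Q = subquot V C1 C0"
    obtain \<pi> where \<pi>: "intertwiner G (V\<lparr>carrier := C1\<rparr>) Q \<pi>" "\<pi> ` C1 = carrier Q"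
      and ker: "\<And>x y. x \<in> C1 \<Longrightarrow> y \<in> C1 \<Longrightarrow> \<pi> x = \<pi> y \<longleftrightarrow> x \<ominus> y \<in> C0"
      by (rule quot_map_sub[OF V C1 C0 C(1), folded Q_def]) (rule that)
    have "intertwiner G (V\<lparr>carrier := D\<rparr>) Q \<pi>"
      using \<pi>(1) C(2) by (simp add: intertwiner_iff subset_iff)
    moreover have "\<pi> ` D = carrier Q"
    proof
      show "\<pi> ` D \<subseteq> carrier Q" using \<pi>(2) C(2) by blast
      show "carrier Q \<subseteq> \<pi> ` D"
      proof
        fix y assume "y \<in> carrier Q"
        then obtain x where x: "x \<in> C1" "y = \<pi> x" using \<pi>(2) by blast
        then obtain a d where ad: "a \<in> C0" "d \<in> D" "x = a \<oplus> d"
          using subsetD[OF C(3)] unfolding set_add_iff by blast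
        have "a \<in> carrier V" "d \<in> carrier V"
          using ad C0 D by (auto simp: invariant_subspace_iff[OF V])
        then have "x \<ominus> d = a" using ad by (simp add: a_minus_def V.a_assoc V.r_neg)
        then have "\<pi> x = \<pi> d" using ker[of x d] x ad C by auto
        then show "y \<in> \<pi> ` D" using x ad by blast
      qed
    qed
    ultimately show thesis
      by (rule wit[folded Q_def]) (use ker C(2) in auto)
  qed
  obtain a where a: "intertwiner G (V\<lparr>carrier := D\<rparr>) QA a" "a ` D = carrier QA"
     "\<And>x y. x \<in> D \<Longrightarrow> y \<in> D \<Longrightarrow> a x = a y \<longleftrightarrow> x \<ominus> y \<in> A0"
  proof (rule cover[OF inv(1,2,5), folded QA_def])
    show "D \<subseteq> A1" "A1 \<subseteq> A0 <+>\<^bsub>V\<^esub> D" using A by (simp_all add: D_def)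
  qed (rule that)
  obtain b where b: "intertwiner G (V\<lparr>carrier := D\<rparr>) QB b" "b ` D = carrier QB"
     "\<And>x y. x \<in> D \<Longrightarrow> y \<in> D \<Longrightarrow> b x = b y \<longleftrightarrow> x \<ominus> y \<in> B0"
  proof (rule cover[OF inv(3,4,6), folded QB_def])
    show "D \<subseteq> B1" "B1 \<subseteq> B0 <+>\<^bsub>V\<^esub> D" using B by (simp_all add: D_def)
  qed (rule that)
  show ?thesis unfolding QA_def[symmetric] QB_def[symmetric]
  proof (rule rep_iso_common_cover[OF subrepresentation[OF V D] a(1) b(1)])
    fix x y assume "x \<in> carrier (V\<lparr>carrier := D\<rparr>)" "y \<in> carrier (V\<lparr>carrier := D\<rparr>)"
    then have xy: "x \<in> D" "y \<in> D" by simp_all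
    then have "x \<ominus> y \<in> D" using subspace_diff[OF V D] by blast
    then have "x \<ominus> y \<in> A0 \<longleftrightarrow> x \<ominus> y \<in> B0" using eq inv unfolding D_def by blast
    then show "a x = a y \<longleftrightarrow> b x = b y" using a(3) b(3) xy by simp
  qed (simp_all add: a b)
qed

text \<open>In the common refinement of two series, the factor \<open>E1/E0\<close> meets \<open>F1/F0\<close> nontrivially.\<close>

definition linked :: "('g, 'v) rep \<Rightarrow> 'v set \<Rightarrow> 'v set \<Rightarrow> 'v set \<Rightarrow> 'v set \<Rightarrow> bool" where
  "linked V E0 E1 F0 F1 \<longleftrightarrow> \<not> E1 \<inter> F1 \<subseteq> (E0 \<inter> F1) <+>\<^bsub>V\<^esub> (E1 \<inter> F0)"

text \<open>Exchanging the two steps only exchanges the summands. This symmetry later turns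
  uniqueness of partners in one direction into a bijection.\<close>

lemma linked_sym:
  fixes V (structure)
  assumes V: "representation G V" and "E1 \<subseteq> carrier V" "F1 \<subseteq> carrier V"
  shows "linked V E0 E1 F0 F1 \<longleftrightarrow> linked V F0 F1 E0 E1"
proof -
  interpret V: vectorspace class_ring V using V by (simp add: representation_def)
  have "(E0 \<inter> F1) <+>\<^bsub>V\<^esub> (E1 \<inter> F0) = (F0 \<inter> E1) <+>\<^bsub>V\<^esub> (F1 \<inter> E0)"
  proof -
    have "x \<in> (B0 \<inter> A1) <+>\<^bsub>V\<^esub> (B1 \<inter> A0)"
      if x: "x \<in> (A0 \<inter> B1) <+>\<^bsub>V\<^esub> (A1 \<inter> B0)" and "A1 \<subseteq> carrier V" "B1 \<subseteq> carrier V" for A0 A1 B0 B1 x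
    proof -
      obtain u w where uw: "u \<in> A0 \<inter> B1" "w \<in> A1 \<inter> B0" "x = u \<oplus> w" using x unfolding set_add_iff by blast
      then have "x = w \<oplus> u" using that by (auto intro: V.a_comm)
      then show ?thesis using uw unfolding set_add_iff by blast
    qed
    then show ?thesis using assms(2,3) by blast
  qed
  then show ?thesis unfolding linked_def by (simp add: Int_commute)
qed

text \<open>By the modular law, being linked means that \<open>F1\<close> enlarges the subspace
  between \<open>E0\<close> and \<open>E1\<close> that \<open>F0\<close> cuts out. So linkage can be
  read off as a jump in a chain.\<close>

lemma linked_iff:
  fixes V (structure)
  assumes V: "representation G V" and inv: "invariant_subspace G V E0" "invariant_subspace G V E1"
      "invariant_subspace G V F0" "invariant_subspace G V F1" "E0 \<subseteq> E1" "F0 \<subseteq> F1"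
  shows "linked V E0 E1 F0 F1 \<longleftrightarrow> E0 <+>\<^bsub>V\<^esub> (E1 \<inter> F0) \<noteq> E0 <+>\<^bsub>V\<^esub> (E1 \<inter> F1)"
proof -
  interpret V: vectorspace class_ring V using V by (simp add: representation_def)
  note I = invariant_subspace_Int[OF V] and S = invariant_subspace_set_add[OF V]
  have sub: "E0 <+>\<^bsub>V\<^esub> (E1 \<inter> F0) \<subseteq> E0 <+>\<^bsub>V\<^esub> (E1 \<inter> F1)"
    using inv(6) unfolding set_add_def' by blast
  have "E1 \<inter> F1 \<subseteq> (E0 \<inter> F1) <+>\<^bsub>V\<^esub> (E1 \<inter> F0) \<longleftrightarrow> E1 \<inter> F1 \<subseteq> E0 <+>\<^bsub>V\<^esub> (E1 \<inter> F0)" (is "?l \<longleftrightarrow> ?r")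
  proof
    assume ?l then show ?r unfolding set_add_def' by blast
  next
    assume r: ?r
    show ?l
    proof
      fix x assume x: "x \<in> E1 \<inter> F1"
      then obtain e f where ef: "e \<in> E0" "f \<in> E1 \<inter> F0" "x = e \<oplus> f" using subsetD[OF r] unfolding set_add_iff by blast
      have c: "e \<in> carrier V" "f \<in> carrier V" using ef inv by (auto simp: invariant_subspace_iff[OF V])
      then have "e = x \<ominus> f" using ef by (simp add: a_minus_def V.a_assoc V.r_neg)
      then have "e \<in> F1" using subspace_diff[OF V inv(4)] x ef inv(6) by blast
      then show "x \<in> (E0 \<inter> F1) <+>\<^bsub>V\<^esub> (E1 \<inter> F0)" using ef unfolding set_add_iff by blast
    qed
  qed
  also have "\<dots> \<longleftrightarrow> E0 <+>\<^bsub>V\<^esub> (E1 \<inter> F1) \<subseteq> E0 <+>\<^bsub>V\<^esub> (E1 \<inter> F0)"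
    using S(2,3)[OF inv(1) I[OF inv(2,3)]] S(3)[OF inv(1) I[OF inv(2,4)]]
      set_add_least[OF V S(1)[OF inv(1) I[OF inv(2,3)]], of E0 "E1 \<inter> F1"] by blast
  finally show ?thesis unfolding linked_def using sub by blast
qed

text \<open>Both subspaces compared in \<open>linked_iff\<close> lie between \<open>E0\<close> and
  \<open>E1\<close>. Irreducibility leaves only these two values, so a strict inclusion runs from
  \<open>E0\<close> to \<open>E1\<close>.\<close>

lemma linked_maximal:
  assumes V: "representation G V" and inv: "invariant_subspace G V E0" "invariant_subspace G V E1"
      "invariant_subspace G V F0" "invariant_subspace G V F1" "E0 \<subseteq> E1" "F0 \<subseteq> F1"
    and irr: "irreducible_rep G (subquot V E1 E0)" and l: "linked V E0 E1 F0 F1"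
  shows "E1 \<inter> F0 \<subseteq> E0" "E1 \<subseteq> E0 <+>\<^bsub>V\<^esub> (E1 \<inter> F1)"
proof -
  note I = invariant_subspace_Int[OF V] and S = invariant_subspace_set_add[OF V]
  have C: "invariant_subspace G V (E0 <+>\<^bsub>V\<^esub> (E1 \<inter> F))" "E0 \<subseteq> E0 <+>\<^bsub>V\<^esub> (E1 \<inter> F)"
     "E1 \<inter> F \<subseteq> E0 <+>\<^bsub>V\<^esub> (E1 \<inter> F)"
     "E0 <+>\<^bsub>V\<^esub> (E1 \<inter> F) \<subseteq> E1" if "invariant_subspace G V F" for F
    using S[OF inv(1) I[OF inv(2) that]] set_add_least[OF V inv(2,5), of "E1 \<inter> F"] by auto
  have max: "E0 <+>\<^bsub>V\<^esub> (E1 \<inter> F) = E0 \<or> E0 <+>\<^bsub>V\<^esub> (E1 \<inter> F) = E1" if "invariant_subspace G V F" for F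
    by (rule irreducible_quot_maximal(2)[OF V inv(2,1,5) irr]) (rule C[OF that])+
  have sub: "E0 <+>\<^bsub>V\<^esub> (E1 \<inter> F0) \<subseteq> E0 <+>\<^bsub>V\<^esub> (E1 \<inter> F1)"
    using inv(6) unfolding set_add_def' by blast
  have "E0 <+>\<^bsub>V\<^esub> (E1 \<inter> F0) = E0 \<and> E0 <+>\<^bsub>V\<^esub> (E1 \<inter> F1) = E1"
    using l max[OF inv(3)] max[OF inv(4)] sub inv(5) unfolding linked_iff[OF V inv] by blast
  then show "E1 \<inter> F0 \<subseteq> E0" "E1 \<subseteq> E0 <+>\<^bsub>V\<^esub> (E1 \<inter> F1)" using C(3)[OF inv(3)] by auto
qed

text \<open>Linkage is symmetric, and \<open>linked_maximal\<close> applied to either step supplies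
  the covering conditions and the equality of kernels in \<open>butterfly\<close>.\<close>

lemma linked_rep_iso:
  assumes V: "representation G V" and inv: "invariant_subspace G V E0" "invariant_subspace G V E1"
      "invariant_subspace G V F0" "invariant_subspace G V F1" "E0 \<subseteq> E1" "F0 \<subseteq> F1"
    and irr: "irreducible_rep G (subquot V E1 E0)"
      "irreducible_rep G (subquot V F1 F0)"
    and l: "linked V E0 E1 F0 F1"
  shows "rep_iso G (subquot V E1 E0) (subquot V F1 F0)"
proof -
  have "E1 \<subseteq> carrier V" "F1 \<subseteq> carrier V" using inv by (auto simp: invariant_subspace_iff[OF V])
  then have l': "linked V F0 F1 E0 E1" using l linked_sym[OF V, of E1 F1 E0 F0] by blast
  note E = linked_maximal[OF V inv irr(1) l]
  note F = linked_maximal[OF V inv(3,4,1,2,6,5) irr(2) l']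
  show ?thesis
    by (rule butterfly[OF V inv]) (use E F inv in \<open>auto simp: Int_commute\<close>)
qed

lemma composition_seriesD:
  assumes V: "representation G V" and cs: "composition_series G V Ws"
  shows "i < length Ws \<Longrightarrow> invariant_subspace G V (Ws ! i)"
    and "Suc i < length Ws \<Longrightarrow> Ws ! i \<subseteq> Ws ! Suc i"
    and "Suc i < length Ws \<Longrightarrow> irreducible_rep G (subquot V (Ws ! Suc i) (Ws ! i))"
    and "Ws ! 0 = {\<zero>\<^bsub>V\<^esub>}" "Ws ! (length Ws - 1) = carrier V" "length Ws > 0"
  using cs unfolding composition_series_def series_factor_def
  by (auto simp: hd_conv_nth last_conv_nth)

text \<open>The chain \<open>C i\<close> climbs from \<open>E0\<close> to \<open>E1\<close> as
  \<open>Fs ! i\<close> grows from zero to everything. Every jump goes all the way from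
  \<open>E0\<close> to \<open>E1\<close>, hence there is exactly one.\<close>

lemma linked_unique:
  fixes V (structure)
  assumes V: "representation G V" and inv: "invariant_subspace G V E0" "invariant_subspace G V E1" "E0 \<subseteq> E1"
    and irr: "irreducible_rep G (subquot V E1 E0)" and cs: "composition_series G V Fs"
  shows "\<exists>!i. Suc i < length Fs \<and> linked V E0 E1 (Fs ! i) (Fs ! Suc i)"
proof -
  interpret V: vectorspace class_ring V using V by (simp add: representation_def)
  note F = composition_seriesD[OF V cs]
  define C where "C i = E0 <+>\<^bsub>V\<^esub> (E1 \<inter> Fs ! i)" for i
  have lk: "linked V E0 E1 (Fs ! i) (Fs ! Suc i) \<longleftrightarrow> C i \<noteq> C (Suc i)" if "Suc i < length Fs" for i
    unfolding C_def using F that by (intro linked_iff[OF V inv(1,2) _ _ inv(3)]) auto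
  have jump: "C i = E0 \<and> C (Suc i) = E1" if "Suc i < length Fs" "C i \<noteq> C (Suc i)" for i
  proof -
    note l = linked_maximal[OF V inv(1,2) F(1) F(1) inv(3) F(2) irr]
    have "linked V E0 E1 (Fs ! i) (Fs ! Suc i)" using lk that by blast
    from l[OF _ _ _ this] that
    have m: "E1 \<inter> Fs ! i \<subseteq> E0" "E1 \<subseteq> C (Suc i)" by (auto simp: C_def)
    have "C i \<subseteq> E0" unfolding C_def by (rule set_add_least[OF V inv(1)]) (use m in auto)
    moreover have "E0 \<subseteq> C i" unfolding C_def
      by (rule invariant_subspace_set_add(2)[OF V inv(1) invariant_subspace_Int[OF V inv(2) F(1)]]) (use that in auto)
    moreover have "C (Suc i) \<subseteq> E1" unfolding C_def by (rule set_add_least[OF V inv(2,3)]) auto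
    ultimately show ?thesis using m by blast
  qed
  have ne: "E0 \<noteq> E1" by (rule irreducible_quot_maximal(1)[OF V inv(2,1,3) irr])
  have c: "x \<in> carrier V" if "x \<in> E1" for x using inv that by (auto simp: invariant_subspace_iff[OF V])
  have E0': "E0 \<subseteq> carrier V" "\<zero> \<in> E1" "E1 \<subseteq> carrier V" "\<zero> \<in> E0" using inv by (auto simp: invariant_subspace_iff[OF V])
  have C0: "C 0 = E0"
  proof -
    have "E1 \<inter> Fs ! 0 \<subseteq> E0" using F(4) E0' by auto
    then have "C 0 \<subseteq> E0" unfolding C_def by (intro set_add_least[OF V inv(1)]) auto
    moreover have "E0 \<subseteq> C 0" unfolding C_def
      by (rule invariant_subspace_set_add(2)[OF V inv(1) invariant_subspace_Int[OF V inv(2) F(1)]]) (use F(6) in auto)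
    ultimately show ?thesis by blast
  qed
  have Cm: "C (length Fs - 1) = E1"
  proof -
    have e: "E1 \<inter> Fs ! (length Fs - 1) = E1" using F(5) E0' by auto
    have "E1 \<subseteq> C (length Fs - 1)" unfolding C_def e
      by (rule invariant_subspace_set_add(3)[OF V inv(1,2)])
    moreover have "C (length Fs - 1) \<subseteq> E1" unfolding C_def e by (rule set_add_least[OF V inv(2,3)]) auto
    ultimately show ?thesis by blast
  qed
  \<comment> \<open>A jump can only start at \<open>E0\<close>, so a chain that has arrived at
    \<open>E1\<close> is constant afterwards.\<close>
  have stay: "C j = E1" if "C i = E1" "i \<le> j" "j < length Fs" for i j
    using that(2,3)
  proof (induction j rule: dec_induct)
    case base
    show ?case by (rule that(1))
  next
    case (step j)
    then have j: "C j = E1" "Suc j < length Fs" by simp_all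
    show ?case
    proof (rule ccontr)
      assume "C (Suc j) \<noteq> E1"
      then have "C j \<noteq> C (Suc j)" unfolding j by metis
      then have "C j = E0" using jump[OF j(2)] by blast
      then show False using ne unfolding j by metis
    qed
  qed
  show ?thesis
  proof (rule ex_ex1I)
    show "\<exists>i. Suc i < length Fs \<and> linked V E0 E1 (Fs ! i) (Fs ! Suc i)"
    proof (rule ccontr)
      assume no: "\<nexists>i. Suc i < length Fs \<and> linked V E0 E1 (Fs ! i) (Fs ! Suc i)"
      have "C i = E0" if "i < length Fs" for i using that
      proof (induction i)
        case (Suc i)
        then show ?case using no lk[of i] by auto
      qed (simp add: C0)
      then show False using Cm ne F(6) by auto
    qed
  next
    fix i j
    assume ij: "Suc i < length Fs \<and> linked V E0 E1 (Fs ! i) (Fs ! Suc i)"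
      "Suc j < length Fs \<and> linked V E0 E1 (Fs ! j) (Fs ! Suc j)"
    have *: "\<not> i < j" if "Suc i < length Fs" "C i \<noteq> C (Suc i)" "Suc j < length Fs" "C j \<noteq> C (Suc j)" for i j
    proof
      assume "i < j"
      then have "C j = E1" using stay[of "Suc i" j] jump[of i] that by auto
      then show False using jump[of j] that ne by auto
    qed
    from *[of i j] *[of j i] ij lk[of i] lk[of j] show "i = j" by auto
  qed
qed

text \<open>Every step of either series is linked to exactly one step of the other, by
  \<open>linked_unique\<close> and symmetry. So linkage is the graph of the required bijection, and
  linked factors are isomorphic.\<close>

theorem Jordan_Hoelder:
  assumes V: "representation G V" and E: "composition_series G V Es" and F: "composition_series G V Fs"
  obtains h where "bij_betw h {i. Suc i < length Es} {i. Suc i < length Fs}"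
    and "\<And>i. Suc i < length Es \<Longrightarrow> rep_iso G (series_factor V Es i) (series_factor V Fs (h i))"
proof -
  define L where "L i j \<longleftrightarrow> linked V (Es ! i) (Es ! Suc i) (Fs ! j) (Fs ! Suc j)" for i j
  note ED = composition_seriesD[OF V E] and FD = composition_seriesD[OF V F]
  have inE: "Es ! i \<subseteq> carrier V" if "i < length Es" for i
    using ED(1)[OF that] by (simp add: invariant_subspace_iff[OF V])
  have inF: "Fs ! i \<subseteq> carrier V" if "i < length Fs" for i
    using FD(1)[OF that] by (simp add: invariant_subspace_iff[OF V])
  have ex: "\<exists>!j. Suc j < length Fs \<and> L i j" if "Suc i < length Es" for i
    unfolding L_def
    by (rule linked_unique[OF V _ _ _ _ F]) (rule ED; use that in simp)+
  have ex': "\<exists>!i. Suc i < length Es \<and> L i j" if "Suc j < length Fs" for j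
  proof -
    have "\<exists>!i. Suc i < length Es \<and> linked V (Fs ! j) (Fs ! Suc j) (Es ! i) (Es ! Suc i)"
      by (rule linked_unique[OF V _ _ _ _ E]) (rule FD; use that in simp)+
    moreover have "linked V (Fs ! j) (Fs ! Suc j) (Es ! i) (Es ! Suc i) \<longleftrightarrow> L i j" if "Suc i < length Es" for i
      unfolding L_def by (rule linked_sym[OF V inF inE]) (use that \<open>Suc j < length Fs\<close> in auto)
    ultimately show ?thesis by (auto simp: conj_commute cong: conj_cong)
  qed
  define h where "h i = (THE j. Suc j < length Fs \<and> L i j)" for i
  have h: "Suc (h i) < length Fs \<and> L i (h i)" if "Suc i < length Es" for i
    unfolding h_def by (rule theI') (rule ex[OF that])
  show ?thesis
  proof (rule that)
    show "bij_betw h {i. Suc i < length Es} {i. Suc i < length Fs}"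
    proof (rule bij_betwI')
      fix x y assume "x \<in> {i. Suc i < length Es}" "y \<in> {i. Suc i < length Es}"
      then show "h x = h y \<longleftrightarrow> x = y" using h[of x] h[of y] ex'[of "h x"] by auto
    next
      fix x assume "x \<in> {i. Suc i < length Es}"
      then show "h x \<in> {i. Suc i < length Fs}" using h by auto
    next
      fix j assume "j \<in> {i. Suc i < length Fs}"
      then obtain i where "Suc i < length Es" "L i j" "Suc j < length Fs" using ex'[of j] by auto
      then show "\<exists>i\<in>{i. Suc i < length Es}. j = h i" using h[of i] ex[of i] by auto
    qed
    fix i assume i: "Suc i < length Es"
    show "rep_iso G (series_factor V Es i) (series_factor V Fs (h i))"
      unfolding series_factor_def
      by (rule linked_rep_iso[OF V]) ((rule ED FD; use h[OF i] i in simp)+, use h[OF i] in \<open>simp add: L_def\<close>)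
  qed
qed

lemma multiplicity_eq:
  assumes V: "representation G V" and E: "composition_series G V Es" and F: "composition_series G V Fs"
  shows "multiplicity_in_series G V Es L = multiplicity_in_series G V Fs L"
proof -
  obtain h where h: "bij_betw h {i. Suc i < length Es} {i. Suc i < length Fs}"
    "\<And>i. Suc i < length Es \<Longrightarrow> rep_iso G (series_factor V Es i) (series_factor V Fs (h i))"
    using Jordan_Hoelder[OF V E F] by blast
  have rep: "representation G (series_factor V Es i)" if "Suc i < length Es" for i
    using E that by (auto simp: composition_series_def irreducible_rep_def)
  have "rep_iso G (series_factor V Es i) L \<longleftrightarrow> rep_iso G (series_factor V Fs (h i)) L" if "Suc i < length Es" for i
    using h(2)[OF that] rep_iso_sym[OF rep[OF that]] rep_iso_trans by blast
  then have "h ` {i. Suc i < length Es \<and> rep_iso G (series_factor V Es i) L} =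
      h ` {i. Suc i < length Es} \<inter> {i. rep_iso G (series_factor V Fs i) L}"
    by auto
  also have "\<dots> = {i. Suc i < length Fs \<and> rep_iso G (series_factor V Fs i) L}"
    using bij_betw_imp_surj_on[OF h(1)] by auto
  finally have im: "h ` {i. Suc i < length Es \<and> rep_iso G (series_factor V Es i) L} =
      {i. Suc i < length Fs \<and> rep_iso G (series_factor V Fs i) L}" .
  have "inj_on h {i. Suc i < length Es \<and> rep_iso G (series_factor V Es i) L}"
    using h(1) by (auto simp: bij_betw_def inj_on_def)
  from card_image[OF this] show ?thesis
    unfolding im multiplicity_in_series_def ..
qed

section \<open>The Koszul complex\<close>

text \<open>A function \<open>f\<close> on the subsets of \<open>{1..n}\<close> stands for the element \<open>\<Sum>A. f A \<cdot> e\<^sub>A\<close> of the exterior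
  algebra, where \<open>e\<^sub>A\<close> is the increasing wedge product of the basis vectors with index in \<open>A\<close>.
  The operator \<open>bd\<close> is contraction with the functional \<open>e\<^sub>i \<mapsto> 1\<close>, and \<open>wd\<close> is wedging with
  \<open>e\<^sub>1 + \<dots> + e\<^sub>n\<close>.\<close>

definition eps :: "nat \<Rightarrow> nat set \<Rightarrow> complex" where
  "eps b A = (-1) ^ card {a \<in> A. a < b}"

definition bd :: "nat \<Rightarrow> (nat set \<Rightarrow> complex) \<Rightarrow> nat set \<Rightarrow> complex" where
  "bd n f A = (\<Sum>b\<in>{1..n} - A. eps b A * f (insert b A))"

definition wd :: "(nat set \<Rightarrow> complex) \<Rightarrow> nat set \<Rightarrow> complex" where
  "wd f A = (\<Sum>a\<in>A. eps a A * f (A - {a}))"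

lemma eps_square [simp]: "eps b A * eps b A = 1"
  by (simp add: eps_def flip: power_add mult_2)

lemma eps_nonzero [simp]: "eps b A \<noteq> 0"
  by (simp add: eps_def)

lemma eps_insert:
  assumes "finite A" "a \<notin> A"
  shows "eps b (insert a A) = (if a < b then - eps b A else eps b A)"
proof (cases "a < b")
  case True
  have "{x \<in> insert a A. x < b} = insert a {x \<in> A. x < b}" using True by auto
  then show ?thesis using assms True by (simp add: eps_def)
next
  case False
  then have "{x \<in> insert a A. x < b} = {x \<in> A. x < b}" by auto
  then show ?thesis using False by (simp add: eps_def)
qed

lemma eps_self [simp]: "eps b (insert b A) = eps b A" "eps b (A - {b}) = eps b A"
proof -
  have "{x \<in> insert b A. x < b} = {x \<in> A. x < b}" "{x \<in> A - {b}. x < b} = {x \<in> A. x < b}" by auto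
  then show "eps b (insert b A) = eps b A" "eps b (A - {b}) = eps b A" unfolding eps_def by metis+
qed

text \<open>\<open>eps b A\<close> is the sign of sorting \<open>e_b\<close> into \<open>e_A\<close>
  from the left, so this is the anticommutation of \<open>e_a\<close> and
  \<open>e_b\<close>.\<close>

lemma eps_swap_insert:
  assumes "finite A" "a \<notin> A" "b \<notin> A" "a \<noteq> b"
  shows "eps a A * eps b (insert a A) = - (eps b A * eps a (insert b A))"
  using assms by (auto simp: eps_insert)

lemma bd_add: "bd n (\<lambda>A. f A + g A) A = bd n f A + bd n g A"
  by (simp add: bd_def distrib_left sum.distrib)

lemma bd_smult: "bd n (\<lambda>A. c * f A) A = c * bd n f A"
  by (simp add: bd_def sum_distrib_left mult_ac)

lemma wd_add: "wd (\<lambda>A. f A + g A) A = wd f A + wd g A"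
  by (simp add: wd_def distrib_left sum.distrib)

lemma wd_smult: "wd (\<lambda>A. c * f A) A = c * wd f A"
  by (simp add: wd_def sum_distrib_left mult_ac)

text \<open>Functions here are defined on all sets of numbers, but a value of \<open>bd\<close>
  reads only subsets of \<open>{1..n}\<close> of one size. Identities known in a single degree can
  therefore be used under \<open>bd\<close>; \<open>wd_cong\<close> is the analogue for
  \<open>wd\<close>.\<close>

lemma bd_cong:
  assumes "A \<subseteq> {1..n}" "\<And>B. B \<subseteq> {1..n} \<Longrightarrow> card B = Suc (card A) \<Longrightarrow> f B = g B"
  shows "bd n f A = bd n g A"
  unfolding bd_def
proof (rule sum.cong)
  fix b assume b: "b \<in> {1..n} - A"
  have "finite A" using assms(1) finite_subset by blast
  then show "eps b A * f (insert b A) = eps b A * g (insert b A)"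
    using assms b by simp
qed simp

lemma wd_cong:
  assumes "A \<subseteq> {1..n}" "\<And>B. B \<subseteq> {1..n} \<Longrightarrow> Suc (card B) = card A \<Longrightarrow> f B = g B"
  shows "wd f A = wd g A"
  unfolding wd_def
proof (rule sum.cong)
  fix a assume a: "a \<in> A"
  have "finite A" using assms(1) finite_subset by blast
  then have "Suc (card (A - {a})) = card A" using a by (rule card_Suc_Diff1)
  then show "eps a A * f (A - {a}) = eps a A * g (A - {a})"
    using assms(1) by (subst assms(2)) auto
qed simp

text \<open>Exchanging the order of summation turns the double sum into its negative. It yields both
  \<open>wd_wd\<close> and \<open>bd_bd\<close>.\<close>

lemma sum_antisym:
  fixes h :: "'a \<Rightarrow> 'a \<Rightarrow> complex"
  assumes "finite X" and anti: "\<And>a b. a \<in> X \<Longrightarrow> b \<in> X \<Longrightarrow> a \<noteq> b \<Longrightarrow> h a b = - h b a"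
  shows "(\<Sum>a\<in>X. \<Sum>b\<in>X - {a}. h a b) = 0"
proof -
  define k where "k a b = (if a = b then 0 else h a b)" for a b
  have k: "(\<Sum>b\<in>X - {a}. h a b) = (\<Sum>b\<in>X. k a b)" if "a \<in> X" for a
    using assms(1) that by (intro sum.mono_neutral_cong_left) (auto simp: k_def)
  have "(\<Sum>a\<in>X. \<Sum>b\<in>X. k a b) = (\<Sum>b\<in>X. \<Sum>a\<in>X. k a b)" by (rule sum.swap)
  also have "\<dots> = (\<Sum>b\<in>X. \<Sum>a\<in>X. - k b a)"
  proof (intro sum.cong HOL.refl)
    fix a b assume "a \<in> X" "b \<in> X"
    then show "k b a = - k a b" using anti[of b a] by (auto simp: k_def)
  qed
  also have "\<dots> = - (\<Sum>a\<in>X. \<Sum>b\<in>X. k a b)" by (simp add: sum_negf)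
  finally have "(\<Sum>a\<in>X. \<Sum>b\<in>X. k a b) = 0" by simp
  then show ?thesis using k by simp
qed

lemma wd_wd:
  assumes "finite A"
  shows "wd (wd f) A = 0"
proof -
  have "wd (wd f) A = (\<Sum>a\<in>A. \<Sum>b\<in>A - {a}. eps a A * eps b (A - {a}) * f (A - {a} - {b}))"
    by (simp add: wd_def sum_distrib_left mult.assoc)
  also have "\<dots> = 0"
  proof (rule sum_antisym[OF assms])
    fix a b assume ab: "a \<in> A" "b \<in> A" "a \<noteq> b"
    define C where "C = A - {a} - {b}"
    have "A - {a} = insert b C" "A - {b} = insert a C" "A = insert a (insert b C)" "A - {b} - {a} = C"
      "a \<notin> C" "b \<notin> C" "finite C"
      using ab assms by (auto simp: C_def)
    then show "eps a A * eps b (A - {a}) * f (A - {a} - {b}) = - (eps b A * eps a (A - {b}) * f (A - {b} - {a}))"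
      using ab by (simp add: C_def[symmetric] eps_insert) 
  qed
  finally show ?thesis .
qed

lemma bd_bd:
  assumes "A \<subseteq> {1..n}"
  shows "bd n (bd n f) A = 0"
proof -
  have fin: "finite A" using assms finite_subset by blast
  have d: "{1..n} - insert a A = {1..n} - A - {a}" for a by auto
  have "bd n (bd n f) A = (\<Sum>a\<in>{1..n} - A. \<Sum>b\<in>{1..n} - A - {a}. eps a A * eps b (insert a A) * f (insert b (insert a A)))"
    unfolding bd_def d by (simp add: sum_distrib_left mult.assoc)
  also have "\<dots> = 0"
  proof (rule sum_antisym)
    fix a b assume ab: "a \<in> {1..n} - A" "b \<in> {1..n} - A" "a \<noteq> b"
    have "insert b (insert a A) = insert a (insert b A)" by blast
    then show "eps a A * eps b (insert a A) * f (insert b (insert a A)) =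
        - (eps b A * eps a (insert b A) * f (insert a (insert b A)))"
      using eps_swap_insert[OF fin, of a b] ab by simp
  qed simp
  finally show ?thesis .
qed

text \<open>In \<open>bd n (wd f)\<close> each \<open>b\<close> outside \<open>A\<close> can be
  added and removed again, in \<open>wd (bd n f)\<close> each \<open>a\<close> in \<open>A\<close>
  can be removed and restored; together this gives \<open>n\<close> copies of \<open>f A\<close>.
  The remaining terms replace some \<open>a\<close> by some \<open>b\<close> and cancel by
  anticommutation.\<close>

theorem koszul_homotopy:
  assumes A: "A \<subseteq> {1..n}"
  shows "bd n (wd f) A + wd (bd n f) A = of_nat n * f A"
proof -
  define B where "B = {1..n} - A"
  have fin: "finite A" "finite B" using A finite_subset by (auto simp: B_def)
  have AB: "a \<noteq> b" if "a \<in> A" "b \<in> B" for a b using that by (auto simp: B_def)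
  have "bd n (wd f) A = (\<Sum>b\<in>B. f A + (\<Sum>a\<in>A. eps b A * eps a (insert b A) * f (insert b (A - {a}))))"
    unfolding bd_def B_def[symmetric]
  proof (rule sum.cong[OF HOL.refl])
    fix b assume b: "b \<in> B"
    then have "b \<notin> A" by (simp add: B_def)
    then have "wd f (insert b A) = eps b A * f A + (\<Sum>a\<in>A. eps a (insert b A) * f (insert b A - {a}))"
      using fin by (simp add: wd_def)
    also have "(\<Sum>a\<in>A. eps a (insert b A) * f (insert b A - {a})) = (\<Sum>a\<in>A. eps a (insert b A) * f (insert b (A - {a})))"
    proof (rule sum.cong[OF HOL.refl])
      fix a assume "a \<in> A"
      then have "a \<noteq> b" using AB b by blast
      then show "eps a (insert b A) * f (insert b A - {a}) = eps a (insert b A) * f (insert b (A - {a}))"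
        by (auto simp: insert_Diff_if)
    qed
    finally show "eps b A * wd f (insert b A) = f A + (\<Sum>a\<in>A. eps b A * eps a (insert b A) * f (insert b (A - {a})))"
      by (simp add: distrib_left sum_distrib_left mult.assoc flip: mult.assoc[of _ _ "f A"])
  qed
  also have "\<dots> = of_nat (card B) * f A + (\<Sum>b\<in>B. \<Sum>a\<in>A. eps b A * eps a (insert b A) * f (insert b (A - {a})))"
    by (simp add: sum.distrib)
  finally have 1: "bd n (wd f) A = \<dots>" .
  have "wd (bd n f) A = (\<Sum>a\<in>A. f A + (\<Sum>b\<in>B. eps a A * eps b (A - {a}) * f (insert b (A - {a}))))"
    unfolding wd_def
  proof (rule sum.cong[OF HOL.refl])
    fix a assume a: "a \<in> A"
    then have "{1..n} - (A - {a}) = insert a B" using A by (auto simp: B_def)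
    moreover have "a \<notin> B" "insert a (A - {a}) = A" using a by (auto simp: B_def)
    ultimately have "bd n f (A - {a}) = eps a A * f A + (\<Sum>b\<in>B. eps b (A - {a}) * f (insert b (A - {a})))"
      using fin by (simp add: bd_def)
    then show "eps a A * bd n f (A - {a}) = f A + (\<Sum>b\<in>B. eps a A * eps b (A - {a}) * f (insert b (A - {a})))"
      by (simp add: distrib_left sum_distrib_left mult.assoc flip: mult.assoc[of _ _ "f A"])
  qed
  also have "\<dots> = of_nat (card A) * f A + (\<Sum>a\<in>A. \<Sum>b\<in>B. eps a A * eps b (A - {a}) * f (insert b (A - {a})))"
    by (simp add: sum.distrib)
  also have "(\<Sum>a\<in>A. \<Sum>b\<in>B. eps a A * eps b (A - {a}) * f (insert b (A - {a}))) =
     (\<Sum>b\<in>B. \<Sum>a\<in>A. - (eps b A * eps a (insert b A) * f (insert b (A - {a}))))"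
    unfolding sum.swap[of _ B A]
  proof (intro sum.cong HOL.refl)
    fix a b assume ab: "a \<in> A" "b \<in> B"
    define C where "C = A - {a}"
    have C: "finite C" "a \<notin> C" "b \<notin> C" "A = insert a C" "a \<noteq> b"
      using ab fin AB by (auto simp: C_def B_def)
    have "eps a A * eps b (A - {a}) = - (eps b A * eps a (insert b A))"
      unfolding C_def[symmetric] unfolding C(4)
      using C(1-3,5) by (auto simp: eps_insert insert_commute)
    then show "eps a A * eps b (A - {a}) * f (insert b (A - {a})) = - (eps b A * eps a (insert b A) * f (insert b (A - {a})))"
      by simp
  qed
  finally have 2: "wd (bd n f) A = of_nat (card A) * f A -
     (\<Sum>b\<in>B. \<Sum>a\<in>A. eps b A * eps a (insert b A) * f (insert b (A - {a})))"
    by (simp add: sum_negf)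
  have "card B + card A = n"
  proof -
    have "B \<inter> A = {}" "B \<union> A = {1..n}" using A by (auto simp: B_def)
    then show ?thesis using card_Un_disjoint[OF fin(2,1)] by simp
  qed
  then have "(of_nat n :: complex) = of_nat (card B) + of_nat (card A)" by (metis of_nat_add)
  with 1 2 show ?thesis by (simp add: distrib_right)
qed

text \<open>The homotopy applied to \<open>bd n f\<close>, where one summand vanishes. It says that
  \<open>wd\<close> divided by \<open>n\<close> is a section of \<open>bd\<close> over its
  image.\<close>

lemma bd_wd_bd:
  assumes A: "A \<subseteq> {1..n}"
  shows "bd n (wd (bd n f)) A = of_nat n * bd n f A"
proof -
  have fin: "finite A" using A finite_subset by blast
  have "wd (bd n (bd n f)) A = wd (\<lambda>_. 0) A" by (rule wd_cong[OF A]) (rule bd_bd)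
  then have "wd (bd n (bd n f)) A = 0" by (simp add: wd_def)
  then show ?thesis using koszul_homotopy[OF A, of "bd n f"] by simp
qed

lemma wd_bd_wd:
  assumes A: "A \<subseteq> {1..n}"
  shows "wd (bd n (wd f)) A = of_nat n * wd f A"
proof -
  have "bd n (wd (wd f)) A = bd n (\<lambda>_. 0) A" 
    by (rule bd_cong[OF A]) (meson finite_atLeastAtMost finite_subset wd_wd)
  then have "bd n (wd (wd f)) A = 0" by (simp add: bd_def)
  then show ?thesis using koszul_homotopy[OF A, of "wd f"] by simp
qed


section \<open>Adjacent transpositions on the exterior algebra\<close>

abbreviation adj :: "nat \<Rightarrow> nat \<Rightarrow> nat" where
  "adj i \<equiv> Transposition.transpose i (Suc i)"

text \<open>The transposition of \<open>i\<close> and \<open>i + 1\<close> keeps the factors of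
  \<open>e_A\<close> sorted, except when both indices occur.\<close>

definition csgn :: "nat \<Rightarrow> nat set \<Rightarrow> complex" where
  "csgn i A = (if i \<in> A \<and> Suc i \<in> A then - 1 else 1)"

text \<open>The transposition acting on coefficient functions. The action is by pullback along the
  inverse, and \<open>adj i\<close> is its own inverse.\<close>

definition tau :: "nat \<Rightarrow> (nat set \<Rightarrow> complex) \<Rightarrow> nat set \<Rightarrow> complex" where
  "tau i f A = csgn i A * f (adj i ` A)"

lemma csgn_square [simp]: "csgn i A * csgn i A = 1"
  by (simp add: csgn_def)

lemma adj_fix: "i \<notin> C \<Longrightarrow> Suc i \<notin> C \<Longrightarrow> adj i ` C = C"
  by (force simp: Transposition.transpose_def image_iff)

text \<open>Both sides are the sign obtained by applying the transposition to the product of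
  \<open>e_b\<close> and \<open>e_A\<close>, once after and once before sorting \<open>e_b\<close>
  into place. Only \<open>b = i\<close> and \<open>b = Suc i\<close> need a closer look, and there
  the rest \<open>C\<close> contains neither index.\<close>

lemma eps_csgn:
  assumes fin: "finite A" and b: "b \<notin> A"
  shows "eps b A * csgn i (insert b A) = csgn i A * eps (adj i b) (adj i ` A)"
proof (cases "b = i \<or> b = Suc i")
  case False
  then have ab: "adj i b = b" by (auto simp: Transposition.transpose_def)
  have "{x \<in> adj i ` A. x < b} = adj i ` {x \<in> A. x < b}"
    using False by (auto simp: Transposition.transpose_def image_iff split: if_splits)
  then have "card {x \<in> adj i ` A. x < b} = card {x \<in> A. x < b}"
    by (simp add: card_image inj_on_subset[OF inj_transpose])
  then have "eps (adj i b) (adj i ` A) = eps b A" unfolding ab eps_def by simp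
  moreover have "csgn i (insert b A) = csgn i A" using False by (auto simp: csgn_def)
  ultimately show ?thesis by simp
next
  case True
  define C where "C = A - {i, Suc i}"
  have C: "finite C" "i \<notin> C" "Suc i \<notin> C" using fin by (auto simp: C_def)
  have lt: "eps (Suc i) C = eps i C"
  proof -
    have "{a \<in> C. a < Suc i} = {a \<in> C. a < i}" using C by (auto simp: less_Suc_eq)
    then show ?thesis by (simp add: eps_def)
  qed
  from True show ?thesis
  proof
    assume bi: "b = i"
    then have "A = C \<or> A = insert (Suc i) C" using b by (auto simp: C_def)
    then show ?thesis
      using C lt bi by (auto simp: csgn_def adj_fix eps_insert)
  next
    assume bi: "b = Suc i"
    then have "A = C \<or> A = insert i C" using b by (auto simp: C_def)
    then show ?thesis
      using C lt bi by (auto simp: csgn_def adj_fix eps_insert)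
  qed
qed

lemma adj_image_interval: "1 \<le> i \<Longrightarrow> i < n \<Longrightarrow> adj i ` {1..n} = {1..n}"
  by (rule permutes_image) (auto intro: permutes_swap_id)

lemma adj_image_subset: "1 \<le> i \<Longrightarrow> i < n \<Longrightarrow> A \<subseteq> {1..n} \<Longrightarrow> adj i ` A \<subseteq> {1..n}"
  using adj_image_interval by blast

lemma card_adj_image [simp]: "card (adj i ` A) = card A"
  by (simp add: card_image inj_on_subset[OF inj_transpose])

lemma bd_tau:
  assumes i: "1 \<le> i" "i < n" and A: "A \<subseteq> {1..n}"
  shows "bd n (tau i f) A = tau i (bd n f) A"
proof -
  have fin: "finite A" using A finite_subset by blast
  have "{1..n} - adj i ` A = adj i ` ({1..n} - A)"
    using image_set_diff[OF inj_transpose, of i "Suc i" "{1..n}" A] adj_image_interval[OF i] by simp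
  then have "tau i (bd n f) A = csgn i A * (\<Sum>b\<in>adj i ` ({1..n} - A). eps b (adj i ` A) * f (insert b (adj i ` A)))"
    by (simp add: tau_def bd_def)
  also have "\<dots> = csgn i A * (\<Sum>b\<in>{1..n} - A. eps (adj i b) (adj i ` A) * f (insert (adj i b) (adj i ` A)))"
    by (subst sum.reindex) (auto intro: inj_on_subset[OF inj_transpose])
  also have "\<dots> = (\<Sum>b\<in>{1..n} - A. eps b A * csgn i (insert b A) * f (adj i ` insert b A))"
    unfolding sum_distrib_left using fin by (intro sum.cong HOL.refl) (simp add: eps_csgn)
  also have "\<dots> = bd n (tau i f) A"
    by (simp add: bd_def tau_def mult.assoc)
  finally show ?thesis ..
qed

lemma wd_tau:
  assumes fin: "finite A"
  shows "wd (tau i f) A = tau i (wd f) A"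
proof -
  have d: "adj i ` A - {adj i a} = adj i ` (A - {a})" for a
    using image_set_diff[OF inj_transpose, of i "Suc i" A "{a}"] by simp
  have "tau i (wd f) A = csgn i A * (\<Sum>a\<in>A. eps (adj i a) (adj i ` A) * f (adj i ` A - {adj i a}))"
    unfolding tau_def wd_def
    by (subst sum.reindex) (auto intro: inj_on_subset[OF inj_transpose])
  also have "\<dots> = (\<Sum>a\<in>A. eps a A * (csgn i (A - {a}) * f (adj i ` (A - {a}))))"
    unfolding sum_distrib_left
  proof (intro sum.cong HOL.refl)
    fix a assume a: "a \<in> A"
    then have A: "insert a (A - {a}) = A" by blast
    have "adj i ` A = insert (adj i a) (adj i ` (A - {a}))" using a by blast
    then have e: "eps (adj i a) (adj i ` A) = eps (adj i a) (adj i ` (A - {a}))" by simp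
    have "eps a A * csgn i A = csgn i (A - {a}) * eps (adj i a) (adj i ` A)"
      using eps_csgn[of "A - {a}" a i] fin unfolding A e by simp
    \<comment> \<open>Multiplying by two signs, each of square one, moves \<open>csgn\<close> from
      \<open>A\<close> to \<open>A - {a}\<close>.\<close>
    then have "csgn i A * (eps a A * csgn i A) * csgn i (A - {a}) =
        csgn i A * (csgn i (A - {a}) * eps (adj i a) (adj i ` A)) * csgn i (A - {a})" by simp
    then have "(csgn i A * csgn i A) * (eps a A * csgn i (A - {a})) =
        (csgn i (A - {a}) * csgn i (A - {a})) * (csgn i A * eps (adj i a) (adj i ` A))" by (simp only: mult_ac)
    then have "eps a A * csgn i (A - {a}) = csgn i A * eps (adj i a) (adj i ` A)" by simp
    then show "csgn i A * (eps (adj i a) (adj i ` A) * f (adj i ` A - {adj i a})) =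
        eps a A * (csgn i (A - {a}) * f (adj i ` (A - {a})))"
      unfolding d by (simp flip: mult.assoc)
  qed
  finally show ?thesis by (simp add: wd_def tau_def)
qed

text \<open>The sign of the permutation which sorts a list.\<close>

fun sortsign :: "nat list \<Rightarrow> complex" where
  "sortsign [] = 1"
| "sortsign (x # xs) = eps x (set xs) * sortsign xs"

lemma sortsign_square [simp]: "sortsign xs * sortsign xs = 1"
proof (induction xs)
  case (Cons x xs)
  have "sortsign (x # xs) * sortsign (x # xs) = (eps x (set xs) * eps x (set xs)) * (sortsign xs * sortsign xs)"
    by (simp only: sortsign.simps mult_ac)
  then show ?case using Cons by simp
qed simp

lemma sortsign_nonzero [simp]: "sortsign xs \<noteq> 0"
  using sortsign_square[of xs] by (metis mult_zero_left zero_neq_one)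

text \<open>Renaming by \<open>adj i\<close> reverses the relative order of no pair other than
  \<open>i\<close> and \<open>i + 1\<close>; formally, \<open>eps_csgn\<close> is applied at every
  entry of the list.\<close>

lemma sortsign_adj: "distinct xs \<Longrightarrow> sortsign (map (adj i) xs) = csgn i (set xs) * sortsign xs"
proof (induction xs)
  case (Cons x xs)
  have "sortsign (map (adj i) (x # xs)) = (csgn i (set xs) * eps (adj i x) (adj i ` set xs)) * sortsign xs"
    using Cons by (simp add: mult_ac)
  also have "\<dots> = (eps x (set xs) * csgn i (insert x (set xs))) * sortsign xs"
    using Cons.prems by (subst eps_csgn) auto
  finally show ?case by (simp add: mult_ac)
qed (simp add: csgn_def)

lemma sortsign_sorted: "sorted xs \<Longrightarrow> distinct xs \<Longrightarrow> sortsign xs = 1"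
proof (induction xs)
  case (Cons x xs)
  have "{a \<in> set xs. a < x} = {}" using Cons.prems by auto
  then have "eps x (set xs) = (- 1) ^ card ({} :: nat set)" unfolding eps_def by (simp only:)
  then show ?case using Cons by simp
qed simp

section \<open>Generation by adjacent transpositions\<close>

text \<open>A transposition \<open>(a b+1)\<close> is the conjugate of \<open>(a b)\<close> by
  \<open>(b b+1)\<close>, so adjacent ones generate. The principle is needed because
  \<open>tau\<close>, \<open>csgn\<close> and all equivariance statements exist only for adjacent
  transpositions.\<close>

lemma permutes_adj_induct [consumes 1, case_names id adj]:
  assumes \<sigma>: "\<sigma> permutes {1..n}" and P: "P id"
    and step: "\<And>i \<sigma>. 1 \<le> i \<Longrightarrow> i < n \<Longrightarrow> \<sigma> permutes {1..n} \<Longrightarrow> P \<sigma> \<Longrightarrow> P (adj i \<circ> \<sigma>)"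
  shows "P \<sigma>"
proof -
  have adj: "adj i permutes {1..n}" if "1 \<le> i" "i < n" for i
    using that by (intro permutes_swap_id) auto
  have tr: "P (Transposition.transpose a (a + Suc d) \<circ> \<sigma>)"
    if "1 \<le> a" "a + Suc d \<le> n" "\<sigma> permutes {1..n}" "P \<sigma>" for a d \<sigma>
    using that
  proof (induction d arbitrary: \<sigma>)
    case 0
    show ?case unfolding add_Suc_right add_0_right by (rule step) (use 0 in auto)
  next
    case (Suc d)
    define b where "b = a + Suc d"
    have b: "1 \<le> b" "b < n" "a < b" using Suc.prems by (auto simp: b_def)
    have t: "Transposition.transpose a b permutes {1..n}" using b Suc.prems by (intro permutes_swap_id) auto
    have 1: "P (adj b \<circ> \<sigma>)" "adj b \<circ> \<sigma> permutes {1..n}"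
      using step[OF b(1,2)] Suc.prems adj[OF b(1,2)] by (auto intro: permutes_compose)
    have "P (Transposition.transpose a b \<circ> (adj b \<circ> \<sigma>))"
      unfolding b_def by (rule Suc.IH[OF Suc.prems(1) _ 1(2,1)[unfolded b_def]]) (use Suc.prems(2) in simp)
    then have "P (adj b \<circ> (Transposition.transpose a b \<circ> (adj b \<circ> \<sigma>)))"
      using step[OF b(1,2)] permutes_compose[OF 1(2) t] by blast
    also have "adj b \<circ> (Transposition.transpose a b \<circ> (adj b \<circ> \<sigma>)) = Transposition.transpose a (Suc b) \<circ> \<sigma>"
      using b by (auto simp: fun_eq_iff Transposition.transpose_def)
    finally show ?case by (simp only: b_def add_Suc_right)
  qed
  from \<sigma> finite_atLeastAtMost P show ?thesis
  proof (induction rule: permutes_induct)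
    case (swap a b p)
    show ?case
    proof (cases "a < b")
      case True
      then have e: "a + Suc (b - a - 1) = b" by simp
      show ?thesis by (rule tr[of a "b - a - 1" p, unfolded e]) (use swap in auto)
    next
      case False
      then have e: "b + Suc (a - b - 1) = a" using swap by simp
      have "P (Transposition.transpose b a \<circ> p)"
        by (rule tr[of b "a - b - 1" p, unfolded e]) (use swap in auto)
      then show ?thesis by (simp only: transpose_commute[of a b])
    qed
  qed
qed

section \<open>Reduction of statements about the mixed doubles group to its generators\<close>

context
  fixes n :: nat
begin

interpretation MD: group "MD n" by (rule group_MD)

lemma MD_gen_closed: "1 \<le> i \<Longrightarrow> i < n \<Longrightarrow> MD_r n i \<in> carrier (MD n)" "1 \<le> i \<Longrightarrow> i < n \<Longrightarrow> MD_s n i \<in> carrier (MD n)"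
  by (auto simp: MD_def MD_r_def MD_s_def carrier_presented_group)

text \<open>The generators are involutions, so inverse letters can be replaced by letters and each
  element is reached by left multiplications with generators.\<close>

lemma MD_induct [consumes 1, case_names one r s]:
  assumes g: "g \<in> carrier (MD n)" and one: "P \<one>\<^bsub>MD n\<^esub>"
    and r: "\<And>i g. 1 \<le> i \<Longrightarrow> i < n \<Longrightarrow> g \<in> carrier (MD n) \<Longrightarrow> P g \<Longrightarrow> P (MD_r n i \<otimes>\<^bsub>MD n\<^esub> g)"
    and s: "\<And>i g. 1 \<le> i \<Longrightarrow> i < n \<Longrightarrow> g \<in> carrier (MD n) \<Longrightarrow> P g \<Longrightarrow> P (MD_s n i \<otimes>\<^bsub>MD n\<^esub> g)"
  shows "P g"
proof -
  define X where "X = MD_gens n"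
  define Rels where "Rels = MD_rels n"
  \<comment> \<open>The word consisting of the inverse letter of \<open>x\<close> followed by
    \<open>x\<close> twice reduces to the inverse letter by the relation for the square, and to
    \<open>x\<close> by cancellation.\<close>
  have inverse_letter: "pres_class X Rels [(x, False)] = pres_class X Rels [(x, True)]" if x: "x \<in> X" for x
  proof -
    have "([(x, True), (x, True)], []) \<in> Rels"
      using x by (cases x) (auto simp: X_def Rels_def MD_rels_def)
    then have "([(x, False)] @ [(x, True), (x, True)] @ [], [(x, False)] @ [] @ []) \<in> pres_rel X Rels"
      using x by (intro pres_rel.rel) auto
    then have 1: "([(x, False), (x, True), (x, True)], [(x, False)]) \<in> pres_rel X Rels" by simp
    have 2: "([(x, False), (x, True), (x, True)], [(x, True)]) \<in> pres_rel X Rels"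
      using pres_rel.cancel[of "[]" X "[(x, True)]" x False Rels] x by simp
    show ?thesis
      using x pres_rel.trans[OF pres_rel.sym[OF 1] 2] by (subst pres_class_eq) auto
  qed
  have "P (pres_class X Rels w)" if "w \<in> gwords X" for w
    using that
  proof (induction w)
    case Nil
    then show ?case using one by (simp add: MD_def one_presented_group X_def Rels_def)
  next
    case (Cons a w)
    obtain x b where a: "a = (x, b)" by fastforce
    have x: "x \<in> X" "w \<in> gwords X" using Cons.prems a by auto
    have w: "pres_class X Rels w \<in> carrier (MD n)"
      using x by (auto simp: MD_def carrier_presented_group X_def Rels_def)
    have "pres_class X Rels (a # w) = pres_class X Rels [(x, b)] \<otimes>\<^bsub>MD n\<^esub> pres_class X Rels w"
      using x a mult_presented_group[of "[(x, b)]" X w Rels] by (simp add: MD_def X_def Rels_def)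
    also have "pres_class X Rels [(x, b)] = pres_class X Rels [(x, True)]"
      using inverse_letter[OF x(1)] by (cases b) auto
    finally have e: "pres_class X Rels (a # w) = pres_class X Rels [(x, True)] \<otimes>\<^bsub>MD n\<^esub> pres_class X Rels w" .
    show ?case
    proof (cases x)
      case (Rgen i)
      then show ?thesis using r[of i, OF _ _ w Cons.IH] x e by (simp add: X_def Rels_def MD_r_def)
    next
      case (Sgen i)
      then show ?thesis using s[of i, OF _ _ w Cons.IH] x e by (simp add: X_def Rels_def MD_s_def)
    qed
  qed
  then show ?thesis using g by (auto simp: MD_def carrier_presented_group X_def Rels_def)
qed

text \<open>The classes of the \<open>r_i\<close> map to all adjacent transpositions. As a
  consequence, invariance under \<open>MD n\<close> gives invariance under all permutations in the
  hook modules.\<close>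

lemma MD_perm_surj:
  assumes "\<sigma> permutes {1..n}"
  shows "\<exists>g\<in>carrier (MD n). MD_perm n g = \<sigma>"
  using assms
proof (induction rule: permutes_adj_induct)
  case id
  have "MD_perm n \<one>\<^bsub>MD n\<^esub> = id"
    using hom_one[OF MD_perm_hom group_MD sym_group_is_group] by (simp add: sym_group_one)
  then show ?case using MD.one_closed by blast
next
  case (adj i \<sigma>)
  then obtain g where g: "g \<in> carrier (MD n)" "MD_perm n g = \<sigma>" by blast
  have "MD_perm n (MD_r n i \<otimes>\<^bsub>MD n\<^esub> g) = adj i \<circ> \<sigma>"
    using hom_mult[OF MD_perm_hom[of n] MD_gen_closed(1)[of i] g(1)] adj g
    by (simp add: MD_perm_r sym_group_mult)
  then show ?case using MD_gen_closed(1)[of i] adj g by (metis MD.m_closed)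
qed

lemma invariant_subspace_MD:
  assumes V: "representation (MD n) V" and W: "W \<subseteq> carrier V" "\<zero>\<^bsub>V\<^esub> \<in> W"
    "\<And>x y. x \<in> W \<Longrightarrow> y \<in> W \<Longrightarrow> x \<oplus>\<^bsub>V\<^esub> y \<in> W" "\<And>c x. x \<in> W \<Longrightarrow> c \<odot>\<^bsub>V\<^esub> x \<in> W"
    and gen: "\<And>i x. 1 \<le> i \<Longrightarrow> i < n \<Longrightarrow> x \<in> W \<Longrightarrow> act V (MD_r n i) x \<in> W"
      "\<And>i x. 1 \<le> i \<Longrightarrow> i < n \<Longrightarrow> x \<in> W \<Longrightarrow> act V (MD_s n i) x \<in> W"
  shows "invariant_subspace (MD n) V W"
proof -
  have "\<forall>x\<in>W. act V g x \<in> W" if "g \<in> carrier (MD n)" for g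
    using that
  proof (induction rule: MD_induct)
    case one
    then show ?case using W(1) by (auto simp: representation_act(4)[OF V MD.one_closed] subset_iff)
  next
    case (r i g)
    then show ?case using W(1) gen by (auto simp: representation_act(3)[OF V MD_gen_closed(1)] subset_iff)
  next
    case (s i g)
    then show ?case using W(1) gen by (auto simp: representation_act(3)[OF V MD_gen_closed(2)] subset_iff)
  qed
  then show ?thesis using W unfolding invariant_subspace_iff[OF V] by blast
qed

lemma intertwiner_MD:
  assumes V: "representation (MD n) V" and W: "representation (MD n) W"
    and f: "\<And>x. x \<in> carrier V \<Longrightarrow> f x \<in> carrier W"
      "\<And>x y. x \<in> carrier V \<Longrightarrow> y \<in> carrier V \<Longrightarrow> f (x \<oplus>\<^bsub>V\<^esub> y) = f x \<oplus>\<^bsub>W\<^esub> f y"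
      "\<And>c x. x \<in> carrier V \<Longrightarrow> f (c \<odot>\<^bsub>V\<^esub> x) = c \<odot>\<^bsub>W\<^esub> f x"
    and gen: "\<And>i x. 1 \<le> i \<Longrightarrow> i < n \<Longrightarrow> x \<in> carrier V \<Longrightarrow> f (act V (MD_r n i) x) = act W (MD_r n i) (f x)"
      "\<And>i x. 1 \<le> i \<Longrightarrow> i < n \<Longrightarrow> x \<in> carrier V \<Longrightarrow> f (act V (MD_s n i) x) = act W (MD_s n i) (f x)"
  shows "intertwiner (MD n) V W f"
proof -
  have "\<forall>x\<in>carrier V. f (act V g x) = act W g (f x)" if "g \<in> carrier (MD n)" for g
    using that
  proof (induction rule: MD_induct)
    case one
    then show ?case
      using f(1) by (simp add: representation_act(4)[OF V MD.one_closed] representation_act(4)[OF W MD.one_closed])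
  next
    case (r i g)
    then show ?case
      using f(1) gen(1)[OF r(1,2)] representation_closed(4)[OF V r(3)]
      by (simp add: representation_act(3)[OF V MD_gen_closed(1)] representation_act(3)[OF W MD_gen_closed(1)])
  next
    case (s i g)
    then show ?case
      using f(1) gen(2)[OF s(1,2)] representation_closed(4)[OF V s(3)]
      by (simp add: representation_act(3)[OF V MD_gen_closed(2)] representation_act(3)[OF W MD_gen_closed(2)])
  qed
  then show ?thesis using f unfolding intertwiner_iff by blast
qed

end

section \<open>Tabloids of hook shape\<close>

text \<open>A tabloid of hook shape is given by the sequence of its \<open>k\<close> entries outside the first row.\<close>

definition hook_seqs :: "nat \<Rightarrow> nat \<Rightarrow> nat list set" where
  "hook_seqs n k = {xs. distinct xs \<and> length xs = k \<and> set xs \<subseteq> {1..n}}"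

definition hook_tabloid :: "nat \<Rightarrow> nat list \<Rightarrow> nat set list" where
  "hook_tabloid n xs = ({1..n} - set xs) # map (\<lambda>x. {x}) xs"

definition hook_tableau :: "nat list \<Rightarrow> nat list \<Rightarrow> nat \<times> nat \<Rightarrow> nat" where
  "hook_tableau ys xs = (\<lambda>(i, j). if i = 0 then ys ! j else xs ! (i - 1))"

lemma finite_hook_seqs: "finite (hook_seqs n k)"
proof -
  have "hook_seqs n k \<subseteq> {xs. set xs \<subseteq> {1..n} \<and> length xs = k}" by (auto simp: hook_seqs_def)
  then show ?thesis using finite_lists_length_eq[of "{1..n}" k] finite_subset by blast
qed

lemma hook_tabloid_inject [simp]: "hook_tabloid n xs = hook_tabloid n ys \<longleftrightarrow> xs = ys"
  by (auto simp: hook_tabloid_def inj_map_eq_map inj_def)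

lemma hook_tabloid_seq [simp]: "map the_elem (tl (hook_tabloid n xs)) = xs"
  by (simp add: hook_tabloid_def map_idI)

lemma map_hook_tabloid:
  assumes "\<sigma> permutes {1..n}"
  shows "map ((`) \<sigma>) (hook_tabloid n xs) = hook_tabloid n (map \<sigma> xs)"
  using permutes_image[OF assms] image_set_diff[OF permutes_inj[OF assms], of "{1..n}" "set xs"]
  by (simp add: hook_tabloid_def)

lemma map_hook_seqs:
  assumes "\<sigma> permutes {1..n}" "xs \<in> hook_seqs n k"
  shows "map \<sigma> xs \<in> hook_seqs n k"
  using assms permutes_image[OF assms(1)] inj_on_subset[OF permutes_inj[OF assms(1)], of "set xs"]
  by (auto simp: hook_seqs_def distinct_map)

lemma length_hook: "length (hook n k) = Suc k"
  by (simp add: hook_def)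

lemma nth_hook: "i \<le> k \<Longrightarrow> hook n k ! i = (if i = 0 then n - k else 1)"
  by (auto simp: hook_def nth_Cons')

lemma sum_list_hook: "k \<le> n \<Longrightarrow> sum_list (hook n k) = n"
  by (simp add: hook_def sum_list_replicate)

lemma young_diagram_hook:
  "young_diagram (hook n k) = Pair 0 ` {..<n - k} \<union> (\<lambda>i. (Suc i, 0)) ` {..<k}" (is "_ = ?B")
proof (rule Set.set_eqI)
  fix p :: "nat \<times> nat"
  obtain i j where p: "p = (i, j)" by fastforce
  show "p \<in> young_diagram (hook n k) \<longleftrightarrow> p \<in> ?B"
    unfolding p by (cases i) (auto simp: young_diagram_def length_hook nth_hook less_Suc_eq_le)
qed

lemma tabloid_hook_eq:
  "tabloid (hook n k) t = t ` ({0} \<times> {..<n - k}) # map (\<lambda>i. {t (Suc i, 0)}) [0..<k]"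
proof (rule nth_equalityI)
  fix i assume "i < length (tabloid (hook n k) t)"
  then have "i < Suc k" by (simp add: tabloid_def length_hook)
  then show "tabloid (hook n k) t ! i = (t ` ({0} \<times> {..<n - k}) # map (\<lambda>i. {t (Suc i, 0)}) [0..<k]) ! i"
    by (cases i) (auto simp: tabloid_def length_hook nth_hook simp del: upt_Suc)
qed (simp add: tabloid_def length_hook)

lemma hook_tableau_tabloid:
  assumes "k < n" "distinct (ys @ xs)" "set (ys @ xs) = {1..n}" "length ys = n - k" "length xs = k"
  shows "tableau (hook n k) (hook_tableau ys xs)"
    and "tabloid (hook n k) (hook_tableau ys xs) = hook_tabloid n xs"
proof -
  define Y where "Y = young_diagram (hook n k)"
  have im: "hook_tableau ys xs ` Y = {1..n}"
  proof -
    have "set zs = (!) zs ` {..<length zs}" for zs :: "nat list" by (auto simp: set_conv_nth)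
    then have "hook_tableau ys xs ` Y = set ys \<union> set xs"
      using assms(4,5) by (simp add: Y_def young_diagram_hook image_Un image_image hook_tableau_def)
    then show ?thesis using assms(3) by simp
  qed
  have "card Y = card (Pair (0::nat) ` {..<n - k}) + card ((\<lambda>i. (Suc i, 0::nat)) ` {..<k})"
    unfolding Y_def young_diagram_hook by (rule card_Un_disjoint) auto
  also have "\<dots> = n" using assms(1) by (simp add: card_image inj_on_def)
  finally have "inj_on (hook_tableau ys xs) Y"
    using im by (intro eq_card_imp_inj_on) (auto simp: Y_def young_diagram_hook)
  then show "tableau (hook n k) (hook_tableau ys xs)"
    using im assms(1) by (simp add: tableau_def bij_betw_def Y_def sum_list_hook)
  have "hook_tableau ys xs ` ({0} \<times> {..<n - k}) = set ys"
    using assms(4) by (auto simp: hook_tableau_def set_conv_nth image_iff)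
  also have "\<dots> = {1..n} - set xs" using assms(2,3) by auto
  finally show "tabloid (hook n k) (hook_tableau ys xs) = hook_tabloid n xs"
    unfolding tabloid_hook_eq hook_tabloid_def
    using assms(5) by (auto simp: hook_tableau_def intro!: nth_equalityI)
qed

lemma tabloids_hook:
  assumes kn: "k < n"
  shows "tabloids (hook n k) = hook_tabloid n ` hook_seqs n k"
proof
  show "tabloids (hook n k) \<subseteq> hook_tabloid n ` hook_seqs n k"
  proof
    fix T assume "T \<in> tabloids (hook n k)"
    then obtain t where t: "tableau (hook n k) t" "T = tabloid (hook n k) t" by (auto simp: tabloids_def)
    define xs where "xs = map (\<lambda>i. t (Suc i, 0)) [0..<k]"
    have bij: "inj_on t (young_diagram (hook n k))" "t ` young_diagram (hook n k) = {1..n}"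
      using t(1) kn by (auto simp: tableau_def bij_betw_def sum_list_hook)
    have xs: "xs \<in> hook_seqs n k"
    proof -
      have "inj_on t ((\<lambda>i. (Suc i, 0)) ` {..<k})"
        by (rule inj_on_subset[OF bij(1)]) (auto simp: young_diagram_hook)
      then have "inj_on (\<lambda>i. t (Suc i, 0)) {..<k}"
        using comp_inj_on[of "\<lambda>i. (Suc i, 0)" "{..<k}" t] by (simp add: comp_def inj_on_def[of "\<lambda>i. (Suc i, 0)"])
      then have "distinct xs" by (simp add: xs_def distinct_map atLeast0LessThan)
      moreover have "set xs \<subseteq> t ` young_diagram (hook n k)" by (auto simp: xs_def young_diagram_hook)
      ultimately show ?thesis using bij(2) by (auto simp: hook_seqs_def xs_def)
    qed
    have "set xs = t ` (\<lambda>i. (Suc i, 0)) ` {..<k}" by (auto simp: xs_def)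
    moreover have "t ` (Pair 0 ` {..<n - k}) = t ` young_diagram (hook n k) - t ` (\<lambda>i. (Suc i, 0)) ` {..<k}"
      using bij(1) unfolding young_diagram_hook
      by (subst inj_on_image_set_diff[symmetric]) auto
    moreover have "Pair 0 ` {..<n - k} = {0::nat} \<times> {..<n - k}" by auto
    ultimately have "t ` ({0} \<times> {..<n - k}) = {1..n} - set xs" using bij(2) by simp
    then have "T = hook_tabloid n xs"
      unfolding t(2) tabloid_hook_eq hook_tabloid_def by (simp add: xs_def comp_def)
    then show "T \<in> hook_tabloid n ` hook_seqs n k" using xs by blast
  qed
  show "hook_tabloid n ` hook_seqs n k \<subseteq> tabloids (hook n k)"
  proof
    fix T assume "T \<in> hook_tabloid n ` hook_seqs n k"
    then obtain xs where xs: "T = hook_tabloid n xs" "distinct xs" "length xs = k" "set xs \<subseteq> {1..n}"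
      by (auto simp: hook_seqs_def)
    \<comment> \<open>Any enumeration of the remaining numbers would do as first row; sorting merely
      selects one.\<close>
    define ys where "ys = sorted_list_of_set ({1..n} - set xs)"
    have "card (set xs) = k" using xs distinct_card by blast
    then have "length ys = n - k" using xs by (simp add: ys_def card_Diff_subset)
    moreover have "distinct (ys @ xs)" "set (ys @ xs) = {1..n}" using xs by (auto simp: ys_def)
    ultimately show "T \<in> tabloids (hook n k)"
      using hook_tableau_tabloid[OF kn, of ys xs] xs unfolding tabloids_def by force
  qed
qed

lemma finite_tabloids_hook: "k < n \<Longrightarrow> finite (tabloids (hook n k))"
  by (simp add: tabloids_hook finite_hook_seqs)

abbreviation hook_act ::
  "nat \<Rightarrow> nat \<Rightarrow> (nat \<Rightarrow> nat) \<Rightarrow> (nat set list \<Rightarrow> complex) \<Rightarrow> nat set list \<Rightarrow> complex" where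
  "hook_act n k \<equiv> tabloid_act (hook n k)"

abbreviation hook_tabloids :: "nat \<Rightarrow> nat \<Rightarrow> nat set list set" where
  "hook_tabloids n k \<equiv> tabloids (hook n k)"

lemma tabloid_act_hook:
  assumes "k < n" "\<sigma> permutes {1..n}" "xs \<in> hook_seqs n k"
  shows "hook_act n k \<sigma> f (hook_tabloid n xs) = f (hook_tabloid n (map (inv' \<sigma>) xs))"
  using assms by (simp add: tabloid_act_def tabloids_hook map_hook_tabloid permutes_inv)

lemma extensional_hook_eqI:
  assumes "k < n" "f \<in> extensional (hook_tabloids n k)" "g \<in> extensional (hook_tabloids n k)"
    and "\<And>xs. xs \<in> hook_seqs n k \<Longrightarrow> f (hook_tabloid n xs) = g (hook_tabloid n xs)"
  shows "f = g"
  by (rule extensionalityI[OF assms(2,3)]) (use assms(1,4) in \<open>auto simp: tabloids_hook\<close>)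

lemma tabloid_act_extensional: "tabloid_act lam \<sigma> f \<in> extensional (tabloids lam)"
  by (simp add: tabloid_act_def)

lemma tabloid_act_comp:
  assumes "\<sigma> permutes {1..sum_list lam}" "\<tau> permutes {1..sum_list lam}"
  shows "tabloid_act lam (\<sigma> \<circ> \<tau>) v = tabloid_act lam \<sigma> (tabloid_act lam \<tau> v)"
proof
  fix T
  have "inv' (\<sigma> \<circ> \<tau>) = inv' \<tau> \<circ> inv' \<sigma>"
    using assms by (intro o_inv_distrib permutes_bij)
  then have "map ((`) (inv' (\<sigma> \<circ> \<tau>))) T = map ((`) (inv' \<tau>)) (map ((`) (inv' \<sigma>)) T)"
    by (simp add: image_comp)
  then show "tabloid_act lam (\<sigma> \<circ> \<tau>) v T = tabloid_act lam \<sigma> (tabloid_act lam \<tau> v) T"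
    using tabloids_image[OF _ permutes_inv[OF assms(1)], of T]
    unfolding tabloid_act_def restrict_def by (simp only: split: if_split) blast
qed

text \<open>The embedding of the \<open>k\<close>-th exterior power into the permutation module of a hook.\<close>

definition alt :: "nat \<Rightarrow> nat \<Rightarrow> (nat set \<Rightarrow> complex) \<Rightarrow> nat set list \<Rightarrow> complex" where
  "alt n k f = (\<lambda>T\<in>hook_tabloids n k.
     sortsign (map the_elem (tl T)) * f (set (map the_elem (tl T))))"

lemma alt_hook_tabloid:
  "k < n \<Longrightarrow> xs \<in> hook_seqs n k \<Longrightarrow> alt n k f (hook_tabloid n xs) = sortsign xs * f (set xs)"
  unfolding alt_def by (subst restrict_apply') (simp_all only: tabloids_hook hook_tabloid_seq imageI)

lemma alt_extensional: "alt n k f \<in> extensional (hook_tabloids n k)"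
  by (simp add: alt_def)

text \<open>Each \<open>k\<close>-subset is the set of some sequence, and sorting signs are
  invertible. Equations in the hook module thus become equations between coefficients in degree
  \<open>k\<close>.\<close>

lemma alt_eq_iff:
  assumes "k < n"
  shows "alt n k f = alt n k g \<longleftrightarrow> (\<forall>A\<subseteq>{1..n}. card A = k \<longrightarrow> f A = g A)"
proof
  assume eq: "alt n k f = alt n k g"
  show "\<forall>A\<subseteq>{1..n}. card A = k \<longrightarrow> f A = g A"
  proof (intro allI impI)
    fix A assume A: "A \<subseteq> {1..n}" "card A = k"
    then have "finite A" using finite_subset by blast
    then obtain xs where xs: "set xs = A" "distinct xs" using finite_distinct_list by blast
    then have "xs \<in> hook_seqs n k" using A distinct_card[OF xs(2)] by (auto simp: hook_seqs_def)
    then show "f A = g A" using fun_cong[OF eq, of "hook_tabloid n xs"] assms xs by (simp add: alt_hook_tabloid)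
  qed
next
  assume "\<forall>A\<subseteq>{1..n}. card A = k \<longrightarrow> f A = g A"
  then show "alt n k f = alt n k g"
    by (intro extensional_hook_eqI[OF assms])
      (auto simp: alt_extensional alt_hook_tabloid assms hook_seqs_def distinct_card)
qed

lemma alt_tau:
  assumes "k < n" and i: "1 \<le> i" "i < n"
  shows "hook_act n k (adj i) (alt n k f) = alt n k (tau i f)"
proof (rule extensional_hook_eqI[OF assms(1)])
  have p: "adj i permutes {1..n}" using i by (intro permutes_swap_id) auto
  fix xs assume xs: "xs \<in> hook_seqs n k"
  then have d: "distinct xs" by (simp add: hook_seqs_def)
  have "hook_act n k (adj i) (alt n k f) (hook_tabloid n xs) = sortsign (map (adj i) xs) * f (adj i ` set xs)"
    using assms(1) xs map_hook_seqs[OF p xs] by (simp add: tabloid_act_hook[OF assms(1) p] alt_hook_tabloid)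
  also have "\<dots> = alt n k (tau i f) (hook_tabloid n xs)"
    using assms(1) xs by (simp add: sortsign_adj[OF d] alt_hook_tabloid tau_def mult_ac)
  finally show "hook_act n k (adj i) (alt n k f) (hook_tabloid n xs) = alt n k (tau i f) (hook_tabloid n xs)" .
qed (simp_all add: alt_extensional tabloid_act_extensional)


section \<open>Polytabloids of hook shape\<close>

text \<open>The first column reads \<open>1, ..., k + 1\<close> from the corner downwards, so that
  the column stabilizer permutes an initial interval and is itself generated by adjacent
  transpositions.\<close>

definition tab0 :: "nat \<Rightarrow> nat \<Rightarrow> nat \<times> nat \<Rightarrow> nat" where
  "tab0 n k = hook_tableau (1 # [k + 2..<n + 1]) [2..<k + 2]"

lemma tab0:
  assumes "k < n"
  shows "tableau (hook n k) (tab0 n k)" "tabloid (hook n k) (tab0 n k) = hook_tabloid n [2..<k + 2]"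
    "[2..<k + 2] \<in> hook_seqs n k"
proof -
  have "distinct ((1 # [k + 2..<n + 1]) @ [2..<k + 2])" "set ((1 # [k + 2..<n + 1]) @ [2..<k + 2]) = {1..n}"
    using assms by auto
  then show "tableau (hook n k) (tab0 n k)" "tabloid (hook n k) (tab0 n k) = hook_tabloid n [2..<k + 2]"
    unfolding tab0_def using hook_tableau_tabloid[OF assms, of "1 # [k + 2..<n + 1]" "[2..<k + 2]"] assms
    by (simp_all del: upt_Suc distinct.simps set_append set_simps distinct_append append_Cons)
  show "[2..<k + 2] \<in> hook_seqs n k" using assms by (auto simp: hook_seqs_def)
qed

abbreviation polytabloid0 :: "nat \<Rightarrow> nat \<Rightarrow> nat set list \<Rightarrow> complex" where
  "polytabloid0 n k \<equiv> polytabloid (hook n k) (tab0 n k)"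

text \<open>All columns of a hook except the first have height one, which forces the entries above
  \<open>k + 1\<close> to be fixed.\<close>

lemma column_stabilizer_tab0:
  assumes kn: "k < n"
  shows "column_stabilizer (hook n k) (tab0 n k) = {\<sigma>. \<sigma> permutes {1..Suc k}}"
proof -
  have col: "tab0 n k (i, 0) = Suc i" if "i \<le> k" for i
    using that by (cases i) (auto simp: tab0_def hook_tableau_def simp del: upt_Suc)
  have row: "tab0 n k (0, j) = k + Suc j" if "0 < j" "j < n - k" for j
    using that by (cases j) (auto simp: tab0_def hook_tableau_def nth_Cons' simp del: upt_Suc)
  have Y: "(i, j) \<in> young_diagram (hook n k) \<longleftrightarrow> i \<le> k \<and> j = 0 \<or> i = 0 \<and> j < n - k" for i j
    using kn by (cases i) (auto simp: young_diagram_hook)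
  show ?thesis
  proof (intro Set.set_eqI iffI)
    fix \<sigma> assume "\<sigma> \<in> column_stabilizer (hook n k) (tab0 n k)"
    then have \<sigma>: "\<sigma> permutes {1..n}" and st: "\<And>i j. (i, j) \<in> young_diagram (hook n k) \<Longrightarrow>
        \<exists>i'. (i', j) \<in> young_diagram (hook n k) \<and> \<sigma> (tab0 n k (i, j)) = tab0 n k (i', j)"
      using kn by (auto simp: column_stabilizer_def sum_list_hook)
    have "\<sigma> x = x" if "x \<in> {1..n} - {1..Suc k}" for x
    proof -
      define j where "j = x - Suc k"
      have j: "0 < j" "j < n - k" "x = k + Suc j" using that by (auto simp: j_def)
      then show ?thesis using st[of 0 j] row[OF j(1,2)] by (auto simp: Y)
    qed
    then show "\<sigma> \<in> {\<sigma>. \<sigma> permutes {1..Suc k}}" using permutes_superset[OF \<sigma>] by blast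
  next
    fix \<sigma> assume "\<sigma> \<in> {\<sigma>. \<sigma> permutes {1..Suc k}}"
    then have \<sigma>: "\<sigma> permutes {1..Suc k}" by simp
    have "\<exists>i'. (i', j) \<in> young_diagram (hook n k) \<and> \<sigma> (tab0 n k (i, j)) = tab0 n k (i', j)"
      if "(i, j) \<in> young_diagram (hook n k)" for i j
    proof (cases "j = 0")
      case True
      then have "i \<le> k" using that Y by auto
      then have "\<sigma> (Suc i) \<in> {1..Suc k}" using permutes_in_image[OF \<sigma>, of "Suc i"] by simp
      then have "\<sigma> (tab0 n k (i, j)) = tab0 n k (\<sigma> (Suc i) - 1, j)" "\<sigma> (Suc i) - 1 \<le> k"
        using True \<open>i \<le> k\<close> by (auto simp: col)
      then show ?thesis using True Y by blast
    next
      case False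
      then have "i = 0" "j < n - k" using that Y by auto
      then show ?thesis using that False row[of j] permutes_not_in[OF \<sigma>] by auto
    qed
    moreover have "\<sigma> permutes {1..n}" by (rule permutes_subset[OF \<sigma>]) (use kn in auto)
    ultimately show "\<sigma> \<in> column_stabilizer (hook n k) (tab0 n k)"
      using kn by (auto simp: column_stabilizer_def sum_list_hook)
  qed
qed

lemma permutation_of_list:
  assumes "distinct zs" "length zs = m" "set zs = {1..m}"
  shows "\<exists>\<sigma>. \<sigma> permutes {1..m} \<and> map \<sigma> [1..<Suc m] = zs"
proof -
  define \<sigma> where "\<sigma> x = (if x \<in> {1..m} then zs ! (x - 1) else x)" for x
  have m: "map \<sigma> [1..<Suc m] = zs"
    using assms(2) by (auto simp: \<sigma>_def intro!: nth_equalityI simp del: upt_Suc)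
  have s: "set [1..<Suc m] = {1..m}" by auto
  have "\<sigma> ` {1..m} = {1..m}" using arg_cong[OF m, of set] assms(3) unfolding set_map s by simp
  then have "bij_betw \<sigma> {1..m} {1..m}"
    by (simp add: bij_betw_def finite_surj_inj[of "{1..m}" \<sigma>] del: One_nat_def)
  then have "\<sigma> permutes {1..m}" by (rule bij_imp_permutes) (auto simp: \<sigma>_def)
  then show ?thesis using m by blast
qed

lemma two_missing:
  assumes "finite B" "card A < card B - 1" "finite A"
  shows "\<exists>a b. a \<in> B - A \<and> b \<in> B - A \<and> a \<noteq> b"
proof -
  have "card (B - A) > 1" using diff_card_le_card_Diff[OF assms(3), of B] assms(2) by linarith
  then show ?thesis by (metis One_nat_def card_le_Suc0_iff_eq finite_Diff assms(1) not_less)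
qed

text \<open>Exchanging two entries of the first row fixes the tabloid, so the value there equals its
  own negative.\<close>

lemma antisymmetric_zero:
  assumes kn: "k < n" and xs: "xs \<in> hook_seqs n k" and ab: "a \<in> {1..n} - set xs" "b \<in> {1..n} - set xs"
    and anti: "hook_act n k (Transposition.transpose a b) f (hook_tabloid n xs) = - f (hook_tabloid n xs)"
  shows "f (hook_tabloid n xs) = 0"
proof -
  have p: "Transposition.transpose a b permutes {1..n}" using ab by (intro permutes_swap_id) auto
  have "map (Transposition.transpose a b) xs = xs"
    using ab by (intro map_idI) (auto simp: Transposition.transpose_def)
  then show ?thesis using anti by (simp add: tabloid_act_hook[OF kn p xs])
qed

definition antisymmetric :: "nat \<Rightarrow> nat \<Rightarrow> nat \<Rightarrow> (nat set list \<Rightarrow> complex) \<Rightarrow> bool" where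
  "antisymmetric n k m f \<longleftrightarrow> (\<forall>\<sigma>. \<sigma> permutes {1..m} \<longrightarrow>
     (\<forall>T\<in>hook_tabloids n k. hook_act n k \<sigma> f T = of_int (sign \<sigma>) * f T))"

text \<open>The polytabloid of \<open>tab0\<close> spans the functions which are antisymmetric under its column
  stabilizer: on a tabloid whose first row contains two of the numbers \<open>1, \<dots>, k + 1\<close>, such a
  function vanishes, and the other tabloids form a single orbit.\<close>

lemma antisymmetric_eq_polytabloid:
  assumes kn: "k < n" and f: "f \<in> extensional (hook_tabloids n k)" and anti: "antisymmetric n k (Suc k) f"
  shows "f = (\<lambda>T\<in>hook_tabloids n k. f (hook_tabloid n [2..<k + 2]) * polytabloid0 n k T)"
proof (rule extensional_hook_eqI[OF kn f])
  fix xs assume xs: "xs \<in> hook_seqs n k"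
  define S where "S = {\<sigma>. \<sigma> permutes {1..Suc k} \<and> map \<sigma> [2..<k + 2] = xs}"
  have T: "hook_tabloid n xs \<in> hook_tabloids n k" using xs by (simp add: tabloids_hook kn)
  have pn: "\<sigma> permutes {1..n}" if "\<sigma> permutes {1..Suc k}" for \<sigma>
    by (rule permutes_subset[OF that]) (use kn in auto)
  have "{\<sigma> \<in> column_stabilizer (hook n k) (tab0 n k). tabloid (hook n k) (\<sigma> \<circ> tab0 n k) = hook_tabloid n xs} = S"
    using pn by (auto simp: S_def column_stabilizer_tab0[OF kn] tabloid_comp tab0[OF kn] map_hook_tabloid simp del: upt_Suc)
  then have e: "polytabloid0 n k (hook_tabloid n xs) = (\<Sum>\<sigma>\<in>S. of_int (sign \<sigma>))"
    using T by (simp add: polytabloid_def)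
  show "f (hook_tabloid n xs) = (\<lambda>T\<in>hook_tabloids n k. f (hook_tabloid n [2..<k + 2]) *
      polytabloid0 n k T) (hook_tabloid n xs)"
  proof (cases "S = {}")
    case False
    then obtain \<sigma> where \<sigma>: "\<sigma> permutes {1..Suc k}" "map \<sigma> [2..<k + 2] = xs" by (auto simp: S_def)
    \<comment> \<open>The list \<open>[2..<k + 2]\<close> misses only \<open>1\<close> from the
      first column, and a permutation of \<open>{1..Suc k}\<close> is determined by its values at
      all points but one.\<close>
    have unique: "\<sigma>' = \<sigma>" if \<sigma>': "\<sigma>' permutes {1..Suc k}" "map \<sigma>' [2..<k + 2] = xs" for \<sigma>'
    proof -
      define \<rho> where "\<rho> = inv' \<sigma> \<circ> \<sigma>'"
      have "\<rho> permutes {1..Suc k}" unfolding \<rho>_def by (rule permutes_compose[OF \<sigma>'(1) permutes_inv[OF \<sigma>(1)]])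
      moreover have "\<rho> x = x" if "x \<in> {1..Suc k} - {1}" for x
      proof -
        have "x \<in> set [2..<k + 2]" using that by auto
        then have "\<sigma>' x = \<sigma> x" using \<sigma> \<sigma>' map_eq_conv by metis
        then show ?thesis by (simp add: \<rho>_def permutes_inverses[OF \<sigma>(1)])
      qed
      ultimately have "\<rho> permutes {1}" by (rule permutes_superset)
      then have id: "\<rho> = id" by simp
      show ?thesis
      proof
        fix x
        have "\<sigma>' x = \<sigma> (\<rho> x)" by (simp add: \<rho>_def permutes_inverses[OF \<sigma>(1)])
        then show "\<sigma>' x = \<sigma> x" by (simp add: id)
      qed
    qed
    have "\<sigma> \<in> S" unfolding S_def using \<sigma> by blast
    moreover have "\<sigma>' = \<sigma>" if "\<sigma>' \<in> S" for \<sigma>' using that unique unfolding S_def by blast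
    ultimately have "S = {\<sigma>}" by blast
    then have e': "polytabloid0 n k (hook_tabloid n xs) = of_int (sign \<sigma>)" using e by simp
    have "map (inv' \<sigma>) xs = [2..<k + 2]"
      unfolding \<sigma>(2)[symmetric] map_map by (rule map_idI) (simp add: permutes_inverses[OF \<sigma>(1)])
    then have "f (hook_tabloid n [2..<k + 2]) = of_int (sign \<sigma>) * f (hook_tabloid n xs)"
      using anti \<sigma>(1) T tabloid_act_hook[OF kn pn[OF \<sigma>(1)] xs, of f] by (auto simp: antisymmetric_def)
    then have "f (hook_tabloid n [2..<k + 2]) * of_int (sign \<sigma>) = of_int (sign \<sigma> * sign \<sigma>) * f (hook_tabloid n xs)"
      by (simp only: of_int_mult mult_ac)
    then show ?thesis using T e' by simp
  next
    case True
    \<comment> \<open>If \<open>xs\<close> omitted just one number \<open>b\<close> of the first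
      column, then \<open>b # xs\<close> would arrange \<open>{1..Suc k}\<close>, and the
      permutation sending \<open>1\<close> to \<open>b\<close> and the remaining numbers to
      \<open>xs\<close> would lie in \<open>S\<close>.\<close>
    have "\<exists>a b. a \<in> {1..Suc k} - set xs \<and> b \<in> {1..Suc k} - set xs \<and> a \<noteq> b"
    proof (rule ccontr)
      assume no: "\<not> ?thesis"
      have len: "distinct xs" "length xs = k" "card (set xs) = k" using xs by (auto simp: hook_seqs_def distinct_card)
      have "card ({1..Suc k} - set xs) \<ge> 1" using diff_card_le_card_Diff[of "set xs" "{1..Suc k}"] len by simp
      then have "{1..Suc k} - set xs \<noteq> {}" by (metis card.empty not_one_le_zero)
      then obtain b where b: "b \<in> {1..Suc k} - set xs" by blast
      then have single: "{1..Suc k} - set xs = {b}" using no by blast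
      then have "{1..Suc k} \<subseteq> insert b (set xs)" by blast
      moreover have "card (insert b (set xs)) = Suc k" using len b by simp
      ultimately have "set (b # xs) = {1..Suc k}"
        using card_subset_eq[of "insert b (set xs)" "{1..Suc k}"] by simp
      then obtain \<sigma> where \<sigma>: "\<sigma> permutes {1..Suc k}" "map \<sigma> [1..<Suc (Suc k)] = b # xs"
        using permutation_of_list[of "b # xs" "Suc k"] len b by auto
      have "[1..<Suc (Suc k)] = 1 # [2..<k + 2]" by (simp add: upt_conv_Cons numeral_2_eq_2 del: upt_Suc)
      then have "map \<sigma> [2..<k + 2] = xs" using \<sigma>(2) by (simp del: upt_Suc)
      then show False using \<sigma>(1) True by (auto simp: S_def)
    qed
    then obtain a b where ab: "a \<in> {1..Suc k} - set xs" "b \<in> {1..Suc k} - set xs" "a \<noteq> b" by blast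
    have p: "Transposition.transpose a b permutes {1..Suc k}" using ab by (intro permutes_swap_id) auto
    have "f (hook_tabloid n xs) = 0"
    proof (rule antisymmetric_zero[OF kn xs])
      show "a \<in> {1..n} - set xs" "b \<in> {1..n} - set xs" using ab kn by auto
      show "hook_act n k (Transposition.transpose a b) f (hook_tabloid n xs) = - f (hook_tabloid n xs)"
        using anti p T ab(3) by (simp add: antisymmetric_def sign_swap_id)
    qed
    moreover have "polytabloid0 n k (hook_tabloid n xs) = 0" using e True by simp
    ultimately show ?thesis using T by simp
  qed
qed simp

section \<open>Specht modules of hook shape\<close>

lemma hook_rep_sel:
  "carrier (hook_rep n k) = LinearCombinations.module.span class_ring (perm_module (hook n k))
     (polytabloid (hook n k) ` {t. tableau (hook n k) t})"
  "\<zero>\<^bsub>hook_rep n k\<^esub> = (\<lambda>T\<in>hook_tabloids n k. 0)"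
  "f \<oplus>\<^bsub>hook_rep n k\<^esub> g = (\<lambda>T\<in>hook_tabloids n k. f T + g T)"
  "c \<odot>\<^bsub>hook_rep n k\<^esub> f = (\<lambda>T\<in>hook_tabloids n k. c * f T)"
  "act (hook_rep n k) w f = hook_act n k (MD_perm n w) f"
  by (simp_all add: hook_rep_def specht_def perm_module_simps)

text \<open>Tableaux are total functions with arbitrary values off the diagram, so tableaux with the
  same entries need not be equal as functions.\<close>

lemma polytabloid_cong:
  assumes eq: "\<And>p. p \<in> young_diagram lam \<Longrightarrow> t p = t' p"
  shows "polytabloid lam t = polytabloid lam t'"
proof -
  have "tabloid lam (\<sigma> \<circ> t) = tabloid lam (\<sigma> \<circ> t')" for \<sigma>
    unfolding tabloid_def using eq by (auto simp: young_diagram_def intro!: image_cong)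
  moreover have "column_stabilizer lam t = column_stabilizer lam t'"
  proof -
    have "(\<exists>i'. (i', snd p) \<in> young_diagram lam \<and> \<sigma> (t p) = t (i', snd p)) \<longleftrightarrow>
        (\<exists>i'. (i', snd p) \<in> young_diagram lam \<and> \<sigma> (t' p) = t' (i', snd p))"
      if "p \<in> young_diagram lam" for p \<sigma>
      using eq that by metis
    then show ?thesis unfolding column_stabilizer_def case_prod_beta prod.collapse
      by (intro Collect_cong conj_cong HOL.refl ball_cong)
  qed
  ultimately show ?thesis by (simp add: polytabloid_def)
qed

text \<open>The permutation is \<open>t\<close> after the inverse of \<open>t0\<close>, extended by
  the identity. Hence a single polytabloid generates the Specht module under the symmetric
  group.\<close>

lemma polytabloid_orbit:
  assumes t0: "tableau lam t0" and t: "tableau lam t"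
  shows "\<exists>\<sigma>. \<sigma> permutes {1..sum_list lam} \<and> polytabloid lam t = tabloid_act lam \<sigma> (polytabloid lam t0)"
proof -
  define N where "N = {1..sum_list lam}"
  define Y where "Y = young_diagram lam"
  define \<sigma> where "\<sigma> x = (if x \<in> N then t (inv_into Y t0 x) else x)" for x
  have bij: "bij_betw t0 Y N" "bij_betw t Y N" using t0 t by (simp_all add: tableau_def Y_def N_def)
  have "bij_betw (t \<circ> inv_into Y t0) N N" using bij_betw_trans[OF bij_betw_inv_into[OF bij(1)] bij(2)] .
  then have "bij_betw \<sigma> N N" by (rule bij_betw_cong[THEN iffD1, rotated]) (simp add: \<sigma>_def)
  then have p: "\<sigma> permutes N" by (rule bij_imp_permutes) (simp add: \<sigma>_def)
  have "t p = (\<sigma> \<circ> t0) p" if "p \<in> young_diagram lam" for p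
    using that bij(1) bij_betw_inv_into_left[OF bij(1)] bij_betwE[OF bij(1)] by (simp add: \<sigma>_def Y_def)
  then have "polytabloid lam t = polytabloid lam (\<sigma> \<circ> t0)" by (rule polytabloid_cong)
  then show ?thesis using p tabloid_act_polytabloid[of \<sigma> lam t0] t0 by (auto simp: N_def)
qed

lemma tabloid_act_id:
  assumes "f \<in> extensional (tabloids lam)"
  shows "tabloid_act lam id f = f"
proof -
  have "map ((`) (inv' (id :: nat \<Rightarrow> nat))) T = T" for T :: "nat set list" by (simp add: map_idI)
  then show ?thesis using assms by (auto simp: tabloid_act_def fun_eq_iff extensional_def)
qed

section \<open>Contraction inside the permutation module\<close>

lemma alt_add: "(\<lambda>T\<in>hook_tabloids n k. alt n k f T + alt n k g T) = alt n k (\<lambda>A. f A + g A)"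
  by (auto simp: alt_def distrib_left fun_eq_iff)

lemma alt_smult: "(\<lambda>T\<in>hook_tabloids n k. c * alt n k f T) = alt n k (\<lambda>A. c * f A)"
  by (auto simp: alt_def fun_eq_iff)

lemma bd_add_fun: "bd n (\<lambda>A. f A + g A) = (\<lambda>A. bd n f A + bd n g A)"
  by (rule ext) (rule bd_add)

lemma bd_smult_fun: "bd n (\<lambda>A. c * f A) = (\<lambda>A. c * bd n f A)"
  by (rule ext) (rule bd_smult)

lemma alt_bd_tau:
  assumes "k < n" "1 \<le> i" "i < n"
  shows "hook_act n k (adj i) (alt n k (bd n f)) = alt n k (bd n (tau i f))"
  unfolding alt_tau[OF assms] alt_eq_iff[OF assms(1)] using bd_tau[OF assms(2,3)] by simp

text \<open>The coefficient function of the basis vector \<open>e_B\<close>.\<close>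

definition kdelta :: "nat set \<Rightarrow> nat set \<Rightarrow> complex" where
  "kdelta B A = (if A = B then 1 else 0)"

lemma tau_kdelta: "tau i (kdelta B) = (\<lambda>A. csgn i (adj i ` B) * kdelta (adj i ` B) A)"
proof
  fix A
  have "adj i ` A = B \<longleftrightarrow> A = adj i ` B" by (metis image_comp transpose_comp_involutory image_id id_apply)
  then show "tau i (kdelta B) A = csgn i (adj i ` B) * kdelta (adj i ` B) A"
    by (auto simp: tau_def kdelta_def)
qed

text \<open>The product \<open>e_1 ... e_(k+1)\<close> changes sign under adjacent transpositions of
  its indices, and \<open>alt\<close> after \<open>bd\<close> commutes with these
  transpositions.\<close>

lemma antisymmetric_kdelta:
  assumes kn: "k < n"
  shows "antisymmetric n k (Suc k) (alt n k (bd n (kdelta {1..Suc k})))"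
proof -
  define h where "h = alt n k (bd n (kdelta {1..Suc k}))"
  define TT where "TT = hook_tabloids n k"
  have N: "sum_list (hook n k) = n" using kn by (simp add: sum_list_hook)
  have h: "h \<in> extensional TT" by (simp add: h_def alt_extensional TT_def)
  have pn: "\<sigma> permutes {1..n}" if "\<sigma> permutes {1..Suc k}" for \<sigma>
    by (rule permutes_subset[OF that]) (use kn in auto)
  have h_adj: "hook_act n k (adj i) h = (\<lambda>T\<in>TT. (- 1) * h T)" if i: "1 \<le> i" "i < Suc k" for i
  proof -
    have im: "adj i ` {1..Suc k} = {1..Suc k}" by (rule adj_image_interval) (use i in auto)
    have "csgn i {1..Suc k} = - 1" using i by (auto simp: csgn_def)
    then have "tau i (kdelta {1..Suc k}) = (\<lambda>A. (- 1) * kdelta {1..Suc k} A)"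
      unfolding tau_kdelta im by simp
    then have "hook_act n k (adj i) h = alt n k (bd n (\<lambda>A. (- 1) * kdelta {1..Suc k} A))"
      unfolding h_def using i kn by (subst alt_bd_tau) auto
    then show ?thesis unfolding h_def TT_def by (simp only: alt_smult bd_smult_fun)
  qed
  have "\<forall>T\<in>TT. hook_act n k \<sigma> h T = of_int (sign \<sigma>) * h T" if "\<sigma> permutes {1..Suc k}" for \<sigma>
    using that
  proof (induction rule: permutes_adj_induct)
    case id
    show ?case unfolding tabloid_act_id[OF h[unfolded TT_def]] sign_id by simp
  next
    case (adj i \<sigma>)
    have pi: "adj i permutes {1..Suc k}" using adj(1,2) by (intro permutes_swap_id) auto
    have perm: "permutation (adj i)" "permutation \<sigma>"
      using pi adj(3) permutation_permutes by blast+
    have s: "of_int (sign (adj i \<circ> \<sigma>)) = (- of_int (sign \<sigma>) :: complex)"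
      unfolding sign_compose[OF perm] by (simp add: sign_swap_id)
    show ?case
    proof
      fix T assume T: "T \<in> TT"
      define T' where "T' = map ((`) (inv' (adj i))) T"
      have T': "T' \<in> TT"
        using tabloids_image[of T "hook n k" "inv' (adj i)"] T permutes_inv[OF pn[OF pi]] N
        by (simp add: TT_def T'_def)
      have ap: "hook_act n k (adj i) g T = g T'" for g using T by (simp add: tabloid_act_def TT_def T'_def)
      have "hook_act n k (adj i \<circ> \<sigma>) h T = hook_act n k (adj i) (hook_act n k \<sigma> h) T"
        by (subst tabloid_act_comp) (use pn[OF pi] pn[OF adj(3)] N in auto)
      also have "\<dots> = of_int (sign \<sigma>) * hook_act n k (adj i) h T"
        unfolding ap using adj(4) T' by blast
      also have "hook_act n k (adj i) h T = - h T"
        unfolding h_adj[OF adj(1,2)]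
        using T by simp
      finally show "hook_act n k (adj i \<circ> \<sigma>) h T = of_int (sign (adj i \<circ> \<sigma>)) * h T" by (simp only: s) simp
    qed
  qed
  then show ?thesis by (simp add: antisymmetric_def h_def TT_def)
qed

text \<open>The contraction of \<open>e_1 ... e_(k+1)\<close> is antisymmetric, hence a multiple of
  the polytabloid; its value at the tabloid of \<open>tab0\<close> shows that the factor is one. No
  other coefficient has to be computed.\<close>

lemma polytabloid_tab0:
  assumes kn: "k < n"
  shows "polytabloid0 n k = alt n k (bd n (kdelta {1..Suc k}))"
    and "polytabloid0 n k (hook_tabloid n [2..<k + 2]) = 1"
proof -
  define h where "h = alt n k (bd n (kdelta {1..Suc k}))"
  define A where "A = {2..k + 1}"
  \<comment> \<open>Only \<open>b = 1\<close> completes \<open>{2..k + 1}\<close> to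
    \<open>{1..Suc k}\<close>, and nothing in that set is smaller than \<open>1\<close>, so the sign
    is positive.\<close>
  have "bd n (kdelta {1..Suc k}) A = (\<Sum>b\<in>{1}. eps b A * kdelta {1..Suc k} (insert b A))"
    unfolding bd_def
  proof (rule sum.mono_neutral_right)
    show "\<forall>b\<in>{1..n} - A - {1}. eps b A * kdelta {1..Suc k} (insert b A) = 0"
    proof
      fix b assume "b \<in> {1..n} - A - {1}"
      then have "b \<notin> {1..Suc k}" by (auto simp: A_def)
      then have "insert b A \<noteq> {1..Suc k}" by blast
      then show "eps b A * kdelta {1..Suc k} (insert b A) = 0" by (simp add: kdelta_def)
    qed
  qed (use kn in \<open>auto simp: A_def\<close>)
  also have "\<dots> = eps 1 A" 
  proof -
    have "insert 1 A = {1..Suc k}" by (auto simp: A_def)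
    then show ?thesis by (simp add: kdelta_def)
  qed
  also have "eps 1 A = 1"
  proof -
    have "{a \<in> A. a < 1} = {}" by (auto simp: A_def)
    then show ?thesis unfolding eps_def by (simp only: card.empty power_0)
  qed
  also have "A = set [2..<k + 2]" by (auto simp: A_def)
  finally have "bd n (kdelta {1..Suc k}) (set [2..<k + 2]) = 1" .
  then have h1: "h (hook_tabloid n [2..<k + 2]) = 1"
    unfolding h_def alt_hook_tabloid[OF kn tab0(3)[OF kn]] by (simp only: sortsign_sorted sorted_upt distinct_upt mult_1_left)
  have "h = (\<lambda>T\<in>hook_tabloids n k. h (hook_tabloid n [2..<k + 2]) * polytabloid0 n k T)"
    unfolding h_def by (rule antisymmetric_eq_polytabloid[OF kn alt_extensional antisymmetric_kdelta[OF kn]])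
  also have "\<dots> = polytabloid0 n k"
    unfolding h1 by (auto simp: polytabloid_def fun_eq_iff)
  finally show "polytabloid0 n k = alt n k (bd n (kdelta {1..Suc k}))" by (simp add: h_def)
  then show "polytabloid0 n k (hook_tabloid n [2..<k + 2]) = 1" using h1 by (simp only: h_def)
qed

lemma module_perm_module: "module class_ring (perm_module lam)"
  using vectorspace_perm_module[of lam] by (simp add: vectorspace_def)

lemma submodule_perm_module_iff:
  "LinearCombinations.submodule class_ring W (perm_module lam) \<longleftrightarrow>
     W \<subseteq> extensional (tabloids lam) \<and> (\<lambda>T\<in>tabloids lam. 0) \<in> W \<and>
     (\<forall>f\<in>W. \<forall>g\<in>W. (\<lambda>T\<in>tabloids lam. f T + g T) \<in> W) \<and> (\<forall>c. \<forall>f\<in>W. (\<lambda>T\<in>tabloids lam. c * f T) \<in> W)"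
  using module_perm_module[of lam] by (auto simp: submodule_def perm_module_simps)

lemma polytabloid_in_hook_rep:
  "tableau (hook n k) t \<Longrightarrow> polytabloid (hook n k) t \<in> carrier (hook_rep n k)"
  unfolding hook_rep_sel
  by (rule subsetD[OF module.in_own_span[OF module_perm_module]])
    (auto simp: perm_module_simps polytabloid_def)

lemma hook_rep_least:
  assumes W: "LinearCombinations.submodule class_ring W (perm_module (hook n k))"
    and "\<And>t. tableau (hook n k) t \<Longrightarrow> polytabloid (hook n k) t \<in> W"
  shows "carrier (hook_rep n k) \<subseteq> W"
  unfolding hook_rep_sel by (rule module.span_is_subset[OF module_perm_module _ W]) (use assms(2) in auto)

lemma hook_rep_tabloid_act:
  assumes "k < n" "\<sigma> permutes {1..n}" "x \<in> carrier (hook_rep n k)"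
  shows "hook_act n k \<sigma> x \<in> carrier (hook_rep n k)"
proof -
  obtain g where g: "g \<in> carrier (MD n)" "MD_perm n g = \<sigma>" using MD_perm_surj[OF assms(2)] by blast
  then show ?thesis
    using representation_closed(4)[OF representation_hook_rep[OF assms(1)] g(1) assms(3)] by (simp add: hook_rep_sel(5))
qed

lemma hook_rep_extensional:
  assumes "k < n"
  shows "carrier (hook_rep n k) \<subseteq> extensional (hook_tabloids n k)"
  by (rule hook_rep_least) (auto simp: submodule_perm_module_iff polytabloid_def)

lemma ex_permutes_image:
  fixes n :: nat
  assumes "B \<subseteq> {1..n}" "C \<subseteq> {1..n}" "card B = card C"
  shows "\<exists>\<sigma>. \<sigma> permutes {1..n} \<and> \<sigma> ` B = C"
proof -
  have fB: "finite B" by (rule finite_subset[OF assms(1)]) simp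
  have fC: "finite C" by (rule finite_subset[OF assms(2)]) simp
  note fin = fB fC
  obtain f where f: "bij_betw f B C" using fin assms(3) finite_same_card_bij by blast
  have "card ({1..n} - B) = card ({1..n} - C)" using fin assms by (simp add: card_Diff_subset)
  then obtain g where g: "bij_betw g ({1..n} - B) ({1..n} - C)"
    using finite_same_card_bij[of "{1..n} - B" "{1..n} - C"] by auto
  define \<sigma> where "\<sigma> x = (if x \<in> B then f x else if x \<in> {1..n} then g x else x)" for x
  have sB: "bij_betw \<sigma> B C" using f by (rule bij_betw_cong[THEN iffD1, rotated]) (simp add: \<sigma>_def)
  have gB: "bij_betw \<sigma> ({1..n} - B) ({1..n} - C)"
    using g by (rule bij_betw_cong[THEN iffD1, rotated]) (simp add: \<sigma>_def)
  have "bij_betw \<sigma> (B \<union> ({1..n} - B)) (C \<union> ({1..n} - C))"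
    by (rule bij_betw_combine[OF sB gB]) blast
  then have "bij_betw \<sigma> {1..n} {1..n}" using assms by (simp add: Un_absorb1)
  then have "\<sigma> permutes {1..n}" by (rule bij_imp_permutes) (use assms in \<open>auto simp: \<sigma>_def\<close>)
  then show ?thesis using bij_betw_imp_surj_on[OF sB] by blast
qed

text \<open>The image of the contraction is a submodule, stable under permutations and containing
  one polytabloid, hence all of them. Conversely the functions \<open>kdelta B\<close> with
  \<open>card B = Suc k\<close> are, up to sign, translates of the one whose contraction is that
  polytabloid, and they span the relevant degree.\<close>

theorem carrier_hook_rep:
  assumes kn: "k < n"
  shows "carrier (hook_rep n k) = range (\<lambda>f. alt n k (bd n f))"
proof
  define R where "R = range (\<lambda>f. alt n k (bd n f))"
  have N: "sum_list (hook n k) = n" using kn by (simp add: sum_list_hook)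
  have sub: "LinearCombinations.submodule class_ring R (perm_module (hook n k))"
    unfolding submodule_perm_module_iff
  proof (intro conjI ballI allI)
    show "R \<subseteq> extensional (hook_tabloids n k)" by (auto simp: R_def alt_extensional)
    have "(\<lambda>T\<in>hook_tabloids n k. 0) = alt n k (bd n (\<lambda>_. 0))"
      by (auto simp: alt_def bd_def fun_eq_iff)
    then show "(\<lambda>T\<in>hook_tabloids n k. 0) \<in> R" by (simp add: R_def)
    fix x assume "x \<in> R"
    then obtain f where f: "x = alt n k (bd n f)" by (auto simp: R_def)
    show "(\<lambda>T\<in>hook_tabloids n k. c * x T) \<in> R" for c
      unfolding f alt_smult bd_smult_fun[symmetric] R_def by blast
    fix y assume "y \<in> R"
    then obtain g where g: "y = alt n k (bd n g)" by (auto simp: R_def)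
    show "(\<lambda>T\<in>hook_tabloids n k. x T + y T) \<in> R"
      unfolding f g alt_add bd_add_fun[symmetric] R_def by blast
  qed
  have act: "\<forall>x\<in>R. hook_act n k \<sigma> x \<in> R" if "\<sigma> permutes {1..n}" for \<sigma>
    using that
  proof (induction rule: permutes_adj_induct)
    case id
    show ?case
    proof
      fix x assume "x \<in> R"
      then have "hook_act n k id x = x" by (intro tabloid_act_id) (auto simp: R_def alt_extensional)
      then show "hook_act n k id x \<in> R" using \<open>x \<in> R\<close> by (simp only:)
    qed
  next
    case (adj i \<sigma>)
    have pi: "adj i permutes {1..n}" using adj(1,2) by (intro permutes_swap_id) auto
    show ?case
    proof
      fix x assume "x \<in> R"
      then obtain f where "hook_act n k \<sigma> x = alt n k (bd n f)" using adj(4) by (auto simp: R_def)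
      then have "hook_act n k (adj i \<circ> \<sigma>) x = alt n k (bd n (tau i f))"
        using tabloid_act_comp[of "adj i" "hook n k" \<sigma> x] pi adj(3) N alt_bd_tau[OF kn adj(1,2)] by simp
      then show "hook_act n k (adj i \<circ> \<sigma>) x \<in> R" by (simp add: R_def)
    qed
  qed
  have "polytabloid (hook n k) t \<in> R" if t: "tableau (hook n k) t" for t
  proof -
    obtain \<sigma> where "\<sigma> permutes {1..n}" "polytabloid (hook n k) t = hook_act n k \<sigma> (polytabloid0 n k)"
      using polytabloid_orbit[OF tab0(1)[OF kn] t] N by auto
    then show ?thesis using act polytabloid_tab0(1)[OF kn] by (simp add: R_def)
  qed
  then show "carrier (hook_rep n k) \<subseteq> range (\<lambda>f. alt n k (bd n f))"
    using hook_rep_least[OF sub] by (simp add: R_def)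

  \<comment> \<open>The preimage of the Specht module is a linear space, so it suffices to put the
    basis functions into it.\<close>
  define L where "L = {f. alt n k (bd n f) \<in> carrier (hook_rep n k)}"
  note rep = representation_hook_rep[OF kn]
  have add: "(\<lambda>A. f A + g A) \<in> L" if "f \<in> L" "g \<in> L" for f g
    using representation_closed(2)[OF rep, of "alt n k (bd n f)" "alt n k (bd n g)"] that
    by (simp add: L_def hook_rep_sel(3) alt_add bd_add_fun)
  have smult: "(\<lambda>A. c * f A) \<in> L" if "f \<in> L" for f c
    using representation_closed(3)[OF rep, of "alt n k (bd n f)" c] that
    by (simp add: L_def hook_rep_sel(4) alt_smult bd_smult_fun)
  have zero: "(\<lambda>A. 0) \<in> L"
  proof -
    have "alt n k (bd n (\<lambda>A. 0)) = (\<lambda>T\<in>hook_tabloids n k. 0)" by (auto simp: alt_def bd_def fun_eq_iff)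
    then show ?thesis using representation_closed(1)[OF rep] by (simp add: L_def hook_rep_sel(2))
  qed
  have base: "kdelta {1..Suc k} \<in> L"
    using polytabloid_in_hook_rep[OF tab0(1)[OF kn]] polytabloid_tab0(1)[OF kn] by (simp add: L_def)
  have orbit: "kdelta (\<sigma> ` {1..Suc k}) \<in> L" if "\<sigma> permutes {1..n}" for \<sigma>
    using that
  proof (induction rule: permutes_adj_induct)
    case id
    then show ?case using base by simp
  next
    case (adj i \<sigma>)
    define B where "B = \<sigma> ` {1..Suc k}"
    have pi: "adj i permutes {1..n}" using adj(1,2) by (intro permutes_swap_id) auto
    have "tau i (kdelta B) \<in> L"
      using hook_rep_tabloid_act[OF kn pi] adj(4)
      unfolding L_def B_def mem_Collect_eq alt_bd_tau[OF kn adj(1,2), symmetric] by blast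
    \<comment> \<open>A second multiplication by the sign cancels the one which
      \<open>tau_kdelta\<close> produces.\<close>
    then have "(\<lambda>A. csgn i (adj i ` B) * (csgn i (adj i ` B) * kdelta (adj i ` B) A)) \<in> L"
      unfolding tau_kdelta by (rule smult)
    then have "kdelta (adj i ` B) \<in> L" by (simp flip: mult.assoc)
    then show ?case by (simp only: B_def image_comp)
  qed
  have delta: "kdelta B \<in> L" if B: "B \<subseteq> {1..n}" "card B = Suc k" for B
  proof -
    have "{1..Suc k} \<subseteq> {1..n}" "card {1..Suc k} = card B" using B kn by auto
    then obtain \<sigma> where "\<sigma> permutes {1..n}" "\<sigma> ` {1..Suc k} = B"
      using ex_permutes_image[OF _ B(1)] by blast
    then show ?thesis using orbit by blast
  qed
  have sum: "(\<lambda>A. \<Sum>B\<in>\<B>. f B * kdelta B A) \<in> L"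
    if "finite \<B>" "\<And>B. B \<in> \<B> \<Longrightarrow> kdelta B \<in> L" for \<B> f
    using that by (induction \<B> rule: finite_induct) (auto simp: zero intro!: add smult)
  show "range (\<lambda>f. alt n k (bd n f)) \<subseteq> carrier (hook_rep n k)"
  proof
    fix x assume "x \<in> range (\<lambda>f. alt n k (bd n f))"
    then obtain f where f: "x = alt n k (bd n f)" by blast
    define \<B> where "\<B> = {B. B \<subseteq> {1..n} \<and> card B = Suc k}"
    have fin: "finite \<B>" by (simp add: \<B>_def)
    have "(\<lambda>A. \<Sum>B\<in>\<B>. f B * kdelta B A) \<in> L" 
    proof (rule sum[OF fin])
      fix B assume "B \<in> \<B>"
      then show "kdelta B \<in> L" using delta[of B] unfolding \<B>_def by blast
    qed
    moreover have "alt n k (bd n (\<lambda>A. \<Sum>B\<in>\<B>. f B * kdelta B A)) = x"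
      unfolding f alt_eq_iff[OF kn]
    proof (intro allI impI bd_cong)
      fix A B assume A: "A \<subseteq> {1..n}" "card A = k" and B: "B \<subseteq> {1..n}" "card B = Suc (card A)"
      then have "B \<in> \<B>" by (simp add: \<B>_def)
      moreover have "(\<Sum>C\<in>\<B>. f C * kdelta C B) = (\<Sum>C\<in>\<B>. if C = B then f C else 0)"
        by (rule sum.cong) (auto simp: kdelta_def)
      ultimately show "(\<Sum>C\<in>\<B>. f C * kdelta C B) = f B" using fin by simp
    qed
    ultimately show "x \<in> carrier (hook_rep n k)" by (simp add: L_def)
  qed
qed

section \<open>Irreducibility\<close>

text \<open>James's signed column sum of \<open>tab0\<close>, applied to \<open>u\<close>.\<close>

definition colsum :: "nat \<Rightarrow> nat \<Rightarrow> (nat set list \<Rightarrow> complex) \<Rightarrow> nat set list \<Rightarrow> complex" where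
  "colsum n k u = (\<lambda>T\<in>hook_tabloids n k.
     \<Sum>\<sigma> | \<sigma> permutes {1..Suc k}. of_int (sign \<sigma>) * hook_act n k \<sigma> u T)"

lemma permutes_interval_mono: "\<sigma> permutes {1..m} \<Longrightarrow> m \<le> n \<Longrightarrow> \<sigma> permutes {1..n::nat}"
  by (erule permutes_subset) auto

lemma antisymmetric_colsum:
  assumes kn: "k < n"
  shows "antisymmetric n k (Suc k) (colsum n k u)"
  unfolding antisymmetric_def
proof (intro allI impI ballI)
  fix \<rho> T assume \<rho>: "\<rho> permutes {1..Suc k}" and T: "T \<in> hook_tabloids n k"
  have N: "sum_list (hook n k) = n" using kn by (simp add: sum_list_hook)
  have pn: "\<sigma> permutes {1..n}" if "\<sigma> permutes {1..Suc k}" for \<sigma>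
    using permutes_interval_mono[OF that] kn by simp
  define T' where "T' = map ((`) (inv' \<rho>)) T"
  have T': "T' \<in> hook_tabloids n k"
    using tabloids_image[OF T, of "inv' \<rho>"] permutes_inv[OF pn[OF \<rho>]] N by (simp add: T'_def)
  have ap: "hook_act n k \<rho> g T = g T'" for g using T by (simp add: tabloid_act_def T'_def)
  have "(\<Sum>\<sigma> | \<sigma> permutes {1..Suc k}. of_int (sign \<sigma>) * hook_act n k \<sigma> u T) =
      (\<Sum>\<sigma> | \<sigma> permutes {1..Suc k}. of_int (sign (\<rho> \<circ> \<sigma>)) * hook_act n k (\<rho> \<circ> \<sigma>) u T)"
    by (rule setum_permutations_compose_left[OF \<rho>])
  also have "\<dots> = (\<Sum>\<sigma> | \<sigma> permutes {1..Suc k}. of_int (sign \<rho>) * (of_int (sign \<sigma>) * hook_act n k \<sigma> u T'))"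
  proof (rule sum.cong[OF HOL.refl])
    fix \<sigma> assume "\<sigma> \<in> {\<sigma>. \<sigma> permutes {1..Suc k}}"
    then have \<sigma>: "\<sigma> permutes {1..Suc k}" by simp
    have p: "permutation \<rho>" "permutation \<sigma>" using \<rho> \<sigma> permutation_permutes by blast+
    have "hook_act n k (\<rho> \<circ> \<sigma>) u T = hook_act n k \<rho> (hook_act n k \<sigma> u) T"
      by (subst tabloid_act_comp) (use pn[OF \<rho>] pn[OF \<sigma>] N in auto)
    then show "of_int (sign (\<rho> \<circ> \<sigma>)) * hook_act n k (\<rho> \<circ> \<sigma>) u T =
        of_int (sign \<rho>) * (of_int (sign \<sigma>) * hook_act n k \<sigma> u T')"
      by (simp only: ap sign_compose[OF p] of_int_mult mult.assoc)
  qed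
  also have "\<dots> = of_int (sign \<rho>) * colsum n k u T'"
    using T' by (simp add: colsum_def sum_distrib_left)
  finally have "colsum n k u T = of_int (sign \<rho>) * colsum n k u T'" using T by (simp add: colsum_def)
  then have "of_int (sign \<rho>) * colsum n k u T = of_int (sign \<rho> * sign \<rho>) * colsum n k u T'"
    by (simp only: of_int_mult mult.assoc)
  then show "hook_act n k \<rho> (colsum n k u) T = of_int (sign \<rho>) * colsum n k u T"
    by (simp add: ap)
qed

lemma colsum_eq:
  assumes kn: "k < n"
  shows "colsum n k u = (\<lambda>T\<in>hook_tabloids n k.
    colsum n k u (hook_tabloid n [2..<k + 2]) * polytabloid0 n k T)"
  by (rule antisymmetric_eq_polytabloid[OF kn _ antisymmetric_colsum[OF kn]]) (simp add: colsum_def)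

text \<open>At the tabloid of \<open>tab0\<close> the group elements can be moved from
  \<open>u\<close> to the tabloid by passing to inverses, which have the same sign; what remains
  there is the polytabloid. So the factor in \<open>colsum_eq\<close> is the pairing of
  \<open>u\<close> with the polytabloid.\<close>

lemma colsum_pairing:
  assumes kn: "k < n"
  shows "colsum n k u (hook_tabloid n [2..<k + 2]) =
    (\<Sum>T\<in>hook_tabloids n k. u T * polytabloid0 n k T)"
proof -
  define P where "P = {\<sigma>. \<sigma> permutes {1..Suc k}}"
  define x0 where "x0 = [2..<k + 2]"
  have x0: "x0 \<in> hook_seqs n k" unfolding x0_def by (rule tab0(3)[OF kn])
  have pn: "\<sigma> permutes {1..n}" if "\<sigma> \<in> P" for \<sigma>
    using permutes_interval_mono[of \<sigma> "Suc k" n] that kn by (simp add: P_def)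
  have fP: "finite P" by (simp add: P_def finite_permutations)
  have mem: "hook_tabloid n (map \<sigma> x0) \<in> hook_tabloids n k" if "\<sigma> \<in> P" for \<sigma>
    using map_hook_seqs[OF pn[OF that] x0] kn by (simp add: tabloids_hook)
  have e: "polytabloid0 n k T = (\<Sum>\<sigma>\<in>P. if hook_tabloid n (map \<sigma> x0) = T then of_int (sign \<sigma>) else 0)"
    if T: "T \<in> hook_tabloids n k" for T
  proof -
    have "{\<sigma> \<in> column_stabilizer (hook n k) (tab0 n k). tabloid (hook n k) (\<sigma> \<circ> tab0 n k) = T} =
        {\<sigma> \<in> P. hook_tabloid n (map \<sigma> x0) = T}"
      using pn unfolding column_stabilizer_tab0[OF kn] P_def[symmetric] tabloid_comp tab0(2)[OF kn] x0_def[symmetric]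
      by (auto simp: map_hook_tabloid)
    then show ?thesis using T fP by (simp add: polytabloid_def sum.inter_filter)
  qed
  have "colsum n k u (hook_tabloid n x0) = (\<Sum>\<sigma>\<in>P. of_int (sign \<sigma>) * hook_act n k \<sigma> u (hook_tabloid n x0))"
    using x0 kn by (simp add: colsum_def P_def tabloids_hook)
  also have "\<dots> = (\<Sum>\<sigma>\<in>P. of_int (sign \<sigma>) * u (hook_tabloid n (map (inv' \<sigma>) x0)))"
    using pn by (intro sum.cong HOL.refl) (simp add: tabloid_act_hook[OF kn _ x0])
  also have "\<dots> = (\<Sum>\<sigma>\<in>P. of_int (sign (inv' \<sigma>)) * u (hook_tabloid n (map (inv' (inv' \<sigma>)) x0)))"
    unfolding P_def by (rule sum_permutations_inverse)
  also have "\<dots> = (\<Sum>\<sigma>\<in>P. of_int (sign \<sigma>) * u (hook_tabloid n (map \<sigma> x0)))"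
  proof (rule sum.cong[OF HOL.refl])
    fix \<sigma> assume "\<sigma> \<in> P"
    then have "\<sigma> permutes {1..Suc k}" by (simp add: P_def)
    then have "inv' (inv' \<sigma>) = \<sigma>" "sign (inv' \<sigma>) = sign \<sigma>"
      using permutation_permutes by (auto simp: permutes_inv_inv intro!: sign_inverse)
    then show "of_int (sign (inv' \<sigma>)) * u (hook_tabloid n (map (inv' (inv' \<sigma>)) x0)) =
        of_int (sign \<sigma>) * u (hook_tabloid n (map \<sigma> x0))" by (simp only:)
  qed
  also have "\<dots> = (\<Sum>\<sigma>\<in>P. \<Sum>T\<in>hook_tabloids n k.
      if T = hook_tabloid n (map \<sigma> x0) then u T * of_int (sign \<sigma>) else 0)"
    using mem finite_tabloids_hook[OF kn] by (intro sum.cong HOL.refl) (simp add: mult.commute)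
  also have "\<dots> = (\<Sum>T\<in>hook_tabloids n k. \<Sum>\<sigma>\<in>P.
      if T = hook_tabloid n (map \<sigma> x0) then u T * of_int (sign \<sigma>) else 0)"
    by (rule sum.swap)
  also have "\<dots> = (\<Sum>T\<in>hook_tabloids n k. u T * polytabloid0 n k T)"
    unfolding sum_distrib_left by (intro sum.cong HOL.refl) (auto simp: e sum_distrib_left intro!: sum.cong)
  finally show ?thesis by (simp only: x0_def)
qed

lemma tabloid_act_pairing:
  assumes kn: "k < n" and \<sigma>: "\<sigma> permutes {1..n}"
  shows "(\<Sum>T\<in>hook_tabloids n k. u T * hook_act n k \<sigma> e T) =
    (\<Sum>T\<in>hook_tabloids n k. hook_act n k (inv' \<sigma>) u T * e T)"
proof (rule sum.reindex_bij_witness[where i = "map ((`) \<sigma>)" and j = "map ((`) (inv' \<sigma>))"])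
  have N: "sum_list (hook n k) = n" using kn by (simp add: sum_list_hook)
  fix T assume T: "T \<in> hook_tabloids n k"
  show "map ((`) \<sigma>) (map ((`) (inv' \<sigma>)) T) = T" "map ((`) (inv' \<sigma>)) (map ((`) \<sigma>) T) = T"
    by (rule map_image_inv[OF \<sigma>])+
  show m: "map ((`) (inv' \<sigma>)) T \<in> hook_tabloids n k"
    by (rule tabloids_image[OF T]) (simp only: N permutes_inv[OF \<sigma>])
  show "map ((`) \<sigma>) T \<in> hook_tabloids n k"
    by (rule tabloids_image[OF T]) (simp only: N \<sigma>)
  show "hook_act n k (inv' \<sigma>) u (map ((`) (inv' \<sigma>)) T) * e (map ((`) (inv' \<sigma>)) T) =
      u T * hook_act n k \<sigma> e T"
    using T m by (simp add: tabloid_act_def permutes_inv_inv[OF \<sigma>] map_image_inv[OF \<sigma>] del: map_map)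
qed

lemma hook_rep_generated:
  assumes kn: "k < n" and U: "invariant_subspace (MD n) (hook_rep n k) U"
    and e: "polytabloid0 n k \<in> U"
  shows "U = carrier (hook_rep n k)"
proof -
  note rep = representation_hook_rep[OF kn]
  note U' = U[unfolded invariant_subspace_iff[OF rep] hook_rep_sel(2-5)]
  have N: "sum_list (hook n k) = n" using kn by (simp add: sum_list_hook)
  have sub: "LinearCombinations.submodule class_ring U (perm_module (hook n k))"
    unfolding submodule_perm_module_iff using U' hook_rep_extensional[OF kn] by blast
  have "polytabloid (hook n k) t \<in> U" if t: "tableau (hook n k) t" for t
  proof -
    obtain \<sigma> where \<sigma>: "\<sigma> permutes {1..n}"
      "polytabloid (hook n k) t = hook_act n k \<sigma> (polytabloid0 n k)"
      using polytabloid_orbit[OF tab0(1)[OF kn] t] N by auto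
    obtain g where g: "g \<in> carrier (MD n)" "MD_perm n g = \<sigma>" using MD_perm_surj[OF \<sigma>(1)] by blast
    have "hook_act n k (MD_perm n g) (polytabloid0 n k) \<in> U" using U' g(1) e by blast
    then show ?thesis using \<sigma> g by simp
  qed
  then have "carrier (hook_rep n k) \<subseteq> U" by (rule hook_rep_least[OF sub])
  then show ?thesis using U' by blast
qed

text \<open>If some \<open>u\<close> in \<open>U\<close> has nonzero column sum, dividing by its
  factor puts the generating polytabloid into \<open>U\<close>. Otherwise all translates of
  \<open>u\<close> pair to zero with this polytabloid, so \<open>u\<close> is orthogonal to all
  polytabloids, hence to itself.\<close>

theorem irreducible_hook_rep:
  assumes kn: "k < n"
  shows "irreducible_rep (MD n) (hook_rep n k)"
proof -
  note rep = representation_hook_rep[OF kn]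
  define TT where "TT = hook_tabloids n k"
  define e where "e = polytabloid0 n k"
  define T0 where "T0 = hook_tabloid n [2..<k + 2]"
  have N: "sum_list (hook n k) = n" using kn by (simp add: sum_list_hook)
  have T0: "T0 \<in> TT" using tab0(3)[OF kn] kn by (simp add: T0_def TT_def tabloids_hook del: upt_Suc)
  have fT: "finite TT" unfolding TT_def by (rule finite_tabloids_hook[OF kn])
  have "e T0 = 1" unfolding e_def T0_def by (rule polytabloid_tab0(2)[OF kn])
  then have "e \<noteq> \<zero>\<^bsub>hook_rep n k\<^esub>" using T0 by (auto simp: hook_rep_sel TT_def)
  moreover have ein: "e \<in> carrier (hook_rep n k)"
    unfolding e_def by (rule polytabloid_in_hook_rep[OF tab0(1)[OF kn]])
  ultimately have nz: "carrier (hook_rep n k) \<noteq> {\<zero>\<^bsub>hook_rep n k\<^esub>}" by blast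
  have "U = {\<zero>\<^bsub>hook_rep n k\<^esub>} \<or> U = carrier (hook_rep n k)" if U: "invariant_subspace (MD n) (hook_rep n k) U" for U
  proof (rule disjCI)
    assume ne: "U \<noteq> carrier (hook_rep n k)"
    note U' = U[unfolded invariant_subspace_iff[OF rep] hook_rep_sel(2-5) TT_def[symmetric]]
    have ext: "u \<in> extensional TT" if "u \<in> U" for u
      using that U' hook_rep_extensional[OF kn] by (auto simp: TT_def)
    have act: "hook_act n k \<sigma> u \<in> U" if "\<sigma> permutes {1..n}" "u \<in> U" for \<sigma> u
      using MD_perm_surj[OF that(1)] U' that(2) by blast
    have sum: "(\<lambda>T\<in>TT. \<Sum>\<sigma>\<in>P. h \<sigma> T) \<in> U" if "finite P" "\<And>\<sigma>. \<sigma> \<in> P \<Longrightarrow> h \<sigma> \<in> U" for P and h :: "(nat \<Rightarrow> nat) \<Rightarrow> _"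
      using that
    proof (induction P rule: finite_induct)
      case empty
      have "(\<lambda>T\<in>TT. 0) \<in> U" using U' by blast
      then show ?case by (simp only: sum.empty)
    next
      case (insert \<sigma> P)
      then have "(\<lambda>T\<in>TT. h \<sigma> T + (\<lambda>T\<in>TT. \<Sum>\<sigma>\<in>P. h \<sigma> T) T) \<in> U" using U' by auto
      also have "(\<lambda>T\<in>TT. h \<sigma> T + (\<lambda>T\<in>TT. \<Sum>\<sigma>\<in>P. h \<sigma> T) T) = (\<lambda>T\<in>TT. \<Sum>\<sigma>\<in>insert \<sigma> P. h \<sigma> T)"
        using insert(1,2) by (intro restrict_ext) simp
      finally show ?case .
    qed
    have col: "colsum n k u \<in> U" if u: "u \<in> U" for u
    proof -
      have "(\<lambda>T\<in>TT. \<Sum>\<sigma> | \<sigma> permutes {1..Suc k}. (\<lambda>T\<in>TT. of_int (sign \<sigma>) * hook_act n k \<sigma> u T) T) \<in> U"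
      proof (rule sum)
        fix \<sigma> assume "\<sigma> \<in> {\<sigma>. \<sigma> permutes {1..Suc k}}"
        then have "\<sigma> permutes {1..n}" using permutes_interval_mono[of \<sigma> "Suc k" n] kn by simp
        then have "hook_act n k \<sigma> u \<in> U" using act u by blast
        then show "(\<lambda>T\<in>TT. of_int (sign \<sigma>) * hook_act n k \<sigma> u T) \<in> U" using U' by blast
      qed (simp add: finite_permutations)
      also have "(\<lambda>T\<in>TT. \<Sum>\<sigma> | \<sigma> permutes {1..Suc k}. (\<lambda>T\<in>TT. of_int (sign \<sigma>) * hook_act n k \<sigma> u T) T) = colsum n k u"
        unfolding colsum_def TT_def by (intro restrict_ext) simp
      finally show ?thesis .
    qed
    have zero: "colsum n k u T0 = 0" if u: "u \<in> U" for u
    proof (rule ccontr)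
      assume c: "colsum n k u T0 \<noteq> 0"
      have "(\<lambda>T\<in>TT. inverse (colsum n k u T0) * colsum n k u T) \<in> U" using U' col[OF u] by blast
      also have "(\<lambda>T\<in>TT. inverse (colsum n k u T0) * colsum n k u T) = e"
      proof (rule extensionalityI[of _ TT])
        show "e \<in> extensional TT" by (simp add: e_def TT_def polytabloid_def)
        fix T assume T: "T \<in> TT"
        have "colsum n k u T = colsum n k u T0 * e T"
          using fun_cong[OF colsum_eq[OF kn, of u], of T] T by (simp add: TT_def T0_def e_def del: upt_Suc)
        then show "(\<lambda>T\<in>TT. inverse (colsum n k u T0) * colsum n k u T) T = e T" using c T by simp
      qed simp
      finally show False using hook_rep_generated[OF kn U] ne by (simp add: e_def)
    qed
    have "u = \<zero>\<^bsub>hook_rep n k\<^esub>" if u: "u \<in> U" for u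
    proof -
      \<comment> \<open>Conjugation makes the pairing of \<open>u\<close> with itself a sum of
        squared moduli; it does not affect polytabloids, whose coefficients are integers.\<close>
      define W where "W = {f \<in> extensional TT. (\<Sum>T\<in>TT. u T * cnj (f T)) = 0}"
      have sub: "LinearCombinations.submodule class_ring W (perm_module (hook n k))"
        unfolding submodule_perm_module_iff TT_def[symmetric] W_def
        by (auto simp: distrib_left sum.distrib mult.left_commute[of "u _"] simp flip: sum_distrib_left)
      have "polytabloid (hook n k) t \<in> W" if t: "tableau (hook n k) t" for t
      proof -
        obtain \<sigma> where \<sigma>: "\<sigma> permutes {1..n}"
          "polytabloid (hook n k) t = hook_act n k \<sigma> e"
          using polytabloid_orbit[OF tab0(1)[OF kn] t] N by (auto simp: e_def)
        have "cnj (polytabloid (hook n k) t T) = polytabloid (hook n k) t T" if "T \<in> TT" for T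
          using that by (simp add: polytabloid_def TT_def)
        then have "(\<Sum>T\<in>TT. u T * cnj (polytabloid (hook n k) t T)) = (\<Sum>T\<in>TT. u T * hook_act n k \<sigma> e T)"
          using \<sigma>(2) by (intro sum.cong HOL.refl) simp
        also have "\<dots> = (\<Sum>T\<in>TT. hook_act n k (inv' \<sigma>) u T * e T)"
          unfolding TT_def by (rule tabloid_act_pairing[OF kn \<sigma>(1)])
        also have "\<dots> = colsum n k (hook_act n k (inv' \<sigma>) u) T0"
          unfolding TT_def e_def T0_def by (rule colsum_pairing[OF kn, symmetric])
        also have "\<dots> = 0" by (rule zero[OF act[OF permutes_inv[OF \<sigma>(1)] u]])
        finally show ?thesis by (simp add: W_def polytabloid_def TT_def)
      qed
      then have "carrier (hook_rep n k) \<subseteq> W" by (rule hook_rep_least[OF sub])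
      then have "(\<Sum>T\<in>TT. u T * cnj (u T)) = 0" using U' u by (auto simp: W_def)
      then have "complex_of_real (\<Sum>T\<in>TT. (cmod (u T))\<^sup>2) = 0"
        by (simp only: of_real_sum complex_norm_square)
      then have "(\<Sum>T\<in>TT. (cmod (u T))\<^sup>2) = 0" by (simp only: of_real_eq_0_iff)
      then have "\<forall>T\<in>TT. (cmod (u T))\<^sup>2 = 0" using fT by (subst (asm) sum_nonneg_eq_0_iff) auto
      then show ?thesis
        unfolding hook_rep_sel TT_def[symmetric] by (intro extensionalityI[OF ext[OF u]]) auto
    qed
    then show "U = {\<zero>\<^bsub>hook_rep n k\<^esub>}" using U unfolding invariant_subspace_iff[OF rep] by blast
  qed
  then show ?thesis using rep nz by (simp add: irreducible_rep_def)
qed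

text \<open>An antisymmetric vector under the permutations of \<open>1, \<dots>, l + 1\<close> exists in the
  module of the hook with leg \<open>l\<close>, but not for shorter legs.\<close>

lemma hook_rep_not_iso:
  assumes kl: "k < l" and ln: "l < n"
  shows "\<not> rep_iso (MD n) (hook_rep n l) (hook_rep n k)"
proof
  assume "rep_iso (MD n) (hook_rep n l) (hook_rep n k)"
  then obtain f where f: "intertwiner (MD n) (hook_rep n l) (hook_rep n k) f"
    and bij: "bij_betw f (carrier (hook_rep n l)) (carrier (hook_rep n k))" by (auto simp: rep_iso_iff)
  have kn: "k < n" using kl ln by simp
  note repl = representation_hook_rep[OF ln] and repk = representation_hook_rep[OF kn]
  define e where "e = polytabloid0 n l"
  have ein: "e \<in> carrier (hook_rep n l)" unfolding e_def by (rule polytabloid_in_hook_rep[OF tab0(1)[OF ln]])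
  have anti: "antisymmetric n l (Suc l) e"
    unfolding e_def polytabloid_tab0(1)[OF ln] by (rule antisymmetric_kdelta[OF ln])
  have fe: "f e \<in> carrier (hook_rep n k)" using f ein unfolding intertwiner_iff by blast
  have "f e (hook_tabloid n xs) = 0" if xs: "xs \<in> hook_seqs n k" for xs
  proof -
    have "card (set xs) = k" using xs by (auto simp: hook_seqs_def distinct_card)
    \<comment> \<open>The \<open>k < l\<close> entries outside the first row leave at least two of
      the \<open>l + 1\<close> numbers in it.\<close>
    then obtain a b where ab: "a \<in> {1..Suc l} - set xs" "b \<in> {1..Suc l} - set xs" "a \<noteq> b"
      using two_missing[of "{1..Suc l}" "set xs"] kl by auto
    have p: "Transposition.transpose a b permutes {1..Suc l}" using ab by (intro permutes_swap_id) auto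
    have pn: "Transposition.transpose a b permutes {1..n}" using permutes_interval_mono[OF p] ln by simp
    then obtain g where g: "g \<in> carrier (MD n)" "MD_perm n g = Transposition.transpose a b"
      using MD_perm_surj by blast
    have "act (hook_rep n l) g e = (- 1) \<odot>\<^bsub>hook_rep n l\<^esub> e"
      unfolding hook_rep_sel g(2)
    proof (rule extensionalityI[OF tabloid_act_extensional])
      fix T assume "T \<in> hook_tabloids n l"
      then show "hook_act n l (Transposition.transpose a b) e T = (\<lambda>T\<in>hook_tabloids n l. - 1 * e T) T"
        using anti p ab(3) by (simp add: antisymmetric_def sign_swap_id)
    qed simp
    then have "act (hook_rep n k) g (f e) = (- 1) \<odot>\<^bsub>hook_rep n k\<^esub> f e"
      using f ein g(1) unfolding intertwiner_iff by metis
    then have "hook_act n k (Transposition.transpose a b) (f e) (hook_tabloid n xs) = - f e (hook_tabloid n xs)"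
      using xs kn by (simp add: hook_rep_sel g(2) tabloids_hook)
    then show ?thesis
      by (intro antisymmetric_zero[OF kn xs, of a b]) (use ab ln in auto)
  qed
  then have "f e = \<zero>\<^bsub>hook_rep n k\<^esub>"
    unfolding hook_rep_sel using hook_rep_extensional[OF kn] fe
    by (intro extensional_hook_eqI[OF kn]) (auto simp: tabloids_hook kn)
  then have "f e = f \<zero>\<^bsub>hook_rep n l\<^esub>" using intertwiner_zero[OF repl repk f] by simp
  then have "e = \<zero>\<^bsub>hook_rep n l\<^esub>"
    using bij_betw_imp_inj_on[OF bij] ein representation_closed(1)[OF repl] by (simp add: inj_on_eq_iff)
  moreover have "e (hook_tabloid n [2..<l + 2]) = 1" unfolding e_def by (rule polytabloid_tab0(2)[OF ln])
  moreover have "hook_tabloid n [2..<l + 2] \<in> hook_tabloids n l"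
    using tab0(3)[OF ln] by (simp add: tabloids_hook[OF ln] del: upt_Suc)
  ultimately show False by (simp add: hook_rep_sel del: upt_Suc)
qed

theorem hook_rep_iso_imp_eq:
  assumes "k < n" "l < n" "rep_iso (MD n) (hook_rep n k) (hook_rep n l)"
  shows "k = l"
  using hook_rep_not_iso[of k l n] hook_rep_not_iso[of l k n] assms
    rep_iso_sym[OF representation_hook_rep[OF assms(1)] assms(3)]
  by (metis linorder_neqE_nat)


section \<open>Dimension\<close>

text \<open>If \<open>1\<close> lies in \<open>A\<close>, evaluate \<open>bd n (bd n f) = 0\<close>
  at \<open>A - {1}\<close>: every term but the one adding \<open>1\<close> concerns a set without
  \<open>1\<close>. So a contraction is determined by its coefficients at subsets of
  \<open>{2..n}\<close>.\<close>

lemma bd_eq_zero: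
  assumes A: "A \<subseteq> {1..n}" and zero: "\<And>B. B \<subseteq> {2..n} \<Longrightarrow> card B = card A \<Longrightarrow> bd n f B = 0"
  shows "bd n f A = 0"
proof (cases "1 \<in> A")
  case False
  then have "x \<noteq> 1" if "x \<in> A" for x using that by blast
  then have "A \<subseteq> {2..n}" using A by force
  then show ?thesis using zero by blast
next
  case True
  have fin: "finite A" using A by (rule finite_subset) simp
  define C where "C = A - {1}"
  have C: "C \<subseteq> {1..n}" "insert 1 C = A" "1 \<notin> C" "finite C" "card A = Suc (card C)"
    using A True fin card.insert_remove[of A 1] by (auto simp: C_def insert_absorb)
  have "(0::complex) = bd n (bd n f) C" using bd_bd[OF C(1)] by simp
  also have "\<dots> = (\<Sum>b\<in>{1}. eps b C * bd n f (insert b C))"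
    unfolding bd_def[of n "bd n f"]
  proof (rule sum.mono_neutral_right)
    show "\<forall>b\<in>{1..n} - C - {1}. eps b C * bd n f (insert b C) = 0"
    proof
      fix b assume b: "b \<in> {1..n} - C - {1}"
      have "x \<noteq> 1" if "x \<in> insert b C" for x using that b C(3) by blast
      then have "insert b C \<subseteq> {2..n}" using b C(1) by force
      moreover have "card (insert b C) = card A" using b C by simp
      ultimately show "eps b C * bd n f (insert b C) = 0" using zero by simp
    qed
    show "{1} \<subseteq> {1..n} - C" using C(3) A True by auto
  qed simp
  finally show ?thesis using C(2) by simp
qed

text \<open>The coefficients of a contraction at the \<open>k\<close>-subsets of
  \<open>{2..n}\<close> are coordinates: they determine it by \<open>bd_eq_zero\<close>, and they
  can be prescribed freely.\<close>

theorem dim_hook_rep: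
  assumes kn: "k < n"
  shows "vectorspace.dim class_ring (hook_rep n k) = (n - 1) choose k"
proof -
  note rep = representation_hook_rep[OF kn]
  define \<A> where "\<A> = {A. A \<subseteq> {2..n} \<and> card A = k}"
  define m where "m = card \<A>"
  have m: "m = (n - 1) choose k" unfolding m_def \<A>_def by (subst n_subsets) auto
  have "finite \<A>" unfolding \<A>_def by simp
  then obtain en where en: "bij_betw en {0..<m} \<A>" unfolding m_def using ex_bij_betw_nat_finite by blast
  define ix where "ix = inv_into {0..<m} en"
  have ix: "ix A < m" "en (ix A) = A" if "A \<in> \<A>" for A
    using that bij_betw_inv_into_right[OF en that] bij_betwE[OF bij_betw_inv_into[OF en]] by (auto simp: ix_def)
  have en': "en j \<in> \<A>" "ix (en j) = j" if "j < m" for j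
    using that bij_betwE[OF en] bij_betw_inv_into_left[OF en] by (auto simp: ix_def)
  \<comment> \<open>The value prescribed at \<open>A\<close> is placed at the union of
    \<open>A\<close> and \<open>{1}\<close>. Contracting at a set without \<open>1\<close> then has
    a single nonzero term, with sign one.\<close>
  define F :: "complex vec \<Rightarrow> nat set \<Rightarrow> complex" where
    "F v B = (if 1 \<in> B \<and> B - {1} \<in> \<A> then v $ ix (B - {1}) else 0)" for v B
  have sub: "A \<subseteq> {1..n}" "card A = k" "1 \<notin> A" "eps 1 A = 1" if "A \<in> \<A>" for A
  proof -
    show "A \<subseteq> {1..n}" "card A = k" "1 \<notin> A" using that by (auto simp: \<A>_def)
    have "{a \<in> A. a < 1} = {}" using that by (auto simp: \<A>_def)
    then show "eps 1 A = 1" unfolding eps_def by (simp only: card.empty power_0)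
  qed
  have val: "bd n (F v) A = v $ ix A" if A: "A \<in> \<A>" for v A
  proof -
    have "bd n (F v) A = (\<Sum>b\<in>{1}. eps b A * F v (insert b A))"
      unfolding bd_def using sub(3)[OF A] kn by (intro sum.mono_neutral_right) (auto simp: F_def)
    then show ?thesis using sub[OF A] A by (simp add: F_def)
  qed
  define L where "L v = alt n k (bd n (F v))" for v
  define Vm where "Vm = module_vec TYPE(complex) m"
  have Vm: "carrier Vm = carrier_vec m" "add Vm = (+)" "smult Vm = (\<cdot>\<^sub>v)"
    by (simp_all add: Vm_def module_vec_simps)
  have vs: "vectorspace class_ring Vm" "vectorspace class_ring (hook_rep n k)"
    using rep by (simp_all add: Vm_def vec_vs representation_def)
  have "F (v + w) = (\<lambda>A. F v A + F w A)" if "v \<in> carrier_vec m" "w \<in> carrier_vec m" for v w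
    using that ix(1) by (auto simp: F_def fun_eq_iff)
  then have "L (v + w) = L v \<oplus>\<^bsub>hook_rep n k\<^esub> L w" if "v \<in> carrier_vec m" "w \<in> carrier_vec m" for v w
    using that by (simp add: L_def hook_rep_sel(3) alt_add bd_add_fun)
  moreover have "F (c \<cdot>\<^sub>v v) = (\<lambda>A. c * F v A)" if "v \<in> carrier_vec m" for v c
    using that ix(1) by (auto simp: F_def fun_eq_iff)
  then have "L (c \<cdot>\<^sub>v v) = c \<odot>\<^bsub>hook_rep n k\<^esub> L v" if "v \<in> carrier_vec m" for v c
    using that by (simp add: L_def hook_rep_sel(4) alt_smult bd_smult_fun)
  moreover have "L v \<in> carrier (hook_rep n k)" for v by (simp add: carrier_hook_rep[OF kn] L_def)
  ultimately have "L \<in> module_hom class_ring Vm (hook_rep n k)" by (auto simp: module_hom_def Vm)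
  then have lin: "linear_map class_ring Vm (hook_rep n k) L"
    using vs by (intro linear_map.intro mod_hom.intro mod_hom_axioms.intro) (auto simp: vectorspace_def)
  have inj: "inj_on L (carrier Vm)"
  proof (rule inj_onI)
    fix v w assume v: "v \<in> carrier Vm" and w: "w \<in> carrier Vm" and eq: "L v = L w"
    have "v $ j = w $ j" if "j < m" for j
    proof -
      have "bd n (F v) (en j) = bd n (F w) (en j)"
        using eq sub[OF en'(1)[OF that]] unfolding L_def alt_eq_iff[OF kn] by blast
      then show ?thesis using val[OF en'(1)[OF that]] en'(2)[OF that] by simp
    qed
    then show "v = w" using v w by (intro eq_vecI) (auto simp: Vm)
  qed
  have surj: "L ` carrier Vm = carrier (hook_rep n k)"
  proof
    show "L ` carrier Vm \<subseteq> carrier (hook_rep n k)" by (auto simp: carrier_hook_rep[OF kn] L_def)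
    show "carrier (hook_rep n k) \<subseteq> L ` carrier Vm"
    proof
      fix x assume "x \<in> carrier (hook_rep n k)"
      then obtain f where f: "x = alt n k (bd n f)" by (auto simp: carrier_hook_rep[OF kn])
      define v where "v = vec m (\<lambda>j. bd n f (en j))"
      define g where "g A = F v A + (- 1) * f A" for A
      have g: "bd n g A = bd n (F v) A - bd n f A" for A
        using bd_add[of n "F v" "\<lambda>A. (- 1) * f A" A] bd_smult[of n "- 1" f A] by (simp add: g_def[abs_def])
      have "bd n (F v) A = bd n f A" if A: "A \<subseteq> {1..n}" "card A = k" for A
      proof -
        have "bd n g A = 0"
        proof (rule bd_eq_zero[OF A(1)])
          fix B assume "B \<subseteq> {2..n}" "card B = card A"
          then have "B \<in> \<A>" using A by (simp add: \<A>_def)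
          then show "bd n g B = 0" using ix by (simp add: g val v_def)
        qed
        then show ?thesis by (simp add: g)
      qed
      then have "x = L v" unfolding f L_def alt_eq_iff[OF kn] by simp
      then show "x \<in> L ` carrier Vm" by (auto simp: Vm v_def)
    qed
  qed
  have "vectorspace.fin_dim class_ring Vm" unfolding Vm_def by (rule vec_space.fin_dim)
  then have "vectorspace.dim class_ring Vm = vectorspace.dim class_ring (hook_rep n k)"
    by (rule linear_map.dim_eq[OF lin _ inj surj])
  then show ?thesis using vec_space.dim_is_n[of m, where 'a = complex] by (simp add: Vm_def m)
qed

section \<open>Coordinates on the tensor power\<close>

text \<open>The elementary tensor with second basis vector exactly at the positions in \<open>A\<close> has the
  index \<open>tensor_index n A\<close> in the lexicographic order.\<close>

definition tensor_index :: "nat \<Rightarrow> nat set \<Rightarrow> nat" where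
  "tensor_index n A = (\<Sum>i\<in>A. 2 ^ (n - i))"

definition coord :: "nat \<Rightarrow> complex vec \<Rightarrow> nat set \<Rightarrow> complex" where
  "coord n v A = v $ tensor_index n A"

lemma set_encode_less:
  assumes "S \<subseteq> {..<m}"
  shows "set_encode S < 2 ^ m"
proof -
  have "set_encode S \<le> set_encode {..<m}"
    unfolding set_encode_def using assms by (intro sum_mono2) auto
  also have "set_encode {..<m} = 2 ^ m - 1"
    unfolding set_encode_def by (induction m) auto
  finally show ?thesis by (simp add: le_less_trans[of _ "2 ^ m - 1"])
qed

text \<open>The first tensor factor is the most significant binary digit, so positions are reversed
  before the binary encoding of sets applies.\<close>

lemma tensor_index_encode:
  assumes "A \<subseteq> {1..n}"
  shows "tensor_index n A = set_encode ((\<lambda>i. n - i) ` A)"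
proof -
  have "inj_on (\<lambda>i. n - i) {1..n}" by (auto simp: inj_on_def)
  then have "inj_on (\<lambda>i. n - i) A" using assms by (rule inj_on_subset)
  then show ?thesis by (simp add: tensor_index_def set_encode_def sum.reindex)
qed

lemma tensor_index_less:
  assumes "A \<subseteq> {a + 1..n}"
  shows "tensor_index n A < 2 ^ (n - a)"
proof -
  have A: "a + 1 \<le> i \<and> i \<le> n" if "i \<in> A" for i using subsetD[OF assms that] by simp
  then have "A \<subseteq> {1..n}" "(\<lambda>i. n - i) ` A \<subseteq> {..<n - a}" by force+
  then show ?thesis using tensor_index_encode set_encode_less by metis
qed

lemma bij_tensor_index: "bij_betw (tensor_index n) (Pow {1..n}) {..<2 ^ n}"
proof -
  have inj: "inj_on (tensor_index n) (Pow {1..n})"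
  proof (rule inj_onI)
    fix A B assume AB: "A \<in> Pow {1..n}" "B \<in> Pow {1..n}" and eq: "tensor_index n A = tensor_index n B"
    have fin: "finite A" "finite B" using AB finite_subset[of _ "{1..n}"] by auto
    have i: "inj_on (\<lambda>i. n - i) {1..n}" by (auto simp: inj_on_def)
    have "set_encode ((\<lambda>i. n - i) ` A) = set_encode ((\<lambda>i. n - i) ` B)"
      using AB eq by (simp add: tensor_index_encode)
    then have "(\<lambda>i. n - i) ` A = (\<lambda>i. n - i) ` B" using fin by (simp add: set_encode_eq)
    then show "A = B" using inj_on_image_eq_iff[OF i] AB by auto
  qed
  have sub: "tensor_index n ` Pow {1..n} \<subseteq> {..<2 ^ n}"
    using tensor_index_less[of _ 0 n] by auto
  have "card (tensor_index n ` Pow {1..n}) = 2 ^ n"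
    using inj by (simp add: card_image card_Pow)
  then have "tensor_index n ` Pow {1..n} = {..<2 ^ n}"
    using sub by (intro card_subset_eq) auto
  then show ?thesis using inj by (simp add: bij_betw_def)
qed

definition of_coord :: "nat \<Rightarrow> (nat set \<Rightarrow> complex) \<Rightarrow> complex vec" where
  "of_coord n f = vec (2 ^ n) (\<lambda>r. f (inv_into (Pow {1..n}) (tensor_index n) r))"

lemma coord_of_coord:
  assumes "A \<subseteq> {1..n}"
  shows "coord n (of_coord n f) A = f A"
proof -
  have "inv_into (Pow {1..n}) (tensor_index n) (tensor_index n A) = A"
    using assms by (intro bij_betw_inv_into_left[OF bij_tensor_index]) auto
  moreover have "tensor_index n A < 2 ^ n" using bij_betwE[OF bij_tensor_index] assms by auto
  ultimately show ?thesis by (simp add: coord_def of_coord_def)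
qed

lemma of_coord_carrier [simp]: "of_coord n f \<in> carrier_vec (2 ^ n)"
  by (simp add: of_coord_def)

lemma coord_eqI:
  assumes "v \<in> carrier_vec (2 ^ n)" "w \<in> carrier_vec (2 ^ n)"
    and "\<And>A. A \<subseteq> {1..n} \<Longrightarrow> coord n v A = coord n w A"
  shows "v = w"
proof (rule eq_vecI)
  fix r assume "r < dim_vec w"
  then have "r \<in> tensor_index n ` Pow {1..n}"
    using assms(2) bij_betw_imp_surj_on[OF bij_tensor_index[of n]] by simp
  then show "v $ r = w $ r" using assms(3) by (auto simp: coord_def)
qed (use assms in auto)

lemma coord_add:
  assumes "v \<in> carrier_vec (2 ^ n)" "w \<in> carrier_vec (2 ^ n)" "A \<subseteq> {1..n}"
  shows "coord n (v + w) A = coord n v A + coord n w A"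
  using assms tensor_index_less[of A 0 n] by (simp add: coord_def)

lemma coord_smult:
  assumes "v \<in> carrier_vec (2 ^ n)" "A \<subseteq> {1..n}"
  shows "coord n (c \<cdot>\<^sub>v v) A = c * coord n v A"
  using assms tensor_index_less[of A 0 n] by (simp add: coord_def)

lemma coord_zero: "A \<subseteq> {1..n} \<Longrightarrow> coord n (0\<^sub>v (2 ^ n)) A = 0"
  using tensor_index_less[of A 0 n] by (simp add: coord_def)

text \<open>The index is split into the digits \<open>hi\<close> before position \<open>i\<close>,
  the two digits \<open>b\<close> at \<open>i\<close> and \<open>i + 1\<close>, and the digits
  \<open>lo\<close> after them. The two identity factors collapse the sums over \<open>hi\<close>
  and \<open>lo\<close>.\<close>

lemma local_op_mult_vec:
  assumes X: "X \<in> carrier_mat 4 4" and i: "1 \<le> i" "i < n" and v: "v \<in> carrier_vec (2 ^ n)"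
    and r: "hi < 2 ^ (i - 1)" "b < 4" "lo < 2 ^ (n - i - 1)"
  defines "m \<equiv> 2 ^ (n - i - 1)"
  shows "(local_op n i X *\<^sub>v v) $ (hi * (4 * m) + b * m + lo) =
    (\<Sum>b'<4. X $$ (b, b') * v $ (hi * (4 * m) + b' * m + lo))"
proof -
  define a :: nat where "a = 2 ^ (i - 1)"
  have n: "(2::nat) ^ n = a * 4 * m"
  proof -
    have "n = (i - 1) + 2 + (n - i - 1)" using i by simp
    then have "(2::nat) ^ n = 2 ^ ((i - 1) + 2 + (n - i - 1))" by simp
    also have "\<dots> = a * 4 * m" unfolding power_add a_def m_def by simp
    finally show ?thesis .
  qed
  have m0: "0 < m" by (simp add: m_def)
  define K where "K = kron (1\<^sub>m a) X"
  have K: "K \<in> carrier_mat (a * 4) (a * 4)" unfolding K_def by (rule kron_carrier[OF one_carrier_mat X])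
  have L: "local_op n i X = kron K (1\<^sub>m m)" by (simp add: local_op_def kron_pow_one K_def a_def m_def)
  have Lc: "local_op n i X \<in> carrier_mat (2 ^ n) (2 ^ n)"
    unfolding L n by (rule kron_carrier[OF K one_carrier_mat])
  define r where "r = hi * (4 * m) + b * m + lo"
  have r_eq: "r = (hi * 4 + b) * m + lo" by (simp add: r_def algebra_simps)
  have hb: "hi * 4 + b < a * 4" using r(1,2) by (simp add: a_def)
  have rd: "r div m = hi * 4 + b" "r mod m = lo" using r(3) by (simp_all add: r_eq m_def)
  have rl: "r < 2 ^ n"
  proof -
    have "r < (hi * 4 + b + 1) * m" using r(3) by (simp add: r_eq m_def)
    also have "\<dots> \<le> a * 4 * m" using hb by (intro mult_right_mono) auto
    finally show ?thesis by (simp add: n)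
  qed
  have entry: "local_op n i X $$ (r, c) = K $$ (hi * 4 + b, c div m) * (if lo = c mod m then 1 else 0)" if "c < a * 4 * m" for c
  proof -
    have "local_op n i X $$ (r, c) = K $$ (r div m, c div m) * 1\<^sub>m m $$ (r mod m, c mod m)"
      unfolding L using that rl K by (subst index_kron) (auto simp: n)
    moreover have "lo < m" "c mod m < m" using m0 r(3) by (simp_all add: m_def)
    ultimately show ?thesis by (simp add: rd)
  qed
  have "(local_op n i X *\<^sub>v v) $ r = (\<Sum>c<a * 4 * m. local_op n i X $$ (r, c) * v $ c)"
    using Lc rl v by (simp add: scalar_prod_def n atLeast0LessThan)
  also have "\<dots> = (\<Sum>c<a * 4 * m. K $$ (hi * 4 + b, c div m) * (if lo = c mod m then 1 else 0) * v $ (c div m * m + c mod m))"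
    by (intro sum.cong HOL.refl) (simp add: entry)
  also have "\<dots> = (\<Sum>p<a * 4. \<Sum>q<m. K $$ (hi * 4 + b, p) * (if lo = q then 1 else 0) * v $ (p * m + q))"
    by (rule sum_div_mod)
  also have "\<dots> = (\<Sum>p<a * 4. K $$ (hi * 4 + b, p) * v $ (p * m + lo))"
  proof (rule sum.cong[OF HOL.refl])
    fix p
    have "(\<Sum>q<m. K $$ (hi * 4 + b, p) * (if lo = q then 1 else 0) * v $ (p * m + q)) =
        (\<Sum>q<m. if q = lo then K $$ (hi * 4 + b, p) * v $ (p * m + q) else 0)"
      by (rule sum.cong) auto
    then show "(\<Sum>q<m. K $$ (hi * 4 + b, p) * (if lo = q then 1 else 0) * v $ (p * m + q)) = K $$ (hi * 4 + b, p) * v $ (p * m + lo)"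
      using r(3) by (simp add: m_def)
  qed
  also have "\<dots> = (\<Sum>p<a * 4. (if hi = p div 4 then 1 else 0) * X $$ (b, p mod 4) * v $ ((p div 4 * 4 + p mod 4) * m + lo))"
  proof (rule sum.cong[OF HOL.refl])
    fix p assume "p \<in> {..<a * 4}"
    then have p: "p < a * 4" by simp
    have "K $$ (hi * 4 + b, p) = 1\<^sub>m a $$ ((hi * 4 + b) div 4, p div 4) * X $$ ((hi * 4 + b) mod 4, p mod 4)"
      unfolding K_def using X p hb by (subst index_kron) auto
    also have "\<dots> = (if hi = p div 4 then 1 else 0) * X $$ (b, p mod 4)"
      using r(1,2) p by (simp add: a_def less_mult_imp_div_less)
    finally show "K $$ (hi * 4 + b, p) * v $ (p * m + lo) =
        (if hi = p div 4 then 1 else 0) * X $$ (b, p mod 4) * v $ ((p div 4 * 4 + p mod 4) * m + lo)" by simp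
  qed
  also have "\<dots> = (\<Sum>h<a. \<Sum>b'<4. (if hi = h then 1 else 0) * X $$ (b, b') * v $ ((h * 4 + b') * m + lo))"
    by (rule sum_div_mod)
  also have "\<dots> = (\<Sum>h<a. if h = hi then (\<Sum>b'<4. X $$ (b, b') * v $ ((h * 4 + b') * m + lo)) else 0)"
    by (rule sum.cong) auto
  also have "\<dots> = (\<Sum>b'<4. X $$ (b, b') * v $ ((hi * 4 + b') * m + lo))"
    using r(1) by (simp add: a_def)
  finally show ?thesis by (simp add: r_def algebra_simps)
qed

text \<open>A set avoiding \<open>i\<close> and \<open>i + 1\<close> has zeros at these two digits;
  the factor 4 is the room they leave between the high and the low part.\<close>

lemma tensor_index_split:
  assumes C: "C \<subseteq> {1..n}" "i \<notin> C" "Suc i \<notin> C" and i: "1 \<le> i" "i < n"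
  obtains hi lo where "hi < 2 ^ (i - 1)" "lo < 2 ^ (n - i - 1)"
    "tensor_index n C = hi * (4 * 2 ^ (n - i - 1)) + lo"
proof -
  have fin: "finite C" by (rule finite_subset[OF C(1)]) simp
  define lC where "lC = {j \<in> C. j < i}"
  define rC where "rC = {j \<in> C. Suc i < j}"
  have CC: "C = lC \<union> rC" "lC \<inter> rC = {}" using C by (auto simp: lC_def rC_def) (metis Suc_lessI linorder_neqE_nat)
  have "tensor_index (i - 1) lC < 2 ^ (i - 1 - 0)"
    by (rule tensor_index_less) (use C in \<open>auto simp: lC_def\<close>)
  moreover have "tensor_index n rC < 2 ^ (n - Suc i)"
    by (rule tensor_index_less) (use C in \<open>auto simp: rC_def\<close>)
  moreover have "tensor_index n C = tensor_index n lC + tensor_index n rC"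
    unfolding tensor_index_def CC(1) using fin CC(2) by (intro sum.union_disjoint) (auto simp: lC_def rC_def)
  moreover have "tensor_index n lC = tensor_index (i - 1) lC * (4 * 2 ^ (n - i - 1))"
    unfolding tensor_index_def sum_distrib_right
  proof (rule sum.cong[OF HOL.refl])
    fix j assume "j \<in> lC"
    then have e: "n - j = (i - 1 - j) + 2 + (n - i - 1)" using i by (auto simp: lC_def)
    show "(2::nat) ^ (n - j) = 2 ^ (i - 1 - j) * (4 * 2 ^ (n - i - 1))" unfolding e power_add by simp
  qed
  ultimately show ?thesis by (intro that[of "tensor_index (i - 1) lC" "tensor_index n rC"]) auto
qed

text \<open>The membership of \<open>i\<close> and \<open>Suc i\<close> in \<open>A\<close> gives
  the two digits, hence the row of \<open>X\<close>. The swap and the corner entry -1 make up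
  \<open>tau i\<close>; the entry \<open>x\<close> brings in the coefficient of a set with two more
  elements.\<close>

theorem coord_local_op:
  assumes X: "X = mat_of_rows_list 4 [[1, 0, 0, x], [0, 0, 1, 0], [0, 1, 0, 0], [0, 0, 0, -1]]"
    and i: "1 \<le> i" "i < n" and v: "v \<in> carrier_vec (2 ^ n)" and A: "A \<subseteq> {1..n}"
  shows "coord n (local_op n i X *\<^sub>v v) A = tau i (coord n v) A +
     (if i \<notin> A \<and> Suc i \<notin> A then x * coord n v (insert i (insert (Suc i) A)) else 0)"
proof -
  define C where "C = A - {i, Suc i}"
  define m :: nat where "m = 2 ^ (n - i - 1)"
  have C: "C \<subseteq> {1..n}" "i \<notin> C" "Suc i \<notin> C" using A by (auto simp: C_def)
  have fin: "finite C" by (rule finite_subset[OF C(1)]) simp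
  obtain hi lo where hl: "hi < 2 ^ (i - 1)" "lo < 2 ^ (n - i - 1)" "tensor_index n C = hi * (4 * m) + lo"
    using tensor_index_split[OF C i] by (metis m_def)
  have "n - i = Suc (n - i - 1)" using i by simp
  then have p: "2 ^ (n - i) = 2 * m" by (metis m_def power_Suc)
  have ins: "tensor_index n (insert (Suc i) C) = tensor_index n C + m"
    "tensor_index n (insert i C) = tensor_index n C + 2 * m"
    "tensor_index n (insert i (insert (Suc i) C)) = tensor_index n C + 3 * m"
    using fin C p by (simp_all add: tensor_index_def m_def)
  have Xc: "X \<in> carrier_mat 4 4" by (simp add: X mat_of_rows_list_def numeral_eq_Suc)
  note row = local_op_mult_vec[OF Xc i v hl(1) _ hl(2), folded m_def]
  have s4: "(\<Sum>b<4. h b) = h 0 + h 1 + h 2 + h 3" for h :: "nat \<Rightarrow> complex"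
    by (simp add: numeral_eq_Suc)
  have Xv: "X $$ (0, 0) = 1" "X $$ (0, 1) = 0" "X $$ (0, 2) = 0" "X $$ (0, 3) = x"
    "X $$ (1, 0) = 0" "X $$ (1, 1) = 0" "X $$ (1, 2) = 1" "X $$ (1, 3) = 0"
    "X $$ (2, 0) = 0" "X $$ (2, 1) = 1" "X $$ (2, 2) = 0" "X $$ (2, 3) = 0"
    "X $$ (3, 0) = 0" "X $$ (3, 1) = 0" "X $$ (3, 2) = 0" "X $$ (3, 3) = - 1"
    by (simp_all add: X mat_of_rows_list_def)
  note r0 = row[of 0, unfolded s4 Xv] and r1 = row[of 1, unfolded s4 Xv]
    and r2 = row[of 2, unfolded s4 Xv] and r3 = row[of 3, unfolded s4 Xv]
  have c0: "coord n w C = w $ (hi * (4 * m) + 0 * m + lo)" for w by (simp add: coord_def hl(3))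
  have c1: "coord n w (insert (Suc i) C) = w $ (hi * (4 * m) + 1 * m + lo)" for w
    unfolding coord_def ins hl(3) by (simp add: ac_simps)
  have c2: "coord n w (insert i C) = w $ (hi * (4 * m) + 2 * m + lo)" for w
    unfolding coord_def ins hl(3) by (simp add: ac_simps)
  have c3: "coord n w (insert i (insert (Suc i) C)) = w $ (hi * (4 * m) + 3 * m + lo)" for w
    unfolding coord_def ins hl(3) by (simp add: ac_simps)
  have tr: "adj i ` insert i C = insert (Suc i) C" "adj i ` insert (Suc i) C = insert i C"
    "adj i ` insert i (insert (Suc i) C) = insert i (insert (Suc i) C)" "adj i ` C = C"
    using C by (auto simp: adj_fix)
  consider "A = C" | "A = insert (Suc i) C" | "A = insert i C" | "A = insert i (insert (Suc i) C)"
    by (auto simp: C_def)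
  then show ?thesis
  proof cases
    case 1
    then show ?thesis using C r0 unfolding tau_def 1 tr c0 c3 by (simp add: csgn_def)
  next
    case 2
    then show ?thesis using C r1 unfolding tau_def 2 tr c1 c2 by (simp add: csgn_def)
  next
    case 3
    then show ?thesis using C r2 unfolding tau_def 3 tr c1 c2 by (simp add: csgn_def)
  next
    case 4
    then show ?thesis using C r3 unfolding tau_def 4 tr c3 by (simp add: csgn_def)
  qed
qed

section \<open>The composition series\<close>

text \<open>The level of a vector is the largest number of second basis vectors occurring in it.  The
  odd steps of the filtration are given by the level alone; passing from level \<open>j - 1\<close> to level
  \<open>j\<close>, the even step in between consists of the vectors whose top component is annihilated by
  \<open>wd\<close>.\<close>

definition level_filtration :: "nat \<Rightarrow> nat \<Rightarrow> complex vec set" where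
  "level_filtration n m = {v \<in> carrier_vec (2 ^ n).
     (\<forall>A\<subseteq>{1..n}. m div 2 < card A \<longrightarrow> coord n v A = 0) \<and>
     (even m \<longrightarrow> (\<forall>A\<subseteq>{1..n}. card A = Suc (m div 2) \<longrightarrow> wd (coord n v) A = 0))}"

text \<open>Put \<open>j = m div 2\<close>. For even \<open>m\<close> the new vectors have degree
  \<open>j\<close> and count modulo the kernel of \<open>wd\<close>; \<open>bd\<close> brings their
  image under \<open>wd\<close> back to degree \<open>j\<close>. For odd \<open>m\<close> they have
  degree \<open>j + 1\<close> and are killed by \<open>wd\<close>, and \<open>bd\<close> alone is
  injective on these. Either way the target is the contraction image in degree
  \<open>j\<close>.\<close>

definition factor_map :: "nat \<Rightarrow> nat \<Rightarrow> complex vec \<Rightarrow> nat set list \<Rightarrow> complex" where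
  "factor_map n m v = alt n (m div 2) (bd n (if even m then wd (coord n v) else coord n v))"

context
  fixes p q :: complex and R S :: "complex mat" and n :: nat
  assumes S: "S = mat_of_rows_list 4 [[1, 0, 0, p], [0, 0, 1, 0], [0, 1, 0, 0], [0, 0, 0, -1]]"
    and R: "R = mat_of_rows_list 4 [[1, 0, 0, q], [0, 0, 1, 0], [0, 1, 0, 0], [0, 0, 0, -1]]"
    and n: "n \<ge> 1"
begin

lemma rep_V: "representation (MD n) (MD_rep n R S)"
  by (rule representation_MD_rep[OF S R])

lemma MD_rep_sel:
  "carrier (MD_rep n R S) = carrier_vec (2 ^ n)" "\<zero>\<^bsub>MD_rep n R S\<^esub> = 0\<^sub>v (2 ^ n)"
  "v \<oplus>\<^bsub>MD_rep n R S\<^esub> w = v + w" "c \<odot>\<^bsub>MD_rep n R S\<^esub> v = c \<cdot>\<^sub>v v"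
  "act (MD_rep n R S) g v = MD_mat n R S g *\<^sub>v v"
  by (simp_all add: MD_rep_def module_vec_simps)

text \<open>A common form for both kinds of generators, with \<open>x\<close> equal to
  \<open>q\<close> or \<open>p\<close>. Later arguments use only that \<open>x\<close> multiplies
  the coefficient of a larger set.\<close>

lemma act_generator:
  assumes i: "1 \<le> i" "i < n" and g: "g = MD_r n i \<or> g = MD_s n i"
  obtains x where "\<And>v A. v \<in> carrier_vec (2 ^ n) \<Longrightarrow> A \<subseteq> {1..n} \<Longrightarrow>
    coord n (act (MD_rep n R S) g v) A = tau i (coord n v) A +
     (if i \<notin> A \<and> Suc i \<notin> A then x * coord n v (insert i (insert (Suc i) A)) else 0)"
proof -
  from g show ?thesis
  proof
    assume "g = MD_r n i"
    then have "act (MD_rep n R S) g v = local_op n i R *\<^sub>v v" for v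
      using MD_mat_r[OF S R i] by (simp add: MD_rep_sel)
    then show ?thesis using coord_local_op[OF R i] by (intro that) simp
  next
    assume "g = MD_s n i"
    then have "act (MD_rep n R S) g v = local_op n i S *\<^sub>v v" for v
      using MD_mat_s[OF S R i] by (simp add: MD_rep_sel)
    then show ?thesis using coord_local_op[OF S i] by (intro that) simp
  qed
qed

text \<open>The parameters \<open>p\<close> and \<open>q\<close> do not affect the components of top level.\<close>

lemma act_generator_level:
  assumes i: "1 \<le> i" "i < n" and g: "g = MD_r n i \<or> g = MD_s n i"
    and v: "v \<in> carrier_vec (2 ^ n)" and level: "\<And>A. A \<subseteq> {1..n} \<Longrightarrow> j < card A \<Longrightarrow> coord n v A = 0"
    and A: "A \<subseteq> {1..n}" "j \<le> card A"
  shows "coord n (act (MD_rep n R S) g v) A = tau i (coord n v) A"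
proof -
  obtain x where x: "\<And>v A. v \<in> carrier_vec (2 ^ n) \<Longrightarrow> A \<subseteq> {1..n} \<Longrightarrow>
    coord n (act (MD_rep n R S) g v) A = tau i (coord n v) A +
     (if i \<notin> A \<and> Suc i \<notin> A then x * coord n v (insert i (insert (Suc i) A)) else 0)"
    using act_generator[OF i g] by metis
  have fin: "finite A" using A(1) by (rule finite_subset) simp
  have "coord n v (insert i (insert (Suc i) A)) = 0" if "i \<notin> A" "Suc i \<notin> A"
    using that A i fin by (intro level) auto
  then show ?thesis using x[OF v A(1)] by auto
qed

lemma filtrationD:
  assumes "v \<in> level_filtration n m"
  shows "v \<in> carrier_vec (2 ^ n)" "A \<subseteq> {1..n} \<Longrightarrow> m div 2 < card A \<Longrightarrow> coord n v A = 0"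
    and "even m \<Longrightarrow> A \<subseteq> {1..n} \<Longrightarrow> card A = Suc (m div 2) \<Longrightarrow> wd (coord n v) A = 0"
  using assms by (auto simp: level_filtration_def)

lemma tau_zero:
  assumes i: "1 \<le> i" "i < n" and A: "A \<subseteq> {1..n}" and f: "\<And>B. B \<subseteq> {1..n} \<Longrightarrow> card B = card A \<Longrightarrow> f B = 0"
  shows "tau i f A = 0"
  using f[OF adj_image_subset[OF i A]] by (simp add: tau_def)

lemma coord_act_filtration:
  assumes i: "1 \<le> i" "i < n" and g: "g = MD_r n i \<or> g = MD_s n i"
    and v: "v \<in> level_filtration n m" and A: "A \<subseteq> {1..n}" "m div 2 \<le> card A"
  shows "coord n (act (MD_rep n R S) g v) A = tau i (coord n v) A"
  by (rule act_generator_level[OF i g filtrationD(1)[OF v] filtrationD(2)[OF v] A])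

text \<open>On sets of size one above the level, \<open>wd\<close> reads only components of top
  level, where the action is \<open>tau i\<close>.\<close>

lemma wd_act_filtration:
  assumes i: "1 \<le> i" "i < n" and g: "g = MD_r n i \<or> g = MD_s n i"
    and v: "v \<in> level_filtration n m" and A: "A \<subseteq> {1..n}" "card A = Suc (m div 2)"
  shows "wd (coord n (act (MD_rep n R S) g v)) A = tau i (wd (coord n v)) A"
proof -
  have "wd (coord n (act (MD_rep n R S) g v)) A = wd (tau i (coord n v)) A"
    by (rule wd_cong[OF A(1)]) (rule coord_act_filtration[OF i g v], use A(2) in auto)
  also have "finite A" using A(1) by (rule finite_subset) simp
  then have "wd (tau i (coord n v)) A = tau i (wd (coord n v)) A" by (rule wd_tau)
  finally show ?thesis .
qed

lemma invariant_filtration: "invariant_subspace (MD n) (MD_rep n R S) (level_filtration n m)"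
proof (rule invariant_subspace_MD[OF rep_V])
  show "level_filtration n m \<subseteq> carrier (MD_rep n R S)" by (auto simp: level_filtration_def MD_rep_sel)
  have w0: "wd (coord n (0\<^sub>v (2 ^ n))) A = 0" if "A \<subseteq> {1..n}" for A
    unfolding wd_def using that by (intro sum.neutral) (auto simp: coord_zero subset_iff)
  show "\<zero>\<^bsub>MD_rep n R S\<^esub> \<in> level_filtration n m"
    by (simp add: level_filtration_def MD_rep_sel coord_zero w0)
next
  fix v w assume v: "v \<in> level_filtration n m" and w: "w \<in> level_filtration n m"
  note V = filtrationD[OF v] and W = filtrationD[OF w]
  have "wd (coord n (v + w)) A = wd (coord n v) A + wd (coord n w) A" if "A \<subseteq> {1..n}" for A
    unfolding wd_add[symmetric] by (rule wd_cong[OF that]) (simp add: coord_add V(1) W(1))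
  then show "v \<oplus>\<^bsub>MD_rep n R S\<^esub> w \<in> level_filtration n m"
    using V W by (simp add: level_filtration_def MD_rep_sel coord_add)
next
  fix v c assume v: "v \<in> level_filtration n m"
  note V = filtrationD[OF v]
  have "wd (coord n (c \<cdot>\<^sub>v v)) A = c * wd (coord n v) A" if "A \<subseteq> {1..n}" for A
    unfolding wd_smult[symmetric] by (rule wd_cong[OF that]) (simp add: coord_smult V(1))
  then show "c \<odot>\<^bsub>MD_rep n R S\<^esub> v \<in> level_filtration n m"
    using V by (simp add: level_filtration_def MD_rep_sel coord_smult)
next
  have *: "act (MD_rep n R S) g v \<in> level_filtration n m"
    if i: "1 \<le> i" "i < n" and g: "g = MD_r n i \<or> g = MD_s n i" and v: "v \<in> level_filtration n m" for i g v
  proof -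
    note V = filtrationD[OF v]
    have "g \<in> carrier (MD n)" using g MD_gen_closed[OF i] by blast
    then have c: "act (MD_rep n R S) g v \<in> carrier_vec (2 ^ n)"
      using representation_closed(4)[OF rep_V _ V(1)[folded MD_rep_sel(1)]] by (simp only: MD_rep_sel(1))
    have "coord n (act (MD_rep n R S) g v) A = 0" if A: "A \<subseteq> {1..n}" "m div 2 < card A" for A
    proof -
      have "coord n (act (MD_rep n R S) g v) A = tau i (coord n v) A"
        by (rule coord_act_filtration[OF i g v A(1)]) (use A in auto)
      also have "\<dots> = 0" by (rule tau_zero[OF i A(1)]) (rule V(2), use A(2) in auto)
      finally show ?thesis .
    qed
    moreover have "wd (coord n (act (MD_rep n R S) g v)) A = 0"
      if "even m" and A: "A \<subseteq> {1..n}" "card A = Suc (m div 2)" for A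
      unfolding wd_act_filtration[OF i g v A]
      by (rule tau_zero[OF i A(1)]) (rule V(3)[OF \<open>even m\<close>], use A(2) in auto)
    ultimately show ?thesis using c by (simp add: level_filtration_def)
  qed
  fix i v assume "1 \<le> i" "i < n" "v \<in> level_filtration n m"
  then show "act (MD_rep n R S) (MD_r n i) v \<in> level_filtration n m"
    "act (MD_rep n R S) (MD_s n i) v \<in> level_filtration n m"
    using *[of i "MD_r n i" v] *[of i "MD_s n i" v] by auto
qed

lemma filtration_mono: "level_filtration n m \<subseteq> level_filtration n (Suc m)"
proof
  fix v assume v: "v \<in> level_filtration n m"
  note V = filtrationD[OF v]
  show "v \<in> level_filtration n (Suc m)"
  proof (cases "even m")
    case True
    then have "Suc m div 2 = m div 2" by presburger
    then show ?thesis using V True by (simp add: level_filtration_def)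
  next
    case False
    then have e: "Suc m div 2 = Suc (m div 2)" by presburger
    \<comment> \<open>From odd \<open>m\<close> to \<open>Suc m\<close> the level rises by one. The
      new condition on \<open>wd\<close> reads components one above the old level, and these
      vanish.\<close>
    have "wd (coord n v) A = 0" if A: "A \<subseteq> {1..n}" "card A = Suc (Suc (m div 2))" for A
    proof -
      have "wd (coord n v) A = wd (\<lambda>_. 0) A" by (rule wd_cong[OF A(1)]) (rule V(2), use A in auto)
      then show ?thesis by (simp add: wd_def)
    qed
    then show ?thesis using V e by (auto simp: level_filtration_def)
  qed
qed

lemma filtration_0: "level_filtration n 0 = {\<zero>\<^bsub>MD_rep n R S\<^esub>}"
proof
  show "level_filtration n 0 \<subseteq> {\<zero>\<^bsub>MD_rep n R S\<^esub>}"
  proof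
    fix v assume v: "v \<in> level_filtration n 0"
    note V = filtrationD[OF v]
    \<comment> \<open>At level zero only the coefficient of the empty set is left, and the condition
      on \<open>wd\<close> at a singleton removes it.\<close>
    have "wd (coord n v) {1} = 0" using V(3)[of "{1}"] n by simp
    then have e: "coord n v {} = 0" by (simp add: wd_def)
    have "v = 0\<^sub>v (2 ^ n)"
    proof (rule coord_eqI)
      fix A assume A: "A \<subseteq> {1..n}"
      then have "finite A" by (rule finite_subset) simp
      then show "coord n v A = coord n (0\<^sub>v (2 ^ n)) A"
        using e V(2)[OF A] coord_zero[OF A] by (cases "A = {}") (auto simp: card_gt_0_iff)
    qed (use V in auto)
    then show "v \<in> {\<zero>\<^bsub>MD_rep n R S\<^esub>}" by (simp add: MD_rep_sel)
  qed
  show "{\<zero>\<^bsub>MD_rep n R S\<^esub>} \<subseteq> level_filtration n 0"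
    using invariant_filtration[of 0] by (simp add: invariant_subspace_iff[OF rep_V])
qed

lemma card_le_n: "A \<subseteq> {1..n} \<Longrightarrow> card A \<le> n"
  using card_mono[of "{1..n}" A] by simp

text \<open>At level \<open>n\<close> both conditions concern sets with more than \<open>n\<close>
  elements and are void.\<close>

lemma filtration_top: "level_filtration n (2 * n) = carrier (MD_rep n R S)"
proof -
  have "\<not> 2 * n div 2 < card A" "card A \<noteq> Suc (2 * n div 2)" if "A \<subseteq> {1..n}" for A
    using card_le_n[OF that] by simp_all
  then show ?thesis unfolding level_filtration_def MD_rep_sel by blast
qed

section \<open>The factors of the filtration as hook representations\<close>

lemma factor_map_linear:
  assumes m: "m < 2 * n"
  shows "factor_map n m v \<in> carrier (hook_rep n (m div 2))"
    and "v \<in> carrier_vec (2 ^ n) \<Longrightarrow> w \<in> carrier_vec (2 ^ n) \<Longrightarrow>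
      factor_map n m (v + w) = factor_map n m v \<oplus>\<^bsub>hook_rep n (m div 2)\<^esub> factor_map n m w"
    and "v \<in> carrier_vec (2 ^ n) \<Longrightarrow>
      factor_map n m (c \<cdot>\<^sub>v v) = c \<odot>\<^bsub>hook_rep n (m div 2)\<^esub> factor_map n m v"
proof -
  have k: "m div 2 < n" using m by simp
  show "factor_map n m v \<in> carrier (hook_rep n (m div 2))"
    unfolding carrier_hook_rep[OF k] factor_map_def by blast
  define D where "D f = (if even m then wd f else f)" for f
  have D: "factor_map n m u = alt n (m div 2) (bd n (D (coord n u)))" for u
    by (simp add: factor_map_def D_def)
  have cong: "D f A = D g A" if "A \<subseteq> {1..n}" "\<And>B. B \<subseteq> {1..n} \<Longrightarrow> f B = g B" for f g A
    using wd_cong[OF that(1), of f g] that by (simp add: D_def)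
  show "factor_map n m (v + w) = factor_map n m v \<oplus>\<^bsub>hook_rep n (m div 2)\<^esub> factor_map n m w"
    if vw: "v \<in> carrier_vec (2 ^ n)" "w \<in> carrier_vec (2 ^ n)"
  proof -
    have "D (coord n (v + w)) B = D (coord n v) B + D (coord n w) B" if "B \<subseteq> {1..n}" for B
      using cong[OF that, of "coord n (v + w)" "\<lambda>A. coord n v A + coord n w A"] vw
      by (simp add: coord_add) (simp add: D_def wd_add)
    then show ?thesis
      unfolding D hook_rep_sel alt_add bd_add_fun[symmetric] alt_eq_iff[OF k] by (intro allI impI bd_cong)
  qed
  show "factor_map n m (c \<cdot>\<^sub>v v) = c \<odot>\<^bsub>hook_rep n (m div 2)\<^esub> factor_map n m v"
    if v: "v \<in> carrier_vec (2 ^ n)"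
  proof -
    have "D (coord n (c \<cdot>\<^sub>v v)) B = c * D (coord n v) B" if "B \<subseteq> {1..n}" for B
      using cong[OF that, of "coord n (c \<cdot>\<^sub>v v)" "\<lambda>A. c * coord n v A"] v
      by (simp add: coord_smult) (simp add: D_def wd_smult)
    then show ?thesis
      unfolding D hook_rep_sel alt_smult bd_smult_fun[symmetric] alt_eq_iff[OF k] by (intro allI impI bd_cong)
  qed
qed

text \<open>The outer contraction reads only sets of size \<open>j + 1\<close>. There the data of a
  vector in step \<open>Suc m\<close> depend on its top level alone, where \<open>r_i\<close> and
  \<open>s_i\<close> both act as \<open>tau i\<close>.\<close>

lemma factor_map_act:
  assumes m: "m < 2 * n" and i: "1 \<le> i" "i < n" and g: "g = MD_r n i \<or> g = MD_s n i"
    and v: "v \<in> level_filtration n (Suc m)"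
  shows "factor_map n m (act (MD_rep n R S) g v) = act (hook_rep n (m div 2)) g (factor_map n m v)"
proof -
  define j where "j = m div 2"
  have k: "j < n" using m by (simp add: j_def)
  define D where "D f = (if even m then wd f else f)" for f
  have D: "factor_map n m u = alt n j (bd n (D (coord n u)))" for u
    by (simp add: factor_map_def D_def j_def)
  have "MD_perm n g = adj i" using g MD_perm_r[OF i] MD_perm_s[OF i] by auto
  then have "act (hook_rep n j) g (factor_map n m v) = alt n j (bd n (tau i (D (coord n v))))"
    unfolding D hook_rep_sel by (simp add: alt_bd_tau[OF k i])
  moreover have "D (coord n (act (MD_rep n R S) g v)) B = tau i (D (coord n v)) B"
    if B: "B \<subseteq> {1..n}" "card B = Suc j" for B
  proof (cases "even m")
    case True
    then have "Suc m div 2 = j" unfolding j_def by presburger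
    then show ?thesis using wd_act_filtration[OF i g v B(1)] B True by (simp add: D_def)
  next
    case False
    then have "Suc m div 2 = Suc j" unfolding j_def by presburger
    then show ?thesis using coord_act_filtration[OF i g v B(1)] B False by (simp add: D_def)
  qed
  then have "factor_map n m (act (MD_rep n R S) g v) = alt n j (bd n (tau i (D (coord n v))))"
    unfolding D alt_eq_iff[OF k] by (intro allI impI bd_cong) auto
  ultimately show ?thesis by (simp add: j_def)
qed

text \<open>The preimage of the contraction of \<open>f\<close> is \<open>bd n f\<close> divided by
  \<open>n\<close> for even \<open>m\<close>, and \<open>wd (bd n f)\<close> divided by
  \<open>n\<close> for odd \<open>m\<close>; \<open>bd_wd_bd\<close> verifies both. In the odd case
  \<open>wd_wd\<close> puts it into the smaller, even step.\<close>

lemma factor_map_surj: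
  assumes m: "m < 2 * n" and x: "x \<in> carrier (hook_rep n (m div 2))"
  shows "\<exists>v\<in>level_filtration n (Suc m). factor_map n m v = x"
proof -
  define j where "j = m div 2"
  have k: "j < n" using m by (simp add: j_def)
  obtain f where f: "x = alt n j (bd n f)" using x unfolding j_def[symmetric] carrier_hook_rep[OF k] by blast
  have n0: "(of_nat n :: complex) \<noteq> 0" using n by simp
  show ?thesis
  proof (cases "even m")
    case True
    then have e: "Suc m div 2 = j" "odd (Suc m)" unfolding j_def by presburger+
    define h where "h A = (if card A = j then inverse (of_nat n) * bd n f A else 0)" for A
    define v where "v = of_coord n h"
    have c: "coord n v A = h A" if "A \<subseteq> {1..n}" for A unfolding v_def by (rule coord_of_coord[OF that])
    have "v \<in> level_filtration n (Suc m)"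
      using e by (auto simp: level_filtration_def c v_def[symmetric]) (auto simp: v_def h_def coord_of_coord)
    moreover have "bd n (wd (coord n v)) A = bd n f A" if A: "A \<subseteq> {1..n}" "card A = j" for A
    proof -
      have "bd n (wd (coord n v)) A = bd n (\<lambda>B. inverse (of_nat n) * wd (bd n f) B) A"
      proof (rule bd_cong[OF A(1)])
        fix B assume B: "B \<subseteq> {1..n}" "card B = Suc (card A)"
        show "wd (coord n v) B = inverse (of_nat n) * wd (bd n f) B"
          unfolding wd_smult[symmetric] by (rule wd_cong[OF B(1)]) (use B A c in \<open>auto simp: h_def\<close>)
      qed
      also have "\<dots> = bd n f A" using n0 by (simp add: bd_smult bd_wd_bd[OF A(1)])
      finally show ?thesis .
    qed
    then have "factor_map n m v = x" using True unfolding f factor_map_def j_def[symmetric] by (simp add: alt_eq_iff[OF k])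
    ultimately show ?thesis by blast
  next
    case False
    then have e: "Suc m div 2 = Suc j" "even (Suc m)" unfolding j_def by presburger+
    define h where "h A = (if card A = Suc j then inverse (of_nat n) * wd (bd n f) A else 0)" for A
    define v where "v = of_coord n h"
    have c: "coord n v A = h A" if "A \<subseteq> {1..n}" for A unfolding v_def by (rule coord_of_coord[OF that])
    have "wd (coord n v) A = 0" if A: "A \<subseteq> {1..n}" "card A = Suc (Suc j)" for A
    proof -
      have "wd (coord n v) A = wd (\<lambda>B. inverse (of_nat n) * wd (bd n f) B) A"
        by (rule wd_cong[OF A(1)]) (use A c in \<open>auto simp: h_def\<close>)
      also have "\<dots> = 0" using A(1) finite_subset[OF A(1)] by (simp add: wd_smult wd_wd)
      finally show ?thesis .
    qed
    then have "v \<in> level_filtration n (Suc m)"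
      using e by (auto simp: level_filtration_def) (auto simp: v_def h_def coord_of_coord)
    moreover have "bd n (coord n v) A = bd n f A" if A: "A \<subseteq> {1..n}" "card A = j" for A
    proof -
      have "bd n (coord n v) A = bd n (\<lambda>B. inverse (of_nat n) * wd (bd n f) B) A"
        by (rule bd_cong[OF A(1)]) (use A c in \<open>auto simp: h_def\<close>)
      also have "\<dots> = bd n f A" using n0 by (simp add: bd_smult bd_wd_bd[OF A(1)])
      finally show ?thesis .
    qed
    then have "factor_map n m v = x" using False unfolding f factor_map_def j_def[symmetric] by (simp add: alt_eq_iff[OF k])
    ultimately show ?thesis by blast
  qed
qed

text \<open>For even \<open>m\<close>, \<open>wd_bd_wd\<close> shows that \<open>bd\<close> loses
  nothing on images of \<open>wd\<close>. For odd \<open>m\<close> the top component is already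
  killed by \<open>wd\<close>; if \<open>bd\<close> kills it too, the homotopy gives
  \<open>n\<close> times it as zero.\<close>

lemma factor_map_kernel:
  assumes m: "m < 2 * n" and v: "v \<in> level_filtration n (Suc m)"
  shows "factor_map n m v = \<zero>\<^bsub>hook_rep n (m div 2)\<^esub> \<longleftrightarrow> v \<in> level_filtration n m"
proof -
  define j where "j = m div 2"
  have k: "j < n" using m by (simp add: j_def)
  have n0: "(of_nat n :: complex) \<noteq> 0" using n by simp
  note V = filtrationD[OF v]
  have z: "\<zero>\<^bsub>hook_rep n j\<^esub> = alt n j (\<lambda>_. 0)" by (auto simp: hook_rep_sel alt_def fun_eq_iff)
  define f where "f = coord n v"
  show ?thesis
  proof (cases "even m")
    case True
    then have e: "Suc m div 2 = j" unfolding j_def by presburger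
    have "factor_map n m v = \<zero>\<^bsub>hook_rep n j\<^esub> \<longleftrightarrow> (\<forall>A\<subseteq>{1..n}. card A = j \<longrightarrow> bd n (wd f) A = 0)"
      unfolding z factor_map_def j_def[symmetric] using True by (simp add: alt_eq_iff[OF k] f_def)
    also have "\<dots> \<longleftrightarrow> (\<forall>A\<subseteq>{1..n}. card A = Suc j \<longrightarrow> wd f A = 0)"
    proof (intro iffI allI impI)
      fix A assume 0: "\<forall>A\<subseteq>{1..n}. card A = j \<longrightarrow> bd n (wd f) A = 0" and A: "A \<subseteq> {1..n}" "card A = Suc j"
      have "wd (bd n (wd f)) A = wd (\<lambda>_. 0) A" by (rule wd_cong[OF A(1)]) (use 0 A in auto)
      then have "of_nat n * wd f A = 0" unfolding wd_bd_wd[OF A(1)] by (simp add: wd_def)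
      then show "wd f A = 0" using n0 by simp
    next
      fix A assume 0: "\<forall>A\<subseteq>{1..n}. card A = Suc j \<longrightarrow> wd f A = 0" and A: "A \<subseteq> {1..n}" "card A = j"
      have "bd n (wd f) A = bd n (\<lambda>_. 0) A" by (rule bd_cong[OF A(1)]) (use 0 A in auto)
      then show "bd n (wd f) A = 0" by (simp add: bd_def)
    qed
    also have "\<dots> \<longleftrightarrow> v \<in> level_filtration n m"
      using True V(1,2) by (auto simp: level_filtration_def e f_def j_def[symmetric])
    finally show ?thesis by (simp add: j_def)
  next
    case False
    then have e: "Suc m div 2 = Suc j" "even (Suc m)" unfolding j_def by presburger+
    have "factor_map n m v = \<zero>\<^bsub>hook_rep n j\<^esub> \<longleftrightarrow> (\<forall>A\<subseteq>{1..n}. card A = j \<longrightarrow> bd n f A = 0)"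
      unfolding z factor_map_def j_def[symmetric] using False by (simp add: alt_eq_iff[OF k] f_def)
    also have "\<dots> \<longleftrightarrow> (\<forall>A\<subseteq>{1..n}. card A = Suc j \<longrightarrow> f A = 0)"
    proof (intro iffI allI impI)
      fix A assume 0: "\<forall>A\<subseteq>{1..n}. card A = j \<longrightarrow> bd n f A = 0" and A: "A \<subseteq> {1..n}" "card A = Suc j"
      have "bd n (wd f) A = bd n (\<lambda>_. 0) A"
        by (rule bd_cong[OF A(1)]) (use V(3)[OF e(2)] e(1) A in \<open>auto simp: f_def\<close>)
      moreover have "wd (bd n f) A = wd (\<lambda>_. 0) A" by (rule wd_cong[OF A(1)]) (use 0 A in auto)
      ultimately have "of_nat n * f A = 0" unfolding koszul_homotopy[OF A(1), symmetric] by (simp add: wd_def bd_def)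
      then show "f A = 0" using n0 by simp
    next
      fix A assume 0: "\<forall>A\<subseteq>{1..n}. card A = Suc j \<longrightarrow> f A = 0" and A: "A \<subseteq> {1..n}" "card A = j"
      have "bd n f A = bd n (\<lambda>_. 0) A" by (rule bd_cong[OF A(1)]) (use 0 A in auto)
      then show "bd n f A = 0" by (simp add: bd_def)
    qed
    also have "\<dots> \<longleftrightarrow> (\<forall>A\<subseteq>{1..n}. j < card A \<longrightarrow> f A = 0)"
      using V(2) unfolding e(1) f_def by (metis Suc_lessI lessI)
    also have "\<dots> \<longleftrightarrow> v \<in> level_filtration n m"
      using False V(1) by (auto simp: level_filtration_def f_def j_def[symmetric])
    finally show ?thesis by (simp add: j_def)
  qed
qed

lemma rep_iso_filtration_factor:
  assumes m: "m < 2 * n"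
  shows "rep_iso (MD n) (subquot (MD_rep n R S) (level_filtration n (Suc m)) (level_filtration n m))
    (hook_rep n (m div 2))"
proof (rule rep_iso_quot[OF rep_V invariant_filtration invariant_filtration filtration_mono])
  have k: "m div 2 < n" using m by simp
  show rep: "representation (MD n) (hook_rep n (m div 2))" by (rule representation_hook_rep[OF k])
  have sub: "v \<in> carrier_vec (2 ^ n)" if "v \<in> level_filtration n (Suc m)" for v using filtrationD(1)[OF that] .
  show "intertwiner (MD n) ((MD_rep n R S)\<lparr>carrier := level_filtration n (Suc m)\<rparr>) (hook_rep n (m div 2)) (factor_map n m)"
    by (rule intertwiner_MD[OF subrepresentation[OF rep_V invariant_filtration] rep])
      (use sub factor_map_linear[OF m] factor_map_act[OF m] in \<open>simp_all add: MD_rep_sel(3,4)\<close>)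
  show "factor_map n m ` level_filtration n (Suc m) = carrier (hook_rep n (m div 2))"
  proof
    show "factor_map n m ` level_filtration n (Suc m) \<subseteq> carrier (hook_rep n (m div 2))"
      by (rule image_subsetI) (rule factor_map_linear(1)[OF m])
    show "carrier (hook_rep n (m div 2)) \<subseteq> factor_map n m ` level_filtration n (Suc m)"
      using factor_map_surj[OF m] by (metis imageI subsetI)
  qed
  show "factor_map n m v = \<zero>\<^bsub>hook_rep n (m div 2)\<^esub> \<longleftrightarrow> v \<in> level_filtration n m"
    if "v \<in> level_filtration n (Suc m)" for v
    by (rule factor_map_kernel[OF m that])
qed

lemma composition_series_filtration:
  defines "Ws \<equiv> map (level_filtration n) [0..<Suc (2 * n)]"
  shows "composition_series (MD n) (MD_rep n R S) Ws"
    and "i < 2 * n \<Longrightarrow> rep_iso (MD n) (series_factor (MD_rep n R S) Ws i) (hook_rep n (i div 2))"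
    and "length Ws = Suc (2 * n)"
proof -
  have nth: "Ws ! i = level_filtration n i" if "i < Suc (2 * n)" for i
    using that by (simp add: Ws_def del: upt_Suc)
  show len: "length Ws = Suc (2 * n)" by (simp add: Ws_def)
  have iso: "rep_iso (MD n) (series_factor (MD_rep n R S) Ws i) (hook_rep n (i div 2))" if "i < 2 * n" for i
    using rep_iso_filtration_factor[OF that] that by (simp add: series_factor_def nth)
  then show "i < 2 * n \<Longrightarrow> rep_iso (MD n) (series_factor (MD_rep n R S) Ws i) (hook_rep n (i div 2))" .
  have irr: "irreducible_rep (MD n) (series_factor (MD_rep n R S) Ws i)" if i: "i < 2 * n" for i
  proof -
    have rep: "representation (MD n) (series_factor (MD_rep n R S) Ws i)"
      unfolding series_factor_def using i
      by (simp add: nth representation_quot_rep subrepresentation[OF rep_V] invariant_filtration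
          invariant_subspace_mono[OF rep_V] filtration_mono)
    have "i div 2 < n" using i by simp
    then show ?thesis using irreducible_rep_iso[OF irreducible_hook_rep rep rep_iso_sym[OF rep iso[OF i]]] by blast
  qed
  have ne: "Ws \<noteq> []" using len by auto
  have "hd Ws = {\<zero>\<^bsub>MD_rep n R S\<^esub>}" using ne filtration_0 nth[of 0] by (simp add: hd_conv_nth)
  moreover have "last Ws = carrier (MD_rep n R S)" using ne len filtration_top nth[of "2 * n"] by (simp add: last_conv_nth)
  moreover have "\<forall>W\<in>set Ws. invariant_subspace (MD n) (MD_rep n R S) W" by (auto simp: Ws_def invariant_filtration)
  moreover have "Ws ! i \<subseteq> Ws ! Suc i" if "Suc i < length Ws" for i
    using that filtration_mono len by (simp add: nth)
  ultimately show "composition_series (MD n) (MD_rep n R S) Ws"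
    using ne irr len by (simp add: composition_series_def)
qed

end

text \<open>The level filtration has \<open>2 * n\<close> factors, and factor \<open>i\<close> is
  the hook representation with leg \<open>i div 2\<close>. Since different hooks are not isomorphic,
  multiplicities can be read off there and transferred to any other series.\<close>

theorem proposition5p8:
  fixes p q :: complex and R S :: "complex mat" and n :: nat
  assumes "p \<noteq> q"
    and S: "S = mat_of_rows_list 4 [[1, 0, 0, p],
                                    [0, 0, 1, 0],
                                    [0, 1, 0, 0],
                                    [0, 0, 0, -1]]"
    and R: "R = mat_of_rows_list 4 [[1, 0, 0, q],
                                    [0, 0, 1, 0],
                                    [0, 1, 0, 0],
                                    [0, 0, 0, -1]]"
    and "n \<ge> 2"
  shows "(\<exists>Ws. composition_series (MD n) (MD_rep n R S) Ws) \<and>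
    (\<forall>Ws. composition_series (MD n) (MD_rep n R S) Ws \<longrightarrow>
       (\<forall>i. Suc i < length Ws \<longrightarrow>
          (\<exists>k<n. rep_iso (MD n) (series_factor (MD_rep n R S) Ws i) (hook_rep n k))) \<and>
       (\<forall>k<n. multiplicity_in_series (MD n) (MD_rep n R S) Ws (hook_rep n k) = 2)) \<and>
    (\<forall>k<n. \<forall>l<n. rep_iso (MD n) (hook_rep n k) (hook_rep n l) \<longrightarrow> k = l) \<and>
    (\<forall>k<n. irreducible_rep (MD n) (hook_rep n k) \<and>
       vectorspace.dim class_ring (hook_rep n k) = (n - 1) choose k)"
proof -
  have n1: "n \<ge> 1" using \<open>n \<ge> 2\<close> by simp
  define V where "V = MD_rep n R S"
  define Gs where "Gs = map (level_filtration n) [0..<Suc (2 * n)]"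
  have V: "representation (MD n) V" unfolding V_def by (rule rep_V[OF S R n1])
  have Gs: "composition_series (MD n) V Gs" "length Gs = Suc (2 * n)"
    and iso: "\<And>i. i < 2 * n \<Longrightarrow> rep_iso (MD n) (series_factor V Gs i) (hook_rep n (i div 2))"
    unfolding V_def Gs_def by (rule composition_series_filtration[OF S R n1], assumption?)+
  have factor_rep: "representation (MD n) (series_factor V Gs i)" if "i < 2 * n" for i
    using Gs that by (simp add: composition_series_def irreducible_rep_def)
  have factor_iff: "rep_iso (MD n) (series_factor V Gs i) (hook_rep n k) \<longleftrightarrow> i div 2 = k"
    if "i < 2 * n" "k < n" for i k
  proof
    assume "rep_iso (MD n) (series_factor V Gs i) (hook_rep n k)"
    then have "rep_iso (MD n) (hook_rep n (i div 2)) (hook_rep n k)"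
      using rep_iso_trans[OF rep_iso_sym[OF factor_rep iso]] that by blast
    then show "i div 2 = k" using hook_rep_iso_imp_eq[of "i div 2" n k] that by simp
  qed (use iso that in blast)
  have mult: "multiplicity_in_series (MD n) V Gs (hook_rep n k) = 2" if k: "k < n" for k
  proof -
    \<comment> \<open>The two solutions of \<open>i div 2 = k\<close> are the occurrences in degree
      \<open>k\<close> and in degree \<open>k + 1\<close> of the exterior algebra.\<close>
    have "{i. Suc i < length Gs \<and> rep_iso (MD n) (series_factor V Gs i) (hook_rep n k)} = {2 * k, Suc (2 * k)}"
      using k factor_iff unfolding Gs(2) by auto
    then show ?thesis unfolding multiplicity_in_series_def by simp
  qed
  have "(\<forall>i. Suc i < length Ws \<longrightarrow> (\<exists>k<n. rep_iso (MD n) (series_factor V Ws i) (hook_rep n k))) \<and>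
      (\<forall>k<n. multiplicity_in_series (MD n) V Ws (hook_rep n k) = 2)"
    if Ws: "composition_series (MD n) V Ws" for Ws
  proof -
    obtain h where h: "bij_betw h {i. Suc i < length Ws} {i. Suc i < length Gs}"
      "\<And>i. Suc i < length Ws \<Longrightarrow> rep_iso (MD n) (series_factor V Ws i) (series_factor V Gs (h i))"
      using Jordan_Hoelder[OF V Ws Gs(1)] by blast
    have "\<exists>k<n. rep_iso (MD n) (series_factor V Ws i) (hook_rep n k)" if i: "Suc i < length Ws" for i
    proof -
      have hi: "h i < 2 * n" using bij_betwE[OF h(1)] i Gs(2) by auto
      then show ?thesis using rep_iso_trans[OF h(2)[OF i] iso[OF hi]] by (intro exI[of _ "h i div 2"]) auto
    qed
    moreover have "multiplicity_in_series (MD n) V Ws (hook_rep n k) = 2" if "k < n" for k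
      using mult[OF that] multiplicity_eq[OF V Ws Gs(1), of "hook_rep n k"] by simp
    ultimately show ?thesis by simp
  qed
  then show ?thesis unfolding V_def[symmetric]
    using Gs(1) by (intro conjI allI impI exI[of _ Gs] irreducible_hook_rep dim_hook_rep)
      (simp_all add: hook_rep_iso_imp_eq)
qed

end
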